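(* Let $\mathbb{H}$ be an infinite-dimensional separable Hilbert space. For every $\alpha<1$ there exist a quasi-greedy basis $\mathscr{B}$ of $\mathbb{H}$ and a constant $c_\alpha>0$ such that $$k_N(\mathscr{B})\ge c_\alpha(\log N)^{\alpha}\qquad\text{for all integers }N\ge2 .$$ If $\alpha<1/2$, then $\mathscr{B}$ can be chosen to be, in addition, besselian; likewise, if $\alpha<1/2$, then $\mathscr{B}$ can be chosen to be, in addition, hilbertian.
   Context: A basis means a Schauder basis $\mathscr{B}=\{\mathbf{e}_j\}_{j=1}^\infty$ of a Banach space $\mathbb{X}$ (scalars in $\mathbb{C}$), normalized so that $\|\mathbf{e}_j\|=1$. Every $x$ is written $x=\sum_j a_j(x)\mathbf{e}_j$. For $N\ge1$, $G_N(x)=\sum_{j\in\Lambda}a_j(x)\mathbf{e}_j$, where $\Lambda\subset\{1,2,\dots\}$ is any $N$-element set with $\min_{j\in\Lambda}|a_j(x)|\ge\max_{j\notin\Lambda}|a_j(x)|$. The basis is quasi-greedy if $\lim_{N\to\infty}\|x-G_N(x)\|=0$ for every $x$ and every choice of the $G_N$'s; equivalently, there is a constant $K$ with $\|G_N(x)\|\le K\|x\|$ for all $x$, all $N\ge1$ and all choices of $G_N$. For finite $A\subset\{1,2,\dots\}$, $S_A(x)=\sum_{j\in A}a_j(x)\mathbf{e}_j$, and $k_N(\mathscr{B})=\sup_{|A|\le N}\|S_A\|$. The basis is besselian if there is $C$ with $\sum_j|a_j|^2\le C\|\sum_j a_j\mathbf{e}_j\|^2$ for all finitely supported scalar sequences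 $(a_j)$, and hilbertian if there is $C>0$ with $\sum_j|a_j|^2\ge C\|\sum_j a_j\mathbf{e}_j\|^2$ for all such sequences. *)

theory Defs
  imports "HOL-Analysis.Analysis"
begin

section \<open>Complex normed spaces and complex Hilbert spaces\<close>

class complex_normed_vector = real_normed_vector +
  fixes scaleC :: "complex \<Rightarrow> 'a \<Rightarrow> 'a"  (infixr \<open>*\<^sub>C\<close> 75)
  assumes scaleC_add_right: "c *\<^sub>C (x + y) = c *\<^sub>C x + c *\<^sub>C y"
    and scaleC_add_left: "(c + d) *\<^sub>C x = c *\<^sub>C x + d *\<^sub>C x"
    and scaleC_scaleC: "c *\<^sub>C (d *\<^sub>C x) = (c * d) *\<^sub>C x"
    and scaleC_one: "1 *\<^sub>C x = x"
    and scaleR_scaleC: "r *\<^sub>R x = complex_of_real r *\<^sub>C x"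
    and norm_scaleC: "norm (c *\<^sub>C x) = cmod c * norm x"

global_interpretation complex_vector:
  vector_space "scaleC :: complex \<Rightarrow> 'a \<Rightarrow> 'a::complex_normed_vector"
  by unfold_locales (simp_all add: scaleC_add_right scaleC_add_left scaleC_scaleC scaleC_one)

class complex_banach = complex_normed_vector + complete_space

text \<open>The inner product is linear in the first argument. The real inner product inherited from
  \<open>real_inner\<close> is its real part, so that the norm is the one given by \<open>cinner\<close>
  (see \<open>cinner_self\<close> below).\<close>

class complex_inner = complex_normed_vector + real_inner +
  fixes cinner :: "'a \<Rightarrow> 'a \<Rightarrow> complex"
  assumes cinner_commute: "cinner x y = cnj (cinner y x)"
    and cinner_add_left: "cinner (x + y) z = cinner x z + cinner y z"
    and cinner_scaleC_left: "cinner (c *\<^sub>C x) y = c * cinner x y"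
    and Re_cinner: "Re (cinner x y) = inner x y"

class complex_hilbert = complex_inner + complete_space

subclass (in complex_hilbert) complex_banach ..

lemma cinner_self: "cinner x x = complex_of_real ((norm x)\<^sup>2)"
  for x :: "'a::complex_inner"
proof (rule complex_eqI)
  show "Re (cinner x x) = Re (complex_of_real ((norm x)\<^sup>2))"
    by (simp add: Re_cinner power2_norm_eq_inner)
  have "Im (cinner x x) = - Im (cinner x x)"
    using arg_cong[where f = Im, OF cinner_commute[of x x]] by simp
  then show "Im (cinner x x) = Im (complex_of_real ((norm x)\<^sup>2))"
    by simp
qed


section \<open>Schauder bases, greedy sums and conditionality constants\<close>

text \<open>Basis vectors are indexed by \<open>nat\<close>, starting from 0.\<close>

definition schauder_basis :: "(nat \<Rightarrow> 'a::complex_banach) \<Rightarrow> bool" where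
  "schauder_basis e \<longleftrightarrow> (\<forall>x. \<exists>!a. (\<lambda>j. a j *\<^sub>C e j) sums x)"

definition normalized_basis :: "(nat \<Rightarrow> 'a::complex_banach) \<Rightarrow> bool" where
  "normalized_basis e \<longleftrightarrow> schauder_basis e \<and> (\<forall>j. norm (e j) = 1)"

definition basis_coeff :: "(nat \<Rightarrow> 'a::complex_banach) \<Rightarrow> 'a \<Rightarrow> nat \<Rightarrow> complex" where
  "basis_coeff e x = (THE a. (\<lambda>j. a j *\<^sub>C e j) sums x)"

definition basis_proj :: "(nat \<Rightarrow> 'a::complex_banach) \<Rightarrow> nat set \<Rightarrow> 'a \<Rightarrow> 'a" where
  "basis_proj e A x = (\<Sum>j\<in>A. basis_coeff e x j *\<^sub>C e j)"

definition greedy_set :: "(nat \<Rightarrow> 'a::complex_banach) \<Rightarrow> 'a \<Rightarrow> nat \<Rightarrow> nat set \<Rightarrow> bool" where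
  "greedy_set e x N \<Lambda> \<longleftrightarrow> finite \<Lambda> \<and> card \<Lambda> = N \<and>
     (\<forall>i\<in>\<Lambda>. \<forall>j. j \<notin> \<Lambda> \<longrightarrow> cmod (basis_coeff e x j) \<le> cmod (basis_coeff e x i))"

definition quasi_greedy_basis :: "(nat \<Rightarrow> 'a::complex_banach) \<Rightarrow> bool" where
  "quasi_greedy_basis e \<longleftrightarrow> normalized_basis e \<and>
     (\<forall>x \<Lambda>. (\<forall>N\<ge>1. greedy_set e x N (\<Lambda> N)) \<longrightarrow>
        (\<lambda>N. norm (x - basis_proj e (\<Lambda> N) x)) \<longlonglongrightarrow> 0)"

text \<open>For a normalized Schauder basis of a Banach space, the coefficient functionals are uniformly
  bounded, so \<open>onorm\<close> and the supremum below are suprema of bounded sets of reals.\<close>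

definition cond_const :: "(nat \<Rightarrow> 'a::complex_banach) \<Rightarrow> nat \<Rightarrow> real" where
  "cond_const e N = (SUP A \<in> {A. finite A \<and> card A \<le> N}. onorm (basis_proj e A))"

definition besselian :: "(nat \<Rightarrow> 'a::complex_banach) \<Rightarrow> bool" where
  "besselian e \<longleftrightarrow> (\<exists>C. \<forall>a. finite {j. a j \<noteq> 0} \<longrightarrow>
     (\<Sum>j | a j \<noteq> 0. (cmod (a j))\<^sup>2) \<le> C * (norm (\<Sum>j | a j \<noteq> 0. a j *\<^sub>C e j))\<^sup>2)"

definition hilbertian :: "(nat \<Rightarrow> 'a::complex_banach) \<Rightarrow> bool" where
  "hilbertian e \<longleftrightarrow> (\<exists>C>0. \<forall>a. finite {j. a j \<noteq> 0} \<longrightarrow>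
     (\<Sum>j | a j \<noteq> 0. (cmod (a j))\<^sup>2) \<ge> C * (norm (\<Sum>j | a j \<noteq> 0. a j *\<^sub>C e j))\<^sup>2)"

end

theory Submission
  imports Defs
begin

text \<open>Two constructions are combined. One turns polynomial conditionality of an auxiliary basis into
logarithmic conditionality and makes the basis quasi-greedy; the other supplies auxiliary bases
whose conditionality is polynomial of any exponent below 1.

The first one (after Dilworth, Kalton and Kutzarova) starts from an orthonormal basis \<open>u\<close> of
the Hilbert space. Cut its indices into consecutive blocks, block \<open>n\<close> having size \<open>3 * 4 ^ n\<close>,
let \<open>v n\<close> be the normalized sum of \<open>u\<close> over block \<open>n\<close>, and let \<open>x\<close> be any normalized Schauder
basis of the closed span of \<open>v\<close> that has the same finite linear combinations as \<open>v\<close>. In each \<open>u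
j\<close>, with \<open>j\<close> in block \<open>n\<close>, replace the component along \<open>v n\<close> by the same multiple of \<open>x n\<close>. The
squared norm of a combination with coefficients \<open>a\<close> then is the sum of the squared deviations
of \<open>a\<close> from its block means, plus the squared norm of the combination of the \<open>x n\<close> whose
coefficients are the block means of \<open>a\<close> scaled by the square root of the block size
(\<open>norm_sum_dkk\<close>). Coefficients that are suitably constant on blocks reproduce the combinations
of \<open>x\<close>, so that a badly bounded coordinate projection within the first \<open>n\<close> vectors \<open>x\<close> becomes
one on at most \<open>4 ^ n\<close> vectors, and \<open>n\<close> is a logarithm. Still, the basis is quasi-greedy
(\<open>dkk_greedy\<close>): the scaled block means are bounded by a multiple of the norm, so the block
means decay geometrically. For a greedy threshold \<open>t\<close>, on the late blocks, where the mean is at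
most \<open>t / 2\<close>, the selected coefficients are controlled by these deviations; the early blocks
have so few indices that the coefficients not selected, which are at most \<open>t\<close>, add up to a
multiple of the norm. What remains is a partial sum.

The second one uses orthonormal vectors indexed by the nodes of dyadic trees. The vector of a
leaf is the sum over its ancestors, with Haar signs, and with weight of the order of \<open>\<rho> ^
i\<close> (squared) at level \<open>i\<close>. Thus the squared norm of a combination weights the squared Haar
coefficients of level \<open>i\<close> by \<open>(2 * \<rho>) ^ i\<close>. For \<open>1/4 < \<rho> < 1\<close> cutting the
coefficients off at a point costs only a constant factor (\<open>trunc_bound\<close>), so this is a Schauder
basis; it is orthonormal for \<open>\<rho> = 1/2\<close>, besselian above and hilbertian below that value.
The sum of all \<open>2 ^ m\<close> leaves of a tree has squared norm \<open>(4 * \<rho>) ^ m\<close>. Now take two such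
systems, \<open>y\<close> with parameter \<open>\<rho>\<close> and \<open>y'\<close> with parameter \<open>\<rho>'\<close>, in orthogonal
subspaces, and let the auxiliary basis consist of the pairs \<open>(y n + y' n) / sqrt 2\<close> and \<open>(y n -
y' n) / sqrt 2\<close>. The differences of the pairs over a tree sum up to a vector that only involves
\<open>\<rho>'\<close>, whereas the projection onto the first members also sees \<open>\<rho>\<close>. With \<open>\<rho> = 2
powr (s - 1)\<close> and \<open>\<rho>' = 2 powr (t - 1)\<close>, \<open>-1 < t < s < 1\<close>, this projection has norm at
least \<open>(2 ^ m) powr ((s - t) / 2) / 2\<close> on about \<open>2 ^ m\<close> coordinates. The exponent takes every
value between 0 and 1; if \<open>t = 0\<close> (besselian) or \<open>s = 0\<close> (hilbertian), every value between 0
and \<open>1/2\<close>.\<close>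

section \<open>Orthonormal bases of separable complex Hilbert spaces\<close>

lemma cinner_add_right: "cinner x (y + z) = cinner x y + cinner x z"
  for x :: "'a::complex_inner"
  by (metis cinner_add_left cinner_commute complex_cnj_add)

lemma cinner_scaleC_right: "cinner x (c *\<^sub>C y) = cnj c * cinner x y"
  for x :: "'a::complex_inner"
  by (metis cinner_commute cinner_scaleC_left complex_cnj_mult)

lemma cinner_zero_left [simp]: "cinner 0 y = 0"
  for y :: "'a::complex_inner"
  using cinner_add_left[of 0 0 y] by simp

lemma cinner_zero_right [simp]: "cinner y 0 = 0"
  for y :: "'a::complex_inner"
  using cinner_add_right[of y 0 0] by simp

lemma cinner_minus_left: "cinner (- x) y = - cinner x y"
  for y :: "'a::complex_inner"
  using cinner_add_left[of x "- x" y] by (simp add: minus_unique)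

lemma cinner_diff_left: "cinner (x - z) y = cinner x y - cinner z y"
  for y :: "'a::complex_inner"
  using cinner_add_left[of x "- z" y] by (simp add: cinner_minus_left)

lemma cinner_diff_right: "cinner y (x - z) = cinner y x - cinner y z"
  for y :: "'a::complex_inner"
  by (metis cinner_diff_left cinner_commute complex_cnj_diff)

lemma cinner_sum_left: "cinner (\<Sum>i\<in>I. f i) y = (\<Sum>i\<in>I. cinner (f i) y)"
  for y :: "'a::complex_inner"
  by (induction I rule: infinite_finite_induct) (auto simp: cinner_add_left)

lemma cinner_sum_right: "cinner y (\<Sum>i\<in>I. f i) = (\<Sum>i\<in>I. cinner y (f i))"
  for y :: "'a::complex_inner"
  by (induction I rule: infinite_finite_induct) (auto simp: cinner_add_right)

lemmas cinner_simps = cinner_add_left cinner_add_right cinner_diff_left cinner_diff_right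
  cinner_scaleC_left cinner_scaleC_right cinner_sum_left cinner_sum_right

lemma norm_add_orthogonal:
  fixes x y :: "'a::complex_inner"
  assumes "cinner x y = 0"
  shows "(norm (x + y))\<^sup>2 = (norm x)\<^sup>2 + (norm y)\<^sup>2"
proof -
  have "cinner y x = 0"
    using assms by (metis cinner_commute complex_cnj_zero)
  then have "complex_of_real ((norm (x + y))\<^sup>2) = complex_of_real ((norm x)\<^sup>2 + (norm y)\<^sup>2)"
    using assms by (simp only: of_real_add cinner_self[symmetric] cinner_simps) simp
  then show ?thesis
    by (simp only: of_real_eq_iff)
qed

lemma cinner_eq_0_span:
  fixes x :: "'a::complex_inner"
  assumes "\<And>y. y \<in> Y \<Longrightarrow> cinner x y = 0" "z \<in> complex_vector.span Y"
  shows "cinner x z = 0"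
  using assms(2)
  by (induction rule: complex_vector.span_induct_alt) (auto simp: cinner_simps assms(1))

definition orthonormal :: "('i \<Rightarrow> 'a::complex_inner) \<Rightarrow> bool" where
  "orthonormal w \<longleftrightarrow> (\<forall>i j. cinner (w i) (w j) = (if i = j then 1 else 0))"

lemma orthonormalD: "orthonormal w \<Longrightarrow> cinner (w i) (w j) = (if i = j then 1 else 0)"
  by (simp add: orthonormal_def)

lemma orthonormal_norm: "orthonormal w \<Longrightarrow> norm (w i) = 1"
  using cinner_self[of "w i"] orthonormalD[of w i i]
  by (metis norm_ge_zero of_real_eq_1_iff power2_eq_1_iff abs_of_nonneg abs_1 power2_eq_iff_nonneg zero_le_one one_power2)

lemma orthonormal_cinner_sum:
  assumes "orthonormal w" "finite F"
  shows "cinner (\<Sum>i\<in>F. c i *\<^sub>C w i) (w k) = (if k \<in> F then c k else 0)"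
  using assms by (simp add: cinner_simps orthonormalD if_distrib cong: if_cong)

lemma orthonormal_norm_sum:
  assumes "orthonormal w" "finite F"
  shows "(norm (\<Sum>i\<in>F. c i *\<^sub>C w i))\<^sup>2 = (\<Sum>i\<in>F. (cmod (c i))\<^sup>2)"
proof -
  have "complex_of_real ((norm (\<Sum>i\<in>F. c i *\<^sub>C w i))\<^sup>2)
      = (\<Sum>k\<in>F. cnj (c k) * cinner (\<Sum>i\<in>F. c i *\<^sub>C w i) (w k))"
    by (subst cinner_self[symmetric]) (simp only: cinner_sum_right cinner_scaleC_right)
  also have "\<dots> = (\<Sum>k\<in>F. cnj (c k) * c k)"
    using assms by (intro sum.cong) (auto simp: orthonormal_cinner_sum)
  also have "\<dots> = complex_of_real (\<Sum>i\<in>F. (cmod (c i))\<^sup>2)"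
    by (simp only: of_real_sum complex_norm_square mult.commute)
  finally show ?thesis
    by (simp only: of_real_eq_iff)
qed

lemma orthonormal_comp: "orthonormal w \<Longrightarrow> inj f \<Longrightarrow> orthonormal (\<lambda>i. w (f i))"
  by (simp add: orthonormal_def inj_eq)

definition projection_residual :: "'a::complex_inner set \<Rightarrow> 'a \<Rightarrow> 'a" where
  "projection_residual B x = x - (\<Sum>b\<in>B. cinner x b *\<^sub>C b)"

text \<open>Gram-Schmidt orthonormalization in terms of finite orthonormal sets: a vector that already lies
in the span contributes nothing, so that linearly dependent sequences need no preparation.\<close>

definition gram_schmidt_step :: "'a::complex_inner set \<Rightarrow> 'a \<Rightarrow> 'a set" where
  "gram_schmidt_step B x = (if projection_residual B x = 0 then B
     else insert (complex_of_real (inverse (norm (projection_residual B x))) *\<^sub>C projection_residual B x) B)"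

definition orthonormal_set :: "'a::complex_inner set \<Rightarrow> bool" where
  "orthonormal_set B \<longleftrightarrow> (\<forall>b\<in>B. \<forall>b'\<in>B. cinner b b' = (if b = b' then 1 else 0))"

lemma projection_residual_orthogonal:
  assumes "finite B" "orthonormal_set B" "b \<in> B"
  shows "cinner (projection_residual B x) b = 0"
proof -
  have "(\<Sum>b'\<in>B. cinner x b' * cinner b' b) = (\<Sum>b'\<in>B. if b' = b then cinner x b else 0)"
    using assms by (intro sum.cong) (auto simp: orthonormal_set_def)
  also have "\<dots> = cinner x b" using assms by simp
  finally show ?thesis
    by (simp add: projection_residual_def cinner_simps)
qed

lemma projection_residual_span:
  "x - projection_residual B x \<in> complex_vector.span B"
proof -
  have "(\<Sum>b\<in>B. cinner x b *\<^sub>C b) \<in> complex_vector.span B"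
    by (intro complex_vector.span_sum complex_vector.span_scale complex_vector.span_base)
  then show ?thesis by (simp add: projection_residual_def)
qed

lemma gram_schmidt_step:
  assumes "finite B" "orthonormal_set B"
  shows "finite (gram_schmidt_step B x)" "orthonormal_set (gram_schmidt_step B x)" "B \<subseteq> gram_schmidt_step B x"
    "x \<in> complex_vector.span (gram_schmidt_step B x)"
proof -
  let ?r = "projection_residual B x"
  let ?n = "complex_of_real (inverse (norm ?r)) *\<^sub>C ?r"
  show "finite (gram_schmidt_step B x)" using assms by (simp add: gram_schmidt_step_def)
  show "B \<subseteq> gram_schmidt_step B x" by (auto simp: gram_schmidt_step_def)
  have 1: "cinner ?n b = 0" "cinner b ?n = 0" if "b \<in> B" for b
    using projection_residual_orthogonal[OF assms that, of x] cinner_commute[of b ?n]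
    by (simp_all add: cinner_simps)
  have 2: "cinner ?n ?n = 1" if "?r \<noteq> 0"
    using that by (simp add: cinner_self power2_eq_square norm_scaleC norm_inverse)
  show "orthonormal_set (gram_schmidt_step B x)"
    using assms(2) 1 2 unfolding orthonormal_set_def gram_schmidt_step_def
    by (auto; metis zero_neq_one)
  have "?r \<in> complex_vector.span (gram_schmidt_step B x)"
  proof (cases "?r = 0")
    case True
    then show ?thesis by (metis complex_vector.span_zero)
  next
    case False
    then have "complex_of_real (norm ?r) *\<^sub>C ?n \<in> complex_vector.span (gram_schmidt_step B x)"
      by (intro complex_vector.span_scale complex_vector.span_base) (simp add: gram_schmidt_step_def)
    then show ?thesis using False by (simp add: scaleC_scaleC scaleC_one)
  qed
  moreover have "x - ?r \<in> complex_vector.span (gram_schmidt_step B x)"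
    using projection_residual_span[of x B] complex_vector.span_mono[OF \<open>B \<subseteq> gram_schmidt_step B x\<close>] by blast
  ultimately show "x \<in> complex_vector.span (gram_schmidt_step B x)"
    using complex_vector.span_add by fastforce
qed

primrec gram_schmidt :: "(nat \<Rightarrow> 'a::complex_inner) \<Rightarrow> nat \<Rightarrow> 'a set" where
  "gram_schmidt d 0 = {}"
| "gram_schmidt d (Suc n) = gram_schmidt_step (gram_schmidt d n) (d n)"

lemma gram_schmidt_finite_orthonormal: "finite (gram_schmidt d n) \<and> orthonormal_set (gram_schmidt d n)"
  by (induction n) (auto simp: gram_schmidt_step(1,2), simp add: orthonormal_set_def)

lemma gram_schmidt_mono: "m \<le> n \<Longrightarrow> gram_schmidt d m \<subseteq> gram_schmidt d n"
  by (rule lift_Suc_mono_le) (simp_all add: gram_schmidt_step(3) gram_schmidt_finite_orthonormal)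

lemma dense_sequence:
  assumes "separable_space (euclidean :: 'a::real_normed_vector topology)"
  obtains d :: "nat \<Rightarrow> 'a::real_normed_vector" where "closure (range d) = UNIV"
proof -
  obtain C :: "'a set" where C: "countable C" "closure C = UNIV"
    using assms by (auto simp: separable_space_def)
  then have "C \<noteq> {}" by auto
  then have "range (from_nat_into C) = C" using C(1) by (rule range_from_nat_into)
  then show ?thesis using that[of "from_nat_into C"] C(2) by simp
qed

text \<open>Orthonormalize a dense sequence. If only finitely many vectors came out, their span, which is
closed, would contain the dense sequence: the residual of any vector is orthogonal to all
members of the sequence and nevertheless approximated by them, hence zero.\<close>

lemma exists_orthonormal_basis:
  assumes sep: "separable_space (euclidean :: 'a::complex_inner topology)"
    and inf: "\<nexists>B :: 'a::complex_inner set. finite B \<and> complex_vector.span B = UNIV"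
  obtains u :: "nat \<Rightarrow> 'a::complex_inner" where "orthonormal u" "closure (complex_vector.span (range u)) = UNIV"
proof -
  obtain d :: "nat \<Rightarrow> 'a" where d: "closure (range d) = UNIV"
    using dense_sequence[OF sep] by blast
  define B where "B = (\<Union>n. gram_schmidt d n)"
  have on: "orthonormal_set B"
    unfolding orthonormal_set_def
  proof (intro ballI)
    fix b b' assume "b \<in> B" "b' \<in> B"
    then obtain m n where "b \<in> gram_schmidt d m" "b' \<in> gram_schmidt d n" by (auto simp: B_def)
    then have "b \<in> gram_schmidt d (max m n)" "b' \<in> gram_schmidt d (max m n)"
      using gram_schmidt_mono[of m "max m n" d] gram_schmidt_mono[of n "max m n" d] by auto
    then show "cinner b b' = (if b = b' then 1 else 0)"
      using gram_schmidt_finite_orthonormal[of d "max m n"] by (simp add: orthonormal_set_def)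
  qed
  have dB: "range d \<subseteq> complex_vector.span B"
  proof clarify
    fix n
    have "d n \<in> complex_vector.span (gram_schmidt d (Suc n))"
      using gram_schmidt_step(4) gram_schmidt_finite_orthonormal by auto
    moreover have "gram_schmidt d (Suc n) \<subseteq> B"
      unfolding B_def by blast
    ultimately show "d n \<in> complex_vector.span B"
      using complex_vector.span_mono by blast
  qed
  have inf': "infinite B"
  proof
    assume fin: "finite B"
    have "projection_residual B x = 0" for x
    proof -
      let ?r = "projection_residual B x"
      have *: "cinner ?r y = 0" if "y \<in> complex_vector.span B" for y
        using projection_residual_orthogonal[OF fin on] that by (rule cinner_eq_0_span)
      have "?r \<in> closure (range d)" using d by simp
      then have "\<exists>y\<in>range d. dist y ?r < e" if "e > 0" for e
        using that closure_approachable by blast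
      moreover have "norm ?r \<le> dist y ?r" if "y \<in> range d" for y
      proof -
        have "cinner ?r (- y) = 0" 
          using * dB that by (metis cinner_diff_right cinner_zero_right diff_0 diff_zero subsetD)
        then have "(norm (?r + - y))\<^sup>2 = (norm ?r)\<^sup>2 + (norm (- y))\<^sup>2"
          by (rule norm_add_orthogonal)
        then have "(norm ?r)\<^sup>2 \<le> (dist y ?r)\<^sup>2"
          by (simp add: dist_norm norm_minus_commute)
        then show ?thesis by (rule power2_le_imp_le) simp
      qed
      ultimately show ?thesis
        by (metis norm_eq_zero norm_ge_zero less_le not_le)
    qed
    then have "complex_vector.span B = UNIV"
      using projection_residual_span[of _ B] by auto
    then show False using inf fin by blast
  qed
  have "countable B"
    unfolding B_def using gram_schmidt_finite_orthonormal countable_finite by blast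
  with inf' obtain u :: "nat \<Rightarrow> 'a" where u: "bij_betw u UNIV B"
    using bij_betw_from_nat_into by blast
  have "orthonormal u"
    using on u unfolding orthonormal_def orthonormal_set_def bij_betw_def inj_def by (metis rangeI)
  moreover have "closure (complex_vector.span (range u)) = UNIV"
    using dB d closure_mono u unfolding bij_betw_def by blast
  ultimately show ?thesis by (rule that)
qed

section \<open>Criteria for Schauder and quasi-greedy bases\<close>

lemma bounded_linear_scaleC_left: "bounded_linear (\<lambda>c. c *\<^sub>C (x :: 'a::complex_normed_vector))"
  by (rule bounded_linear_intro[where K = "norm x"])
    (simp_all add: scaleC_add_left scaleR_scaleC scaleC_scaleC norm_scaleC scaleR_conv_of_real)

lemma span_range_finite_sum:
  fixes e :: "nat \<Rightarrow> 'a::complex_normed_vector"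
  assumes "y \<in> complex_vector.span (range e)"
  shows "\<exists>n a. y = (\<Sum>j<n. a j *\<^sub>C e j)"
  using assms
proof (induction rule: complex_vector.span_induct_alt)
  case base
  show ?case by (rule exI[of _ 0]) simp
next
  case (step c x y)
  then obtain i n a where *: "x = e i" "y = (\<Sum>j<n. a j *\<^sub>C e j)" by auto
  define N where "N = max n (Suc i)"
  have "(\<Sum>j<N. ((if j < n then a j else 0) + (if j = i then c else 0)) *\<^sub>C e j)
      = (\<Sum>j<N. if j < n then a j *\<^sub>C e j else 0) + (\<Sum>j<N. if j = i then c *\<^sub>C e j else 0)"
    unfolding sum.distrib[symmetric] by (intro sum.cong) (auto simp: scaleC_add_left)
  also have "(\<Sum>j<N. if j < n then a j *\<^sub>C e j else 0) = y"
    unfolding * by (rule sum.mono_neutral_cong_right) (auto simp: N_def)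
  also have "(\<Sum>j<N. if j = i then c *\<^sub>C e j else 0) = c *\<^sub>C x"
    by (auto simp: * N_def)
  finally have "c *\<^sub>C x + y
      = (\<Sum>j<N. ((if j < n then a j else 0) + (if j = i then c else 0)) *\<^sub>C e j)"
    by (simp only: add.commute)
  then show ?case
    by (intro exI[of _ N] exI[of _ "\<lambda>j. (if j < n then a j else 0) + (if j = i then c else 0)"])
qed

text \<open>Density together with uniformly bounded partial sums of finite combinations is the usual
criterion for a Schauder basis.\<close>

locale schauder_system =
  fixes e :: "nat \<Rightarrow> 'a::complex_banach" and K :: real
  assumes norm_e: "norm (e j) = 1"
    and dense: "closure (complex_vector.span (range e)) = UNIV"
    and partial_sum_le: "m \<le> n \<Longrightarrow> norm (\<Sum>j<m. a j *\<^sub>C e j) \<le> K * norm (\<Sum>j<n. a j *\<^sub>C e j)"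
begin

lemma K_ge_1: "1 \<le> K"
  using partial_sum_le[of 1 1 "\<lambda>_. 1"] by (simp add: norm_e scaleC_one)

lemma partial_sum_le_limit:
  assumes "(\<lambda>j. a j *\<^sub>C e j) sums x"
  shows "norm (\<Sum>j<m. a j *\<^sub>C e j) \<le> K * norm x"
proof (rule LIMSEQ_le_const)
  show "(\<lambda>n. K * norm (\<Sum>j<n. a j *\<^sub>C e j)) \<longlonglongrightarrow> K * norm x"
    using assms unfolding sums_def by (intro tendsto_intros)
  show "\<exists>N. \<forall>n\<ge>N. norm (\<Sum>j<m. a j *\<^sub>C e j) \<le> K * norm (\<Sum>j<n. a j *\<^sub>C e j)"
    using partial_sum_le by blast
qed

lemma coeff_le_limit:
  assumes "(\<lambda>j. a j *\<^sub>C e j) sums x"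
  shows "cmod (a j) \<le> 2 * K * norm x"
proof -
  have "cmod (a j) = norm ((\<Sum>j<Suc j. a j *\<^sub>C e j) - (\<Sum>j<j. a j *\<^sub>C e j))"
    by (simp add: norm_scaleC norm_e)
  also have "\<dots> \<le> norm (\<Sum>j<Suc j. a j *\<^sub>C e j) + norm (\<Sum>j<j. a j *\<^sub>C e j)"
    by (rule norm_triangle_ineq4)
  also have "\<dots> \<le> K * norm x + K * norm x"
    using assms by (intro add_mono partial_sum_le_limit)
  finally show ?thesis by simp
qed

lemma coeff_le:
  assumes "j < n"
  shows "cmod (a j) \<le> 2 * K * norm (\<Sum>j<n. a j *\<^sub>C e j)"
proof -
  have "(\<lambda>i. (if i < n then a i else 0) *\<^sub>C e i) sums (\<Sum>i<n. (if i < n then a i else 0) *\<^sub>C e i)"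
    by (rule sums_finite) auto
  from coeff_le_limit[OF this, of j] show ?thesis
    using assms by simp
qed

lemma expansion_unique:
  assumes "(\<lambda>j. a j *\<^sub>C e j) sums x" "(\<lambda>j. b j *\<^sub>C e j) sums x"
  shows "a = b"
proof
  fix j
  have "(\<lambda>j. (a j - b j) *\<^sub>C e j) sums (x - x)"
    using sums_diff[OF assms] by (simp add: complex_vector.scale_left_diff_distrib)
  from coeff_le_limit[OF this, of j] show "a j = b j" by simp
qed

text \<open>Finite combinations \<open>y k\<close> converge to \<open>x\<close>. The coefficients of \<open>y k\<close> form Cauchy sequences, and
the bound on partial sums passes to the limit uniformly in the number of terms, which is what
the convergence of the limiting expansion requires.\<close>

lemma expansion_exists: "\<exists>a. (\<lambda>j. a j *\<^sub>C e j) sums x"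
proof -
  have "x \<in> closure (complex_vector.span (range e))" using dense by simp
  then obtain y where y: "\<And>k. y k \<in> complex_vector.span (range e)" "y \<longlonglongrightarrow> x"
    by (auto simp: closure_sequential)
  then have "\<forall>k. \<exists>n a. y k = (\<Sum>j<n. a j *\<^sub>C e j)"
    using span_range_finite_sum by blast
  then obtain n a where na: "\<And>k. y k = (\<Sum>j<n k. a k j *\<^sub>C e j)" by metis
  define A where "A k j = (if j < n k then a k j else 0)" for k j
  have A: "(\<lambda>j. A k j *\<^sub>C e j) sums y k" for k
  proof -
    have "(\<lambda>j. A k j *\<^sub>C e j) sums (\<Sum>j<n k. A k j *\<^sub>C e j)"
      by (rule sums_finite) (auto simp: A_def)
    also have "(\<Sum>j<n k. A k j *\<^sub>C e j) = y k"
      by (simp add: na A_def)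
    finally show ?thesis .
  qed
  have Adiff: "(\<lambda>j. (A k j - A l j) *\<^sub>C e j) sums (y k - y l)" for k l
    using sums_diff[OF A A] by (simp add: complex_vector.scale_left_diff_distrib)
  have "Cauchy (\<lambda>k. A k j)" for j
  proof (rule metric_CauchyI)
    fix r :: real assume "r > 0"
    then have "r / (2 * K) > 0" using K_ge_1 by simp
    then obtain N where N: "\<And>k l. k \<ge> N \<Longrightarrow> l \<ge> N \<Longrightarrow> dist (y k) (y l) < r / (2 * K)"
      using metric_CauchyD[OF LIMSEQ_imp_Cauchy[OF y(2)]] by blast
    have "dist (A k j) (A l j) < r" if "k \<ge> N" "l \<ge> N" for k l
    proof -
      have "dist (A k j) (A l j) \<le> 2 * K * dist (y k) (y l)"
        using coeff_le_limit[OF Adiff] by (simp add: dist_norm)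
      also have "\<dots> < r"
        using N[OF that] K_ge_1 by (simp add: field_simps)
      finally show ?thesis .
    qed
    then show "\<exists>M. \<forall>m\<ge>M. \<forall>n\<ge>M. dist (A m j) (A n j) < r" by blast
  qed
  then have "\<forall>j. \<exists>l. (\<lambda>k. A k j) \<longlonglongrightarrow> l"
    by (simp add: Cauchy_convergent_iff convergent_def)
  then obtain b where b: "\<And>j. (\<lambda>k. A k j) \<longlonglongrightarrow> b j" by metis
  have b_le: "norm (\<Sum>j<m. (A k j - b j) *\<^sub>C e j) \<le> K * norm (y k - x)" for k m
  proof (rule LIMSEQ_le)
    show "(\<lambda>l. norm (\<Sum>j<m. (A k j - A l j) *\<^sub>C e j)) \<longlonglongrightarrow> norm (\<Sum>j<m. (A k j - b j) *\<^sub>C e j)"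
      by (intro tendsto_intros bounded_linear.tendsto[OF bounded_linear_scaleC_left] b)
    show "(\<lambda>l. K * norm (y k - y l)) \<longlonglongrightarrow> K * norm (y k - x)"
      by (intro tendsto_intros y(2))
    show "\<exists>N. \<forall>l\<ge>N. norm (\<Sum>j<m. (A k j - A l j) *\<^sub>C e j) \<le> K * norm (y k - y l)"
      using partial_sum_le_limit[OF Adiff] by blast
  qed
  have "(\<lambda>j. b j *\<^sub>C e j) sums x"
    unfolding sums_def
  proof (rule LIMSEQ_I)
    fix r :: real assume "r > 0"
    then have "r / (2 * (K + 1)) > 0" using K_ge_1 by simp
    then obtain k where k: "norm (y k - x) < r / (2 * (K + 1))"
      using LIMSEQ_D[OF y(2)] by blast
    obtain N where N: "\<And>m. m \<ge> N \<Longrightarrow> norm ((\<Sum>j<m. A k j *\<^sub>C e j) - y k) < r / 2"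
      using LIMSEQ_D[OF A[unfolded sums_def], of "r / 2"] \<open>r > 0\<close> by auto
    have "norm ((\<Sum>j<m. b j *\<^sub>C e j) - x) < r" if "m \<ge> N" for m
    proof -
      have "(\<Sum>j<m. b j *\<^sub>C e j) - x
          = - (\<Sum>j<m. (A k j - b j) *\<^sub>C e j) + ((\<Sum>j<m. A k j *\<^sub>C e j) - y k) + (y k - x)"
        by (simp add: complex_vector.scale_left_diff_distrib sum_subtractf)
      also have "norm \<dots> \<le> norm (- (\<Sum>j<m. (A k j - b j) *\<^sub>C e j))
          + norm ((\<Sum>j<m. A k j *\<^sub>C e j) - y k) + norm (y k - x)"
        by (rule order_trans[OF norm_triangle_ineq add_right_mono[OF norm_triangle_ineq]])
      also have "\<dots> < K * norm (y k - x) + r / 2 + norm (y k - x)"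
        using b_le[of k m] N[OF that] by simp
      also have "\<dots> = (K + 1) * norm (y k - x) + r / 2"
        by (simp add: algebra_simps)
      also have "\<dots> < r"
        using k K_ge_1 by (simp add: field_simps)
      finally show ?thesis .
    qed
    then show "\<exists>N. \<forall>m\<ge>N. norm ((\<Sum>j<m. b j *\<^sub>C e j) - x) < r" by blast
  qed
  then show ?thesis by blast
qed

lemma normalized_basis: "normalized_basis e"
  unfolding normalized_basis_def schauder_basis_def
  using expansion_exists expansion_unique norm_e by blast

lemma basis_coeff_eqI: "(\<lambda>j. a j *\<^sub>C e j) sums x \<Longrightarrow> basis_coeff e x = a"
  unfolding basis_coeff_def using expansion_unique by blast

lemma basis_coeff_sums: "(\<lambda>j. basis_coeff e x j *\<^sub>C e j) sums x"
  using expansion_exists basis_coeff_eqI by metis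

lemma basis_coeff_finite_sum:
  assumes "finite F"
  shows "basis_coeff e (\<Sum>j\<in>F. a j *\<^sub>C e j) j = (if j \<in> F then a j else 0)"
proof -
  have "(\<lambda>j. (if j \<in> F then a j else 0) *\<^sub>C e j) sums (\<Sum>j\<in>F. (if j \<in> F then a j else 0) *\<^sub>C e j)"
    using assms by (intro sums_finite) auto
  from basis_coeff_eqI[OF this] show ?thesis by simp
qed

lemma basis_coeff_le: "cmod (basis_coeff e x j) \<le> 2 * K * norm x"
  by (rule coeff_le_limit[OF basis_coeff_sums])

lemma basis_coeff_tendsto_0: "basis_coeff e x \<longlonglongrightarrow> 0"
proof -
  have "(\<lambda>j. basis_coeff e x j *\<^sub>C e j) \<longlonglongrightarrow> 0"
    by (rule summable_LIMSEQ_zero[OF sums_summable[OF basis_coeff_sums]])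
  then have "(\<lambda>j. norm (basis_coeff e x j *\<^sub>C e j)) \<longlonglongrightarrow> 0"
    by (rule tendsto_norm_zero)
  then show ?thesis
    by (simp only: norm_scaleC norm_e mult_1_right tendsto_norm_zero_iff)
qed

lemma norm_basis_proj_le: "norm (basis_proj e A x) \<le> real (card A) * (2 * K) * norm x"
proof -
  have "norm (basis_proj e A x) \<le> (\<Sum>j\<in>A. 2 * K * norm x)"
    unfolding basis_proj_def
    by (rule sum_norm_le) (simp add: norm_scaleC norm_e basis_coeff_le)
  then show ?thesis by (simp add: mult_ac)
qed

lemma bounded_linear_basis_proj: "bounded_linear (basis_proj e A)"
proof (rule bounded_linear_intro[where K = "real (card A) * (2 * K)"])
  have add: "basis_coeff e (x + y) = (\<lambda>j. basis_coeff e x j + basis_coeff e y j)" for x y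
    by (rule basis_coeff_eqI)
      (use sums_add[OF basis_coeff_sums[of x] basis_coeff_sums[of y]] in \<open>simp add: scaleC_add_left\<close>)
  have scale: "basis_coeff e (r *\<^sub>R x) = (\<lambda>j. complex_of_real r * basis_coeff e x j)" for r x
    by (rule basis_coeff_eqI)
      (use bounded_linear.sums[OF bounded_linear_scaleR_right basis_coeff_sums[of x]]
        in \<open>simp add: scaleR_scaleC scaleC_scaleC\<close>)
  show "basis_proj e A (x + y) = basis_proj e A x + basis_proj e A y" for x y
    by (simp add: basis_proj_def add scaleC_add_left sum.distrib)
  show "basis_proj e A (r *\<^sub>R x) = r *\<^sub>R basis_proj e A x" for r x
    unfolding basis_proj_def scale by (simp add: scaleR_scaleC complex_vector.scale_sum_right scaleC_scaleC)
  show "norm (basis_proj e A x) \<le> norm x * (real (card A) * (2 * K))" for x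
    using norm_basis_proj_le[of A x] by (simp add: mult_ac)
qed

lemma onorm_le_cond_const:
  assumes "finite A" "card A \<le> N"
  shows "onorm (basis_proj e A) \<le> cond_const e N"
  unfolding cond_const_def
proof (rule cSUP_upper)
  show "A \<in> {A. finite A \<and> card A \<le> N}" using assms by simp
  show "bdd_above ((\<lambda>A. onorm (basis_proj e A)) ` {A. finite A \<and> card A \<le> N})"
  proof (rule bdd_aboveI2)
    fix A :: "nat set" assume "A \<in> {A. finite A \<and> card A \<le> N}"
    then have "real (card A) * (2 * K) \<le> real N * (2 * K)"
      using K_ge_1 by (intro mult_right_mono) auto
    moreover have "onorm (basis_proj e A) \<le> real (card A) * (2 * K)"
      using norm_basis_proj_le K_ge_1 by (intro onorm_bound) auto
    ultimately show "onorm (basis_proj e A) \<le> real N * (2 * K)" by linarith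
  qed
qed

lemma cond_const_ge:
  assumes "finite F" "A \<subseteq> F" "card A \<le> N"
    and "(\<Sum>j\<in>F. a j *\<^sub>C e j) \<noteq> 0"
  shows "norm (\<Sum>j\<in>A. a j *\<^sub>C e j) / norm (\<Sum>j\<in>F. a j *\<^sub>C e j) \<le> cond_const e N"
proof -
  let ?x = "\<Sum>j\<in>F. a j *\<^sub>C e j"
  have "basis_proj e A ?x = (\<Sum>j\<in>A. a j *\<^sub>C e j)"
    unfolding basis_proj_def using assms by (intro sum.cong) (auto simp: basis_coeff_finite_sum)
  then have "norm (\<Sum>j\<in>A. a j *\<^sub>C e j) \<le> onorm (basis_proj e A) * norm ?x"
    using onorm[OF bounded_linear_basis_proj, of A ?x] by simp
  also have "\<dots> \<le> cond_const e N * norm ?x"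
    using assms finite_subset by (intro mult_right_mono onorm_le_cond_const) auto
  finally show ?thesis
    using assms(4) by (simp add: divide_simps)
qed

lemma cond_const_ge_1: "N \<ge> 1 \<Longrightarrow> 1 \<le> cond_const e N"
  using cond_const_ge[of "{0}" "{0}" N "\<lambda>_. 1"] norm_e[of 0] norm_zero[where 'a = 'a]
  by (cases "e 0 = 0") (simp_all add: scaleC_one)

text \<open>The inequality for finite combinations passes to all vectors by approximation, since a greedy
set that lies below \<open>n\<close> is also greedy for the partial sum of length \<open>n\<close>. Convergence then
follows by removing a long partial sum from \<open>x\<close>: only finitely many coefficients are at least
as large as a given nonzero one, so its nonzero coefficients are eventually selected, and what
is selected beyond them is a greedy sum of the small tail.\<close>

lemma quasi_greedyI:
  assumes greedy: "\<And>M G a t. t > 0 \<Longrightarrow> G \<subseteq> {..<M} \<Longrightarrow> (\<And>j. j \<in> G \<Longrightarrow> t \<le> cmod (a j)) \<Longrightarrow>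
      (\<And>j. j < M \<Longrightarrow> j \<notin> G \<Longrightarrow> cmod (a j) \<le> t) \<Longrightarrow>
      norm (\<Sum>j\<in>G. a j *\<^sub>C e j) \<le> C * norm (\<Sum>j<M. a j *\<^sub>C e j)"
  shows "quasi_greedy_basis e"
proof -
  have C: "1 \<le> C"
    using greedy[of 1 "{0}" 1 "\<lambda>_. 1"] by (simp add: norm_e scaleC_one)
  have lim: "norm (\<Sum>j\<in>G. a j *\<^sub>C e j) \<le> C * norm x"
    if x: "(\<lambda>j. a j *\<^sub>C e j) sums x" and G: "finite G" "\<And>i j. i \<in> G \<Longrightarrow> j \<notin> G \<Longrightarrow> cmod (a j) \<le> cmod (a i)"
    for a x G
  proof (cases "\<exists>i\<in>G. a i = 0")
    case True
    then have "a j = 0" if "j \<notin> G" for j using G(2) that by fastforce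
    then have "(\<lambda>j. a j *\<^sub>C e j) sums (\<Sum>j\<in>G. a j *\<^sub>C e j)"
      using G(1) by (intro sums_finite) auto
    with x have *: "(\<Sum>j\<in>G. a j *\<^sub>C e j) = x" by (rule sums_unique2[rotated])
    show ?thesis unfolding * using C by (simp add: mult_le_cancel_right1)
  next
    case False
    show ?thesis
    proof (cases "G = {}")
      case True
      then show ?thesis using C by simp
    next
      case nonempty: False
      define t where "t = Min ((\<lambda>i. cmod (a i)) ` G)"
      have t: "t \<in> (\<lambda>i. cmod (a i)) ` G" "\<And>i. i \<in> G \<Longrightarrow> t \<le> cmod (a i)"
        using G(1) nonempty by (auto simp: t_def)
      have t0: "t > 0" using t(1) False by auto
      have t': "cmod (a j) \<le> t" if "j \<notin> G" for j
        using t(1) G(2) that by blast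
      obtain m where m: "G \<subseteq> {..<m}" using G(1) finite_nat_bounded by blast
      show ?thesis
      proof (rule LIMSEQ_le_const)
        show "(\<lambda>n. C * norm (\<Sum>j<n. a j *\<^sub>C e j)) \<longlonglongrightarrow> C * norm x"
          using x unfolding sums_def by (intro tendsto_intros)
        have "norm (\<Sum>j\<in>G. a j *\<^sub>C e j) \<le> C * norm (\<Sum>j<n. a j *\<^sub>C e j)" if "n \<ge> m" for n
          using m that t(2) t' by (intro greedy[OF t0]) auto
        then show "\<exists>N. \<forall>n\<ge>N. norm (\<Sum>j\<in>G. a j *\<^sub>C e j) \<le> C * norm (\<Sum>j<n. a j *\<^sub>C e j)"
          by blast
      qed
    qed
  qed
  show ?thesis
    unfolding quasi_greedy_basis_def
  proof (intro conjI allI impI normalized_basis)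
    fix x \<Lambda> assume gr: "\<forall>N\<ge>1. greedy_set e x N (\<Lambda> N)"
    define a where "a = basis_coeff e x"
    have a: "(\<lambda>j. a j *\<^sub>C e j) sums x" unfolding a_def by (rule basis_coeff_sums)
    have fin: "finite {i. cmod (a j) \<le> cmod (a i)}" if "a j \<noteq> 0" for j
    proof -
      have "eventually (\<lambda>i. dist (a i) 0 < cmod (a j)) sequentially"
        using basis_coeff_tendsto_0[of x] that unfolding a_def by (intro tendstoD) auto
      then obtain m where "\<And>i. i \<ge> m \<Longrightarrow> cmod (a i) < cmod (a j)"
        by (auto simp: eventually_sequentially)
      then have "{i. cmod (a j) \<le> cmod (a i)} \<subseteq> {..<m}" 
        by (auto simp: not_le[symmetric])
      then show ?thesis by (rule finite_subset) simp
    qed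
    show "(\<lambda>N. norm (x - basis_proj e (\<Lambda> N) x)) \<longlonglongrightarrow> 0"
    proof (rule LIMSEQ_I)
      fix r :: real assume "r > 0"
      then have "r / (1 + C) > 0" using C by simp
      then obtain m where m: "norm ((\<Sum>j<m. a j *\<^sub>C e j) - x) < r / (1 + C)"
        using LIMSEQ_D[OF a[unfolded sums_def]] by blast
      \<comment> \<open>Once more indices are selected than there are coefficients at least as large as \<open>a j\<close>, the index \<open>j\<close> is selected.\<close>
      define L where "L = Suc (\<Sum>j | j < m \<and> a j \<noteq> 0. card {i. cmod (a j) \<le> cmod (a i)})"
      have "norm (x - basis_proj e (\<Lambda> N) x) < r" if "N \<ge> L" for N
      proof -
        have "N \<ge> 1" using that by (simp add: L_def)
        with gr have \<Lambda>: "finite (\<Lambda> N)" "card (\<Lambda> N) = N"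
            "\<And>i j. i \<in> \<Lambda> N \<Longrightarrow> j \<notin> \<Lambda> N \<Longrightarrow> cmod (a j) \<le> cmod (a i)"
          by (auto simp: greedy_set_def a_def)
        have in\<Lambda>: "j \<in> \<Lambda> N" if j: "j < m" "a j \<noteq> 0" for j
        proof (rule ccontr)
          assume "j \<notin> \<Lambda> N"
          then have "\<Lambda> N \<subseteq> {i. cmod (a j) \<le> cmod (a i)}" using \<Lambda>(3) by blast
          then have "card (\<Lambda> N) \<le> card {i. cmod (a j) \<le> cmod (a i)}"
            by (rule card_mono[OF fin[OF j(2)]])
          then have "N \<le> card {i. cmod (a j) \<le> cmod (a i)}"
            by (simp only: \<Lambda>(2))
          also have "\<dots> \<le> (\<Sum>j | j < m \<and> a j \<noteq> 0. card {i. cmod (a j) \<le> cmod (a i)})"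
            using j by (intro member_le_sum) auto
          finally show False using that(1) \<open>N \<ge> L\<close> by (simp add: L_def)
        qed
        define b where "b j = (if j < m then 0 else a j)" for j
        define z where "z = x - (\<Sum>j<m. a j *\<^sub>C e j)"
        have "(\<lambda>j. (if j < m then a j else 0) *\<^sub>C e j) sums (\<Sum>j<m. (if j < m then a j else 0) *\<^sub>C e j)"
          by (rule sums_finite) auto
        from sums_diff[OF a this] have b: "(\<lambda>j. b j *\<^sub>C e j) sums z"
          unfolding z_def complex_vector.scale_left_diff_distrib[symmetric]
          by (simp add: b_def if_distrib cong: if_cong)
        have "norm (\<Sum>j\<in>\<Lambda> N - {..<m}. b j *\<^sub>C e j) \<le> C * norm z"
          using \<Lambda> by (intro lim[OF b]) (auto simp: b_def)
        moreover have "(\<Sum>j\<in>\<Lambda> N - {..<m}. b j *\<^sub>C e j) = (\<Sum>j\<in>\<Lambda> N - {..<m}. a j *\<^sub>C e j)"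
          by (rule sum.cong) (auto simp: b_def)
        moreover have "basis_proj e (\<Lambda> N) x = (\<Sum>j\<in>\<Lambda> N - {..<m}. a j *\<^sub>C e j) + (\<Sum>j\<in>\<Lambda> N \<inter> {..<m}. a j *\<^sub>C e j)"
          unfolding basis_proj_def a_def[symmetric] using \<Lambda>(1)
          by (metis sum.Int_Diff add.commute)
        moreover have "(\<Sum>j\<in>\<Lambda> N \<inter> {..<m}. a j *\<^sub>C e j) = (\<Sum>j<m. a j *\<^sub>C e j)"
          using in\<Lambda> by (intro sum.mono_neutral_left) auto
        ultimately have "norm (x - basis_proj e (\<Lambda> N) x) \<le> norm z + C * norm z"
          using norm_triangle_ineq4[of z "\<Sum>j\<in>\<Lambda> N - {..<m}. b j *\<^sub>C e j"]
          by (simp add: z_def algebra_simps)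
        also have "\<dots> = (1 + C) * norm z" by (simp add: algebra_simps)
        also have "\<dots> < r"
          using m C by (simp add: z_def norm_minus_commute field_simps)
        finally show ?thesis .
      qed
      then show "\<exists>L. \<forall>N\<ge>L. norm (norm (x - basis_proj e (\<Lambda> N) x) - 0) < r"
        by (intro exI[of _ L] allI impI) (simp only: diff_zero real_norm_def abs_norm_cancel)
    qed
  qed
qed

end

section \<open>Integer logarithms and two inequalities for complex numbers\<close>

text \<open>For \<open>n \<ge> 1\<close> this is the floor of the logarithm of \<open>n\<close> to base \<open>b\<close>. Base 2 locates the tree
of a leaf, base 4 the block of an index.\<close>

definition ilog :: "nat \<Rightarrow> nat \<Rightarrow> nat" where
  "ilog b n = (LEAST m. n < b ^ Suc m)"

lemma ilog_less: "b \<ge> 2 \<Longrightarrow> n < b ^ Suc (ilog b n)"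
proof -
  assume b: "b \<ge> 2"
  have "n < 2 ^ n" by (rule less_exp)
  also have "\<dots> \<le> b ^ Suc n"
    using b by (meson lessI less_imp_le order_trans power_increasing power_mono zero_le one_le_numeral)
  finally have "n < b ^ Suc n" .
  then show ?thesis unfolding ilog_def by (rule LeastI)
qed

lemma ilog_le: "b \<ge> 2 \<Longrightarrow> n \<ge> 1 \<Longrightarrow> b ^ ilog b n \<le> n"
proof (cases "ilog b n")
  case (Suc m)
  then have "m < (LEAST m. n < b ^ Suc m)" by (simp add: ilog_def)
  from not_less_Least[OF this] show ?thesis using Suc by simp
qed simp

lemma ilog_eqI: "b \<ge> 2 \<Longrightarrow> b ^ m \<le> n \<Longrightarrow> n < b ^ Suc m \<Longrightarrow> ilog b n = m"
  unfolding ilog_def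
proof (rule Least_equality)
  fix k assume "b \<ge> 2" "b ^ m \<le> n" "n < b ^ Suc k"
  then have "b ^ m < b ^ Suc k" by simp
  then show "m \<le> k" using \<open>b \<ge> 2\<close> by (simp only: power_strict_increasing_iff less_Suc_eq_le)
qed

lemma cmod_parallelogram: "(cmod (x + y))\<^sup>2 + (cmod (x - y))\<^sup>2 = 2 * ((cmod x)\<^sup>2 + (cmod y)\<^sup>2)"
  unfolding cmod_power2 by (simp add: power2_eq_square algebra_simps)

lemma cmod_add_young:
  assumes "\<eta> > 0"
  shows "(cmod (x + y))\<^sup>2 \<le> (1 + \<eta>) * (cmod x)\<^sup>2 + (1 + 1 / \<eta>) * (cmod y)\<^sup>2"
proof -
  have "0 \<le> (\<eta> * cmod x - cmod y)\<^sup>2 / \<eta>" using assms by simp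
  also have "\<dots> = \<eta> * (cmod x)\<^sup>2 + (cmod y)\<^sup>2 / \<eta> - 2 * cmod x * cmod y"
    using assms by (simp add: field_simps power2_eq_square)
  finally have *: "2 * cmod x * cmod y \<le> \<eta> * (cmod x)\<^sup>2 + (cmod y)\<^sup>2 / \<eta>" by simp
  have "(cmod (x + y))\<^sup>2 \<le> (cmod x + cmod y)\<^sup>2"
    by (intro power_mono norm_triangle_ineq) auto
  also have "\<dots> = (cmod x)\<^sup>2 + (cmod y)\<^sup>2 + 2 * cmod x * cmod y"
    by (simp add: power2_eq_square algebra_simps)
  finally show ?thesis using * by (simp add: algebra_simps)
qed

lemma cmod_diff_young:
  "\<eta> > 0 \<Longrightarrow> (cmod (x - y))\<^sup>2 \<le> (1 + \<eta>) * (cmod x)\<^sup>2 + (1 + 1 / \<eta>) * (cmod y)\<^sup>2"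
  using cmod_add_young[of \<eta> x "- y"] by simp

section \<open>Weighted oscillation on the dyadic tree\<close>

definition dyadic :: "nat \<Rightarrow> nat \<Rightarrow> nat set" where
  "dyadic k q = {q * 2 ^ k..<Suc q * 2 ^ k}"

lemma finite_dyadic [simp]: "finite (dyadic k q)"
  by (simp add: dyadic_def)

lemma dyadic_0 [simp]: "dyadic 0 q = {q}"
  by (auto simp: dyadic_def)

lemma card_dyadic: "card (dyadic k q) = 2 ^ k"
  by (simp add: dyadic_def)

lemma mem_dyadic_iff: "n \<in> dyadic k q \<longleftrightarrow> n div 2 ^ k = q"
proof
  assume "n \<in> dyadic k q"
  then show "n div 2 ^ k = q"
    by (intro div_nat_eqI) (simp_all add: dyadic_def mult.commute)
next
  assume "n div 2 ^ k = q"
  then show "n \<in> dyadic k q"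
    using div_times_less_eq_dividend[of n "2 ^ k"] dividend_less_div_times[of "2 ^ k" n]
    by (auto simp: dyadic_def add.commute)
qed

lemma sum_dyadic_Suc: "sum f (dyadic (Suc k) q) = sum f (dyadic k (2 * q)) + sum f (dyadic k (2 * q + 1))"
  unfolding dyadic_def
  using sum.atLeastLessThan_concat[of "q * 2 ^ Suc k" "(2 * q + 1) * 2 ^ k" "Suc q * 2 ^ Suc k" f]
  by (simp add: algebra_simps)

definition mass :: "(nat \<Rightarrow> complex) \<Rightarrow> nat \<Rightarrow> nat \<Rightarrow> complex" where
  "mass a k q = (\<Sum>n\<in>dyadic k q. a n)"

lemma mass_0 [simp]: "mass a 0 q = a q"
  by (simp add: mass_def)

lemma mass_Suc: "mass a (Suc k) q = mass a k (2 * q) + mass a k (2 * q + 1)"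
  unfolding mass_def by (rule sum_dyadic_Suc)

text \<open>The squared norm, within a tree, of the Haar part of a combination of leaf vectors: level \<open>k\<close>
below the node contributes the squared differences of the sums over sibling intervals. The
factor \<open>1 - \<rho>\<close> makes the leaf vectors normalized.\<close>

primrec osc :: "real \<Rightarrow> (nat \<Rightarrow> complex) \<Rightarrow> nat \<Rightarrow> nat \<Rightarrow> real" where
  "osc \<rho> a 0 q = 0"
| "osc \<rho> a (Suc k) q = osc \<rho> a k (2 * q) + osc \<rho> a k (2 * q + 1)
     + (1 - \<rho>) * \<rho> ^ k * (cmod (mass a k (2 * q) - mass a k (2 * q + 1)))\<^sup>2"

lemma osc_nonneg: "0 < \<rho> \<Longrightarrow> \<rho> < 1 \<Longrightarrow> 0 \<le> osc \<rho> a k q"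
  by (induction k arbitrary: q) simp_all

lemma dyadic_Suc_subset: "dyadic k (2 * q) \<subseteq> dyadic (Suc k) q" "dyadic k (2 * q + 1) \<subseteq> dyadic (Suc k) q"
  by (auto simp: dyadic_def)

lemma mass_osc_cong:
  assumes "\<And>n. n \<in> dyadic k q \<Longrightarrow> a n = b n"
  shows "mass a k q = mass b k q" "osc \<rho> a k q = osc \<rho> b k q"
proof -
  have m: "mass a k q = mass b k q" if "\<And>n. n \<in> dyadic k q \<Longrightarrow> a n = b n" for k q
    unfolding mass_def using that by (rule sum.cong[OF refl])
  show "mass a k q = mass b k q" using assms by (rule m)
  show "osc \<rho> a k q = osc \<rho> b k q"
    using assms
  proof (induction k arbitrary: q)
    case (Suc k)
    have l: "\<And>n. n \<in> dyadic k (2 * q) \<Longrightarrow> a n = b n" 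
      and r: "\<And>n. n \<in> dyadic k (2 * q + 1) \<Longrightarrow> a n = b n"
      using Suc.prems dyadic_Suc_subset[of k q] by blast+
    show ?case
      using Suc.IH[OF l] Suc.IH[OF r] m[OF l] m[OF r] by simp
  qed simp
qed

lemma osc_const: "osc \<rho> (\<lambda>_. c) k q = 0"
  by (induction k arbitrary: q) (simp_all add: mass_def card_dyadic)

lemma mass_const: "mass (\<lambda>_. c) k q = 2 ^ k * c"
  by (simp add: mass_def card_dyadic)

definition trunc :: "nat \<Rightarrow> (nat \<Rightarrow> complex) \<Rightarrow> nat \<Rightarrow> complex" where
  "trunc r a = (\<lambda>n. if n < r then a n else 0)"

text \<open>The case of \<open>trunc_bound\<close> in which the cut falls into the right half. The point is that the
coefficient of \<open>r'\<close> on the right is not larger than the factor 2 with which it enters from the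
level below; this is where the factor 2 instead of 1 in front of the squared mass leaves room,
as \<open>(1 - \<rho>) + 2 * \<rho> < 2\<close>.\<close>

lemma trunc_bound_step_right:
  fixes l r r' :: complex
  assumes \<rho>: "1/4 < \<rho>" "\<rho> < 1"
  shows "(1 - \<rho>) * (cmod (l - r'))\<^sup>2 + 2 * \<rho> * (cmod (l + r'))\<^sup>2
    \<le> 2 * (cmod r')\<^sup>2 + (1 + \<rho>) * (1 + 2 / (1 - \<rho>)) * (cmod l)\<^sup>2"
proof -
  \<comment> \<open>Then \<open>(1 + \<rho>) * (1 + \<eta>) < 2\<close>.\<close>
  define \<eta> where "\<eta> = (1 - \<rho>) / 2"
  have \<eta>: "\<eta> > 0" "1 / \<eta> = 2 / (1 - \<rho>)" using \<rho> by (auto simp: \<eta>_def)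
  have eq: "(1 - \<rho>) * X + 2 * \<rho> * X = (1 + \<rho>) * X" for X :: real
    by (simp add: algebra_simps)
  have "(cmod (l - r'))\<^sup>2 \<le> (1 + \<eta>) * (cmod r')\<^sup>2 + (1 + 1 / \<eta>) * (cmod l)\<^sup>2"
    using cmod_diff_young[OF \<eta>(1), of r' l] by (simp add: norm_minus_commute)
  moreover have "(cmod (l + r'))\<^sup>2 \<le> (1 + \<eta>) * (cmod r')\<^sup>2 + (1 + 1 / \<eta>) * (cmod l)\<^sup>2"
    using cmod_add_young[OF \<eta>(1), of r' l] by (simp add: add.commute)
  ultimately have "(1 - \<rho>) * (cmod (l - r'))\<^sup>2 + 2 * \<rho> * (cmod (l + r'))\<^sup>2
     \<le> (1 - \<rho>) * ((1 + \<eta>) * (cmod r')\<^sup>2 + (1 + 1 / \<eta>) * (cmod l)\<^sup>2)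
      + 2 * \<rho> * ((1 + \<eta>) * (cmod r')\<^sup>2 + (1 + 1 / \<eta>) * (cmod l)\<^sup>2)"
    using \<rho> by (intro add_mono mult_left_mono) auto
  also have "\<dots> = (1 + \<rho>) * (1 + \<eta>) * (cmod r')\<^sup>2 + (1 + \<rho>) * (1 + 1 / \<eta>) * (cmod l)\<^sup>2"
    unfolding eq by (subst distrib_left) (simp only: mult.assoc)
  also have "(1 + \<rho>) * (1 + \<eta>) = 2 - (1 - \<rho>)\<^sup>2 / 2"
    by (simp add: \<eta>_def power2_eq_square field_simps)
  also have "(2 - (1 - \<rho>)\<^sup>2 / 2) * (cmod r')\<^sup>2 \<le> 2 * (cmod r')\<^sup>2"
    by (intro mult_right_mono) auto
  finally show ?thesis by (simp add: \<eta>(2))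
qed

text \<open>The parameter \<open>\<delta>\<close> measures how far \<open>\<rho>\<close> is above \<open>1/4\<close>: the sum over a half of an
interval enters, up to the oscillation, with a factor \<open>1/4\<close> from the squared sum over the
interval, while the weight of the level below is larger by the factor \<open>1 / \<rho>\<close>, so there is
a contraction of \<open>1 / (4 * \<rho>)\<close> to distribute. First \<open>\<kappa>\<close> is chosen small, then \<open>E\<close>
large.\<close>

lemma trunc_bound_constants:
  fixes \<rho> :: real
  assumes \<rho>: "1/4 < \<rho>" "\<rho> < 1"
  defines "M \<equiv> (1 + \<rho>) * (1 + 2 / (1 - \<rho>))"
  obtains E \<kappa> \<delta> where "0 < \<kappa>" "\<kappa> \<le> 1" "0 < \<delta>" "(1 + \<delta>)\<^sup>2 = 4 * \<rho>"
    "\<kappa> * (1 + \<delta>) * (1 + 1 / \<delta>) \<le> 4 * (1 - \<rho>)" "1 \<le> E" "2 \<le> E * \<kappa>" "M \<le> E * \<kappa> * \<delta>"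
proof -
  define \<delta> where "\<delta> = 2 * sqrt \<rho> - 1"
  define \<kappa> where "\<kappa> = min 1 (4 * (1 - \<rho>) / ((1 + \<delta>) * (1 + 1 / \<delta>)))"
  define E where "E = max 1 (max (2 / \<kappa>) (M / (\<kappa> * \<delta>)))"
  have "sqrt (1/4) < sqrt \<rho>" using \<rho> by (intro real_sqrt_less_mono)
  moreover have "sqrt (1/4) = 1/2" by (simp add: real_sqrt_divide)
  ultimately have \<delta>: "0 < \<delta>" by (simp add: \<delta>_def)
  have "(1 + \<delta>)\<^sup>2 = 4 * \<rho>" using \<rho> by (simp add: \<delta>_def power_mult_distrib)
  have pos: "(1 + \<delta>) * (1 + 1 / \<delta>) > 0" using \<delta> by (intro mult_pos_pos add_pos_pos) auto
  have \<kappa>: "0 < \<kappa>" using pos \<rho> by (simp add: \<kappa>_def)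
  have "\<kappa> \<le> 1" "1 \<le> E" by (simp_all add: \<kappa>_def E_def)
  have "\<kappa> * ((1 + \<delta>) * (1 + 1 / \<delta>)) \<le> 4 * (1 - \<rho>)"
    unfolding pos_le_divide_eq[OF pos, symmetric] by (simp add: \<kappa>_def)
  moreover have "2 \<le> E * \<kappa>"
    unfolding pos_divide_le_eq[OF \<kappa>, symmetric] by (simp add: E_def)
  moreover have "M \<le> E * (\<kappa> * \<delta>)"
    unfolding pos_divide_le_eq[OF mult_pos_pos[OF \<kappa> \<delta>], symmetric] by (simp add: E_def)
  ultimately show ?thesis
    using \<kappa> \<delta> \<open>(1 + \<delta>)\<^sup>2 = 4 * \<rho>\<close> \<open>\<kappa> \<le> 1\<close> \<open>1 \<le> E\<close>
    by (intro that[of \<kappa> \<delta> E]) (simp_all only: mult.assoc)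
qed

text \<open>Induction over the levels, with different weights for the squared mass on the two sides: 2 for
the truncated sequence and a small \<open>\<kappa>\<close> for the original one. This leaves room to absorb
the terms that arise at each level, so that one constant serves all levels. If the cut is not
beyond the left half, the right half of the truncated sequence vanishes; otherwise its left
half is unchanged.\<close>

lemma trunc_bound:
  fixes \<rho> :: real
  assumes \<rho>: "1/4 < \<rho>" "\<rho> < 1"
  obtains E where "1 \<le> E"
    "\<And>a k q r. osc \<rho> (trunc r a) k q + \<rho> ^ k * (cmod (mass (trunc r a) k q))\<^sup>2
        \<le> E * (osc \<rho> a k q + \<rho> ^ k * (cmod (mass a k q))\<^sup>2)"
proof -
  define M where "M = (1 + \<rho>) * (1 + 2 / (1 - \<rho>))"
  obtain E \<kappa> \<delta> where c: "0 < \<kappa>" "\<kappa> \<le> 1" "0 < \<delta>" "(1 + \<delta>)\<^sup>2 = 4 * \<rho>"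
    "\<kappa> * (1 + \<delta>) * (1 + 1 / \<delta>) \<le> 4 * (1 - \<rho>)" "1 \<le> E" "2 \<le> E * \<kappa>" "M \<le> E * \<kappa> * \<delta>"
    using trunc_bound_constants[OF \<rho>] unfolding M_def by metis
  have M0: "M \<ge> 0" using \<rho> by (auto simp: M_def)
  have half: "(cmod x)\<^sup>2 \<le> ((1 + \<delta>) * (cmod (x + y))\<^sup>2 + (1 + 1 / \<delta>) * (cmod (x - y))\<^sup>2) / 4" for x y
  proof -
    have "(x + y) + (x - y) = 2 * x" by simp
    then have "(cmod x)\<^sup>2 = (cmod ((x + y) + (x - y)))\<^sup>2 / 4"
      by (simp only: norm_mult power_mult_distrib) simp
    also have "\<dots> \<le> ((1 + \<delta>) * (cmod (x + y))\<^sup>2 + (1 + 1 / \<delta>) * (cmod (x - y))\<^sup>2) / 4"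
      by (intro divide_right_mono cmod_add_young c(3)) simp
    finally show ?thesis .
  qed
  have half': "(cmod y)\<^sup>2 \<le> ((1 + \<delta>) * (cmod (x + y))\<^sup>2 + (1 + 1 / \<delta>) * (cmod (x - y))\<^sup>2) / 4" for x y
    using half[of y x] by (simp only: add.commute[of y x] norm_minus_commute[of y x])
  have main: "osc \<rho> (trunc r a) k q + 2 * \<rho> ^ k * (cmod (mass (trunc r a) k q))\<^sup>2
        \<le> E * (osc \<rho> a k q + \<kappa> * \<rho> ^ k * (cmod (mass a k q))\<^sup>2)" for a k q r
  proof (induction k arbitrary: q)
    case 0
    have "2 * (cmod (a q))\<^sup>2 \<le> E * \<kappa> * (cmod (a q))\<^sup>2"
      using c by (intro mult_right_mono) auto
    then show ?case using c by (auto simp: trunc_def mult.assoc)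
  next
    case (Suc k)
    let ?l = "mass a k (2 * q)" and ?r = "mass a k (2 * q + 1)"
    let ?L = "osc \<rho> a k (2 * q)" and ?R = "osc \<rho> a k (2 * q + 1)"
    let ?tl = "mass (trunc r a) k (2 * q)" and ?tr = "mass (trunc r a) k (2 * q + 1)"
    let ?tL = "osc \<rho> (trunc r a) k (2 * q)" and ?tR = "osc \<rho> (trunc r a) k (2 * q + 1)"
    define S where "S = (cmod (?l + ?r))\<^sup>2"
    define D where "D = (cmod (?l - ?r))\<^sup>2"
    have SD: "S \<ge> 0" "D \<ge> 0" by (auto simp: S_def D_def)
    have L0: "?L \<ge> 0" "?R \<ge> 0" using \<rho> by (auto intro: osc_nonneg)
    have \<rho>k: "\<rho> ^ k > 0" using \<rho> by simp
    have left: "?tL + 2 * \<rho> ^ k * (cmod ?tl)\<^sup>2 \<le> E * (?L + \<kappa> * \<rho> ^ k * (cmod ?l)\<^sup>2)"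
      and right: "?tR + 2 * \<rho> ^ k * (cmod ?tr)\<^sup>2 \<le> E * (?R + \<kappa> * \<rho> ^ k * (cmod ?r)\<^sup>2)"
      by (rule Suc.IH)+
    have aim: "osc \<rho> a (Suc k) q + \<kappa> * \<rho> ^ Suc k * (cmod (mass a (Suc k) q))\<^sup>2
        = ?L + ?R + \<rho> ^ k * ((1 - \<rho>) * D + \<kappa> * \<rho> * S)"
      by (simp add: mass_Suc S_def D_def algebra_simps)
    have lhs: "osc \<rho> (trunc r a) (Suc k) q + 2 * \<rho> ^ Suc k * (cmod (mass (trunc r a) (Suc k) q))\<^sup>2
        = ?tL + ?tR + \<rho> ^ k * ((1 - \<rho>) * (cmod (?tl - ?tr))\<^sup>2 + 2 * \<rho> * (cmod (?tl + ?tr))\<^sup>2)"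
      by (simp add: mass_Suc algebra_simps)
    have one: "X * (1 + \<delta>) * S + X * (1 + 1 / \<delta>) * D \<le> 4 * (E * ((1 - \<rho>) * D + \<kappa> * \<rho> * S))"
      if X: "X \<le> E * \<kappa> * (1 + \<delta>)" for X
    proof -
      have "X * (1 + \<delta>) \<le> E * \<kappa> * (1 + \<delta>) * (1 + \<delta>)"
        using X c by (intro mult_right_mono) auto
      also have "\<dots> = 4 * E * \<kappa> * \<rho>" using c(4) by (simp add: power2_eq_square)
      finally have 1: "X * (1 + \<delta>) * S \<le> 4 * E * \<kappa> * \<rho> * S"
        using SD by (intro mult_right_mono) auto
      have "X * (1 + 1 / \<delta>) \<le> E * (\<kappa> * (1 + \<delta>) * (1 + 1 / \<delta>))"
        unfolding mult.assoc[symmetric] using X c by (intro mult_right_mono) auto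
      also have "\<dots> \<le> E * (4 * (1 - \<rho>))"
        using c by (intro mult_left_mono) auto
      finally have 2: "X * (1 + 1 / \<delta>) * D \<le> E * (4 * (1 - \<rho>)) * D"
        using SD by (intro mult_right_mono) auto
      show ?thesis using 1 2 by (simp add: algebra_simps)
    qed
    show ?case
    proof (cases "r \<le> (2 * q + 1) * 2 ^ k")
      case True
      have "trunc r a n = 0" if "n \<in> dyadic k (2 * q + 1)" for n
        using True that by (auto simp: dyadic_def trunc_def)
      then have "?tr = mass (\<lambda>_. 0) k (2 * q + 1)" "?tR = osc \<rho> (\<lambda>_. 0) k (2 * q + 1)"
        by (auto intro!: mass_osc_cong)
      then have 0: "?tr = 0" "?tR = 0" by (simp_all add: osc_const mass_const)
      have "osc \<rho> (trunc r a) (Suc k) q + 2 * \<rho> ^ Suc k * (cmod (mass (trunc r a) (Suc k) q))\<^sup>2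
          = ?tL + \<rho> ^ k * ((1 + \<rho>) * (cmod ?tl)\<^sup>2)"
        unfolding lhs 0 by (simp add: algebra_simps)
      also have "\<dots> \<le> ?tL + \<rho> ^ k * (2 * (cmod ?tl)\<^sup>2)"
        using \<rho> by (intro add_left_mono mult_left_mono mult_right_mono) auto
      also have "\<dots> \<le> E * ?L + \<rho> ^ k * (E * \<kappa> * (cmod ?l)\<^sup>2)"
        using left by (simp add: algebra_simps)
      also have "\<dots> \<le> E * ?L + \<rho> ^ k * (E * ((1 - \<rho>) * D + \<kappa> * \<rho> * S))"
      proof (intro add_left_mono mult_left_mono)
        have "4 * (E * \<kappa> * (cmod ?l)\<^sup>2) \<le> E * \<kappa> * ((1 + \<delta>) * S + (1 + 1 / \<delta>) * D)"
          using mult_left_mono[OF half[of ?l ?r], of "E * \<kappa>"] c by (simp add: S_def D_def)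
        also have "\<dots> \<le> 4 * (E * ((1 - \<rho>) * D + \<kappa> * \<rho> * S))"
          using one[of "E * \<kappa>"] c by (simp add: algebra_simps)
        finally show "E * \<kappa> * (cmod ?l)\<^sup>2 \<le> E * ((1 - \<rho>) * D + \<kappa> * \<rho> * S)" by simp
      qed (use \<rho> in auto)
      also have "\<dots> \<le> E * (?L + ?R + \<rho> ^ k * ((1 - \<rho>) * D + \<kappa> * \<rho> * S))"
        using L0 c by (simp add: algebra_simps)
      finally show ?thesis unfolding aim .
    next
      case False
      have "trunc r a n = a n" if "n \<in> dyadic k (2 * q)" for n
        using False that by (auto simp: dyadic_def trunc_def)
      then have l: "?tl = ?l" "?tL = ?L"
        by (auto intro!: mass_osc_cong)
      have "osc \<rho> (trunc r a) (Suc k) q + 2 * \<rho> ^ Suc k * (cmod (mass (trunc r a) (Suc k) q))\<^sup>2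
          = ?L + ?tR + \<rho> ^ k * ((1 - \<rho>) * (cmod (?l - ?tr))\<^sup>2 + 2 * \<rho> * (cmod (?l + ?tr))\<^sup>2)"
        unfolding lhs l ..
      also have "\<dots> \<le> ?L + ?tR + \<rho> ^ k * (2 * (cmod ?tr)\<^sup>2 + M * (cmod ?l)\<^sup>2)"
        unfolding M_def using \<rho>k by (intro add_left_mono mult_left_mono trunc_bound_step_right \<rho>) auto
      also have "\<dots> \<le> E * ?L + E * ?R + \<rho> ^ k * (E * \<kappa> * (cmod ?r)\<^sup>2 + M * (cmod ?l)\<^sup>2)"
        using right mult_right_mono[OF c(6) L0(1)] by (simp add: algebra_simps)
      also have "\<dots> \<le> E * ?L + E * ?R + \<rho> ^ k * (E * ((1 - \<rho>) * D + \<kappa> * \<rho> * S))"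
      proof (intro add_left_mono mult_left_mono)
        have "4 * (E * \<kappa> * (cmod ?r)\<^sup>2) \<le> E * \<kappa> * ((1 + \<delta>) * S + (1 + 1 / \<delta>) * D)"
          using mult_left_mono[OF half'[of ?r ?l], of "E * \<kappa>"] c by (simp add: S_def D_def)
        moreover have "4 * (M * (cmod ?l)\<^sup>2) \<le> M * ((1 + \<delta>) * S + (1 + 1 / \<delta>) * D)"
          using mult_left_mono[OF half[of ?l ?r], of M] M0 by (simp add: S_def D_def)
        moreover have "(E * \<kappa> + M) * (1 + \<delta>) * S + (E * \<kappa> + M) * (1 + 1 / \<delta>) * D
            \<le> 4 * (E * ((1 - \<rho>) * D + \<kappa> * \<rho> * S))"
          using one[of "E * \<kappa> + M"] c by (simp add: algebra_simps)
        ultimately show "E * \<kappa> * (cmod ?r)\<^sup>2 + M * (cmod ?l)\<^sup>2 \<le> E * ((1 - \<rho>) * D + \<kappa> * \<rho> * S)" 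
          by (simp add: algebra_simps)
      qed (use \<rho> in auto)
      finally show ?thesis unfolding aim by (simp add: algebra_simps)
    qed
  qed
  show ?thesis
  proof (rule that[OF c(6)])
    fix a k q r
    have 1: "0 \<le> \<rho> ^ k * (cmod (mass b k q))\<^sup>2" for b using \<rho> by simp
    have "osc \<rho> (trunc r a) k q + \<rho> ^ k * (cmod (mass (trunc r a) k q))\<^sup>2
       \<le> osc \<rho> (trunc r a) k q + 2 * \<rho> ^ k * (cmod (mass (trunc r a) k q))\<^sup>2"
      using 1[of "trunc r a"] by simp
    also have "\<dots> \<le> E * (osc \<rho> a k q + \<kappa> * \<rho> ^ k * (cmod (mass a k q))\<^sup>2)" by (rule main)
    also have "\<dots> \<le> E * (osc \<rho> a k q + \<rho> ^ k * (cmod (mass a k q))\<^sup>2)"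
      using c mult_right_mono[OF c(2) 1[of a]] by (intro mult_left_mono add_left_mono) (auto simp: mult.assoc)
    finally show "osc \<rho> (trunc r a) k q + \<rho> ^ k * (cmod (mass (trunc r a) k q))\<^sup>2
        \<le> E * (osc \<rho> a k q + \<rho> ^ k * (cmod (mass a k q))\<^sup>2)" .
  qed
qed

text \<open>For \<open>\<rho> = 1/2\<close> the parallelogram identity makes both sides equal at every level; a larger
\<open>\<rho>\<close> only helps. The induction carries the factor \<open>2 * (1 - \<rho>)\<close> also in front of the
mass, as this matches the oscillation.\<close>

lemma osc_besselian:
  assumes "1/2 \<le> \<rho>" "\<rho> < 1"
  shows "2 * (1 - \<rho>) * (\<Sum>n\<in>dyadic k q. (cmod (a n))\<^sup>2) \<le> osc \<rho> a k q + \<rho> ^ k * (cmod (mass a k q))\<^sup>2"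
proof -
  have "2 * (1 - \<rho>) * (\<Sum>n\<in>dyadic k q. (cmod (a n))\<^sup>2)
      \<le> osc \<rho> a k q + 2 * (1 - \<rho>) * \<rho> ^ k * (cmod (mass a k q))\<^sup>2"
  proof (induction k arbitrary: q)
    case (Suc k)
    let ?l = "mass a k (2 * q)" and ?r = "mass a k (2 * q + 1)"
    let ?d = "(1 - \<rho>) * \<rho> ^ k"
    have "?d * (2 * (cmod ?l)\<^sup>2 + 2 * (cmod ?r)\<^sup>2)
        = ?d * ((cmod (?l - ?r))\<^sup>2 + 1 * (cmod (?l + ?r))\<^sup>2)"
      using cmod_parallelogram[of ?l ?r] by simp
    also have "\<dots> \<le> ?d * ((cmod (?l - ?r))\<^sup>2 + 2 * \<rho> * (cmod (?l + ?r))\<^sup>2)"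
      using assms by (intro mult_left_mono add_left_mono mult_right_mono) auto
    finally show ?case
      using Suc.IH[of "2 * q"] Suc.IH[of "2 * q + 1"]
      by (simp add: sum_dyadic_Suc mass_Suc algebra_simps)
  qed simp
  also have "\<dots> \<le> osc \<rho> a k q + 1 * \<rho> ^ k * (cmod (mass a k q))\<^sup>2"
    using assms by (intro add_left_mono mult_right_mono) auto
  finally show ?thesis by simp
qed

lemma osc_hilbertian:
  assumes "0 < \<rho>" "\<rho> \<le> 1/2"
  shows "osc \<rho> a k q + \<rho> ^ k * (cmod (mass a k q))\<^sup>2 \<le> 2 * (1 - \<rho>) * (\<Sum>n\<in>dyadic k q. (cmod (a n))\<^sup>2)"
proof -
  have "osc \<rho> a k q + 1 * \<rho> ^ k * (cmod (mass a k q))\<^sup>2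
      \<le> osc \<rho> a k q + 2 * (1 - \<rho>) * \<rho> ^ k * (cmod (mass a k q))\<^sup>2"
    using assms by (intro add_left_mono mult_right_mono) auto
  also have "\<dots> \<le> 2 * (1 - \<rho>) * (\<Sum>n\<in>dyadic k q. (cmod (a n))\<^sup>2)"
  proof (induction k arbitrary: q)
    case (Suc k)
    let ?l = "mass a k (2 * q)" and ?r = "mass a k (2 * q + 1)"
    let ?d = "(1 - \<rho>) * \<rho> ^ k"
    have "?d * ((cmod (?l - ?r))\<^sup>2 + 2 * \<rho> * (cmod (?l + ?r))\<^sup>2)
        \<le> ?d * ((cmod (?l - ?r))\<^sup>2 + 1 * (cmod (?l + ?r))\<^sup>2)"
      using assms by (intro mult_left_mono add_left_mono mult_right_mono) auto
    also have "\<dots> = ?d * (2 * (cmod ?l)\<^sup>2 + 2 * (cmod ?r)\<^sup>2)"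
      using cmod_parallelogram[of ?l ?r] by simp
    finally show ?case
      using Suc.IH[of "2 * q"] Suc.IH[of "2 * q + 1"]
      by (simp add: sum_dyadic_Suc mass_Suc algebra_simps)
  qed simp
  finally show ?thesis by simp
qed

section \<open>Tree bases\<close>

text \<open>The vector \<open>w (Suc i, q - 1)\<close> belongs to the node of level \<open>Suc i\<close> over the dyadic interval
with number \<open>q \<ge> 1\<close>, and \<open>w (0, m)\<close> to the mean over the tree with the \<open>2 ^ m\<close> leaves from
\<open>2 ^ m\<close> to \<open>2 ^ Suc m - 1\<close>. In this numbering the trees exhaust all pairs of natural numbers.\<close>

locale tree_system =
  fixes \<rho> :: real and w :: "nat \<times> nat \<Rightarrow> 'a::complex_inner"
  assumes rho: "0 < \<rho>" "\<rho> < 1" and w: "orthonormal w"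
begin

definition wt :: "nat \<Rightarrow> complex" where
  "wt i = complex_of_real (sqrt ((1 - \<rho>) * \<rho> ^ i))"

lemma wt: "(cmod (wt i))\<^sup>2 = (1 - \<rho>) * \<rho> ^ i" "wt i \<noteq> 0"
  using rho by (auto simp: wt_def)

definition sgn_bit :: "nat \<Rightarrow> nat \<Rightarrow> complex" where
  "sgn_bit i n = (if even (n div 2 ^ i) then 1 else - 1)"

lemma norm_sgn_bit: "cmod (sgn_bit i n) = 1"
  by (simp add: sgn_bit_def)

definition haar_part :: "nat \<Rightarrow> nat \<Rightarrow> 'a" where
  "haar_part k n = (\<Sum>i<k. (wt i * sgn_bit i n) *\<^sub>C w (Suc i, n div 2 ^ Suc i - 1))"

definition tree_vec :: "nat \<Rightarrow> 'a" where
  "tree_vec n = haar_part (ilog 2 n) n + complex_of_real (sqrt (\<rho> ^ ilog 2 n)) *\<^sub>C w (0, ilog 2 n)"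

lemma w_orth: "p \<noteq> p' \<Longrightarrow> cinner (w p) (w p') = 0"
  using w by (simp add: orthonormalD)

lemma haar_part_orthogonal_other_level:
  "k < i \<or> i = 0 \<Longrightarrow> cinner (haar_part k n) (w (i, p)) = 0"
  by (auto simp: haar_part_def cinner_simps w_orth)

lemma haar_part_orthogonal:
  assumes "\<And>j. j \<le> k \<Longrightarrow> j \<le> k' \<Longrightarrow> j > 0 \<Longrightarrow> n div 2 ^ j - 1 \<noteq> n' div 2 ^ j - 1"
  shows "cinner (haar_part k n) (haar_part k' n') = 0"
proof -
  have "cinner (w (Suc i, n div 2 ^ Suc i - 1)) (w (Suc j, n' div 2 ^ Suc j - 1)) = 0"
    if "i < k" "j < k'" for i j
    using that assms[of "Suc i"] by (intro w_orth) (auto simp del: power_Suc)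
  then show ?thesis
    unfolding haar_part_def by (auto simp: cinner_simps simp del: power_Suc intro!: sum.neutral)
qed

lemma div_pow_neq:
  fixes n n' k j :: nat
  assumes "j \<le> k" "n div 2 ^ k \<noteq> n' div 2 ^ k" "n div 2 ^ k > 0" "n' div 2 ^ k > 0"
  shows "n div 2 ^ j - 1 \<noteq> n' div 2 ^ j - 1"
proof -
  have *: "m div 2 ^ k = m div 2 ^ j div 2 ^ (k - j)" for m :: nat
    using assms(1) by (simp add: div_mult2_eq[symmetric] power_add[symmetric])
  have "n div 2 ^ j \<noteq> n' div 2 ^ j" "n div 2 ^ j > 0" "n' div 2 ^ j > 0"
    using assms(2-) unfolding * by (auto intro: Nat.gr0I)
  then show ?thesis by simp
qed

lemma haar_part_Suc:
  assumes "n div 2 ^ k = 2 * q \<or> n div 2 ^ k = 2 * q + 1"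
  shows "haar_part (Suc k) n = haar_part k n + (wt k * sgn_bit k n) *\<^sub>C w (Suc k, q - 1)"
proof -
  have "n div 2 ^ Suc k = q"
    using assms by (auto simp: div_mult2_eq power_Suc2 simp del: power_Suc)
  then show ?thesis unfolding haar_part_def by (simp del: power_Suc)
qed

text \<open>Leaves in different halves of an interval have no common ancestor below the interval, so the
two halves contribute orthogonal vectors; the node of the interval itself contributes the
difference of the two masses.\<close>

lemma norm_haar_sum:
  assumes "q \<ge> 1"
  shows "(norm (\<Sum>n\<in>dyadic k q. a n *\<^sub>C haar_part k n))\<^sup>2 = osc \<rho> a k q"
  using assms
proof (induction k arbitrary: q)
  case 0
  then show ?case by (simp add: haar_part_def)
next
  case (Suc k)
  define L where "L = (\<Sum>n\<in>dyadic k (2 * q). a n *\<^sub>C haar_part k n)"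
  define R where "R = (\<Sum>n\<in>dyadic k (2 * q + 1). a n *\<^sub>C haar_part k n)"
  define c where "c = wt k * (mass a k (2 * q) - mass a k (2 * q + 1))"
  have l: "(\<Sum>n\<in>dyadic k (2 * q). a n *\<^sub>C haar_part (Suc k) n)
      = L + (wt k * mass a k (2 * q)) *\<^sub>C w (Suc k, q - 1)"
  proof -
    have "a n *\<^sub>C haar_part (Suc k) n = a n *\<^sub>C haar_part k n + (wt k * a n) *\<^sub>C w (Suc k, q - 1)"
      if "n \<in> dyadic k (2 * q)" for n
      using that haar_part_Suc[of n k q]
      by (simp add: mem_dyadic_iff sgn_bit_def scaleC_add_right scaleC_scaleC mult.commute)
    then show ?thesis
      by (simp add: L_def mass_def sum.distrib complex_vector.scale_sum_left sum_distrib_left)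
  qed
  have r: "(\<Sum>n\<in>dyadic k (2 * q + 1). a n *\<^sub>C haar_part (Suc k) n)
      = R - (wt k * mass a k (2 * q + 1)) *\<^sub>C w (Suc k, q - 1)"
  proof -
    have "a n *\<^sub>C haar_part (Suc k) n = a n *\<^sub>C haar_part k n - (wt k * a n) *\<^sub>C w (Suc k, q - 1)"
      if "n \<in> dyadic k (2 * q + 1)" for n
      using that haar_part_Suc[of n k q]
      by (simp add: mem_dyadic_iff sgn_bit_def complex_vector.scale_right_diff_distrib scaleC_scaleC mult.commute)
    then show ?thesis
      by (simp add: R_def mass_def sum_subtractf complex_vector.scale_sum_left sum_distrib_left)
  qed
  have "(\<Sum>n\<in>dyadic (Suc k) q. a n *\<^sub>C haar_part (Suc k) n) = (L + R) + c *\<^sub>C w (Suc k, q - 1)"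
    unfolding sum_dyadic_Suc l r c_def
    by (simp add: complex_vector.scale_left_diff_distrib right_diff_distrib)
  moreover have "cinner (L + R) (c *\<^sub>C w (Suc k, q - 1)) = 0"
    by (simp add: L_def R_def cinner_simps haar_part_orthogonal_other_level)
  moreover have "cinner L R = 0"
  proof -
    have "cinner (haar_part k n) (haar_part k n') = 0"
      if "n \<in> dyadic k (2 * q)" "n' \<in> dyadic k (2 * q + 1)" for n n'
    proof (rule haar_part_orthogonal)
      fix j assume "j \<le> k"
      then show "n div 2 ^ j - 1 \<noteq> n' div 2 ^ j - 1"
        using that Suc.prems by (intro div_pow_neq[of j k]) (auto simp: mem_dyadic_iff)
    qed
    then show ?thesis by (simp add: L_def R_def cinner_simps)
  qed
  ultimately have "(norm (\<Sum>n\<in>dyadic (Suc k) q. a n *\<^sub>C haar_part (Suc k) n))\<^sup>2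
      = (norm L)\<^sup>2 + (norm R)\<^sup>2 + (norm (c *\<^sub>C w (Suc k, q - 1)))\<^sup>2"
    by (simp only: norm_add_orthogonal)
  moreover have "(norm L)\<^sup>2 = osc \<rho> a k (2 * q)" "(norm R)\<^sup>2 = osc \<rho> a k (2 * q + 1)"
    using Suc unfolding L_def R_def by auto
  ultimately show ?case
    by (simp add: norm_scaleC orthonormal_norm[OF w] c_def norm_mult power_mult_distrib wt)
qed

lemma ilog_root: "n \<in> dyadic m 1 \<Longrightarrow> ilog 2 n = m"
  by (rule ilog_eqI) (auto simp: dyadic_def)

lemma norm_tree_sum:
  "(norm (\<Sum>n\<in>dyadic m 1. a n *\<^sub>C tree_vec n))\<^sup>2 = osc \<rho> a m 1 + \<rho> ^ m * (cmod (mass a m 1))\<^sup>2"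
proof -
  let ?H = "\<Sum>n\<in>dyadic m 1. a n *\<^sub>C haar_part m n"
  let ?c = "mass a m 1 * complex_of_real (sqrt (\<rho> ^ m))"
  have "(\<Sum>n\<in>dyadic m 1. a n *\<^sub>C tree_vec n)
      = (\<Sum>n\<in>dyadic m 1. a n *\<^sub>C haar_part m n + (a n * complex_of_real (sqrt (\<rho> ^ m))) *\<^sub>C w (0, m))"
    by (rule sum.cong) (simp_all add: tree_vec_def ilog_root scaleC_add_right scaleC_scaleC)
  also have "\<dots> = ?H + ?c *\<^sub>C w (0, m)"
    by (simp add: sum.distrib mass_def complex_vector.scale_sum_left[symmetric] sum_distrib_right)
  also have "(norm \<dots>)\<^sup>2 = (norm ?H)\<^sup>2 + (norm (?c *\<^sub>C w (0, m)))\<^sup>2"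
    by (rule norm_add_orthogonal) (simp add: cinner_simps haar_part_orthogonal_other_level)
  also have "(norm ?H)\<^sup>2 = osc \<rho> a m 1"
    by (rule norm_haar_sum) simp
  also have "(norm (?c *\<^sub>C w (0, m)))\<^sup>2 = \<rho> ^ m * (cmod (mass a m 1))\<^sup>2"
    using rho by (simp add: norm_scaleC orthonormal_norm[OF w] norm_mult power_mult_distrib)
  finally show ?thesis .
qed

lemma tree_vec_orthogonal:
  assumes "n \<in> dyadic m 1" "n' \<in> dyadic m' 1" "m \<noteq> m'"
  shows "cinner (tree_vec n) (tree_vec n') = 0"
proof -
  have less: "n div 2 ^ j - 1 < n' div 2 ^ j - 1"
    if "n \<in> dyadic m 1" "n' \<in> dyadic m' 1" "m < m'" "j \<le> m" for n n' m m' j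
  proof -
    have "n < 2 ^ Suc m" "2 ^ m' \<le> n'" "2 ^ m \<le> n" using that by (auto simp: dyadic_def)
    have "n div 2 ^ j < 2 ^ (Suc m - j)"
      using that \<open>n < 2 ^ Suc m\<close> 
      by (intro less_mult_imp_div_less) (simp add: power_add[symmetric] del: power_Suc)
    also have "\<dots> \<le> 2 ^ (m' - j)"
      using that by (intro power_increasing) auto
    also have "\<dots> = 2 ^ m' div 2 ^ j"
      using that by (simp add: power_diff)
    also have "\<dots> \<le> n' div 2 ^ j"
      by (rule div_le_mono) fact
    finally have "n div 2 ^ j < n' div 2 ^ j" .
    moreover have "0 < n div 2 ^ j"
      using \<open>2 ^ m \<le> n\<close> that(4) 
      by (auto simp: div_greater_zero_iff intro: order_trans[OF power_increasing])
    ultimately show ?thesis by simp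
  qed
  have "cinner (haar_part m n) (haar_part m' n') = 0"
  proof (rule haar_part_orthogonal)
    fix j assume "j \<le> m" "j \<le> m'"
    then show "n div 2 ^ j - 1 \<noteq> n' div 2 ^ j - 1"
      using less[of n m n' m' j] less[of n' m' n m j] assms by (cases "m < m'") auto
  qed
  moreover have "cinner (w (0, m)) (haar_part m' n') = 0"
    by (metis cinner_commute complex_cnj_zero haar_part_orthogonal_other_level)
  ultimately show ?thesis
    using assms by (simp add: tree_vec_def ilog_root cinner_simps haar_part_orthogonal_other_level w_orth)
qed

lemma norm_sum_trees:
  "(norm (\<Sum>n\<in>{1..<2 ^ M}. a n *\<^sub>C tree_vec n))\<^sup>2
    = (\<Sum>m<M. osc \<rho> a m 1 + \<rho> ^ m * (cmod (mass a m 1))\<^sup>2)"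
proof (induction M)
  case (Suc M)
  have split: "sum f {1..<2 ^ Suc M} = sum f {1..<2 ^ M} + sum f (dyadic M 1)" for f :: "nat \<Rightarrow> 'a"
    unfolding dyadic_def
    by (simp add: sum.atLeastLessThan_concat mult_2)
  have "cinner (tree_vec n) (tree_vec n') = 0" if "n \<in> {1..<2 ^ M}" "n' \<in> dyadic M 1" for n n'
  proof (rule tree_vec_orthogonal)
    show "n \<in> dyadic (ilog 2 n) 1"
      using that ilog_le[of 2 n] ilog_less[of 2 n] by (auto simp: dyadic_def)
    have "(2::nat) ^ ilog 2 n < 2 ^ M"
      by (rule le_less_trans[OF ilog_le[of 2 n]]) (use that in auto)
    then show "ilog 2 n \<noteq> M" by auto
  qed (use that in auto)
  then have "cinner (\<Sum>n\<in>{1..<2 ^ M}. a n *\<^sub>C tree_vec n) (\<Sum>n\<in>dyadic M 1. a n *\<^sub>C tree_vec n) = 0"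
    by (auto simp: cinner_simps intro!: sum.neutral)
  then show ?case
    unfolding split by (simp only: norm_add_orthogonal Suc norm_tree_sum sum.lessThan_Suc)
qed simp

definition tree_basis :: "nat \<Rightarrow> 'a" where "tree_basis n = tree_vec (Suc n)"

lemma sum_tree_basis:
  assumes "N < 2 ^ M"
  shows "(\<Sum>n<N. a n *\<^sub>C tree_basis n) = (\<Sum>n\<in>{1..<2 ^ M}. trunc (Suc N) (\<lambda>n. a (n - 1)) n *\<^sub>C tree_vec n)"
proof -
  have "(\<Sum>n<N. a n *\<^sub>C tree_basis n) = (\<Sum>n\<in>{1..<Suc N}. a (n - 1) *\<^sub>C tree_vec n)"
    unfolding tree_basis_def
    by (rule sum.reindex_bij_witness[of _ "\<lambda>n. n - 1" Suc]) auto
  also have "\<dots> = (\<Sum>n\<in>{1..<2 ^ M}. trunc (Suc N) (\<lambda>n. a (n - 1)) n *\<^sub>C tree_vec n)"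
    using assms by (intro sum.mono_neutral_cong_left) (auto simp: trunc_def)
  finally show ?thesis .
qed

lemma norm_tree_basis: "norm (tree_basis n) = 1"
proof -
  have "(norm (haar_part k n))\<^sup>2 = 1 - \<rho> ^ k" for k n
  proof (induction k)
    case (Suc k)
    have "haar_part (Suc k) n = haar_part k n + (wt k * sgn_bit k n) *\<^sub>C w (Suc k, n div 2 ^ Suc k - 1)"
      by (simp add: haar_part_def)
    also have "(norm \<dots>)\<^sup>2 = (norm (haar_part k n))\<^sup>2
        + (norm ((wt k * sgn_bit k n) *\<^sub>C w (Suc k, n div 2 ^ Suc k - 1)))\<^sup>2"
      by (rule norm_add_orthogonal) (simp add: cinner_simps haar_part_orthogonal_other_level)
    finally show ?case
      by (simp add: Suc norm_scaleC orthonormal_norm[OF w] norm_mult power_mult_distrib wt norm_sgn_bit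
          algebra_simps)
  qed (simp add: haar_part_def)
  then have "(norm (tree_vec m))\<^sup>2 = 1" for m
    unfolding tree_vec_def using rho
    by (subst norm_add_orthogonal)
      (auto simp: cinner_simps haar_part_orthogonal_other_level norm_scaleC orthonormal_norm[OF w])
  then show ?thesis
    unfolding tree_basis_def by (metis norm_ge_zero power2_eq_iff_nonneg one_power2 zero_le_one)
qed

text \<open>Truncation acts on each tree separately, and different trees span orthogonal subspaces.\<close>

lemma tree_basis_partial_sums:
  assumes "1/4 < \<rho>"
  obtains E where "1 \<le> E"
    "\<And>a r N. r \<le> N \<Longrightarrow> (norm (\<Sum>n<r. a n *\<^sub>C tree_basis n))\<^sup>2 \<le> E * (norm (\<Sum>n<N. a n *\<^sub>C tree_basis n))\<^sup>2"
proof -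
  obtain E where E: "1 \<le> E"
    "\<And>a k q r. osc \<rho> (trunc r a) k q + \<rho> ^ k * (cmod (mass (trunc r a) k q))\<^sup>2
        \<le> E * (osc \<rho> a k q + \<rho> ^ k * (cmod (mass a k q))\<^sup>2)"
    using trunc_bound[OF assms rho(2)] by metis
  show ?thesis
  proof (rule that[OF E(1)])
    fix a :: "nat \<Rightarrow> complex" and r N :: nat assume "r \<le> N"
    have N: "N < 2 ^ N" by (rule less_exp)
    define b where "b = trunc (Suc N) (\<lambda>n. a (n - 1))"
    have "trunc (Suc r) (\<lambda>n. a (n - 1)) = trunc (Suc r) b"
      using \<open>r \<le> N\<close> by (auto simp: b_def trunc_def)
    moreover have "r < 2 ^ N" using \<open>r \<le> N\<close> N by (rule le_less_trans)
    ultimately have "(norm (\<Sum>n<r. a n *\<^sub>C tree_basis n))\<^sup>2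
        = (\<Sum>m<N. osc \<rho> (trunc (Suc r) b) m 1 + \<rho> ^ m * (cmod (mass (trunc (Suc r) b) m 1))\<^sup>2)"
      by (simp only: sum_tree_basis norm_sum_trees)
    also have "\<dots> \<le> (\<Sum>m<N. E * (osc \<rho> b m 1 + \<rho> ^ m * (cmod (mass b m 1))\<^sup>2))"
      by (intro sum_mono E(2))
    also have "\<dots> = E * (norm (\<Sum>n<N. a n *\<^sub>C tree_basis n))\<^sup>2"
      unfolding sum_tree_basis[OF N] norm_sum_trees b_def by (simp only: sum_distrib_left)
    finally show "(norm (\<Sum>n<r. a n *\<^sub>C tree_basis n))\<^sup>2 \<le> E * (norm (\<Sum>n<N. a n *\<^sub>C tree_basis n))\<^sup>2" .
  qed
qed

lemma sum_square_trees:
  "(\<Sum>m<N. \<Sum>n\<in>dyadic m 1. (cmod (trunc (Suc N) (\<lambda>n. a (n - 1)) n))\<^sup>2) = (\<Sum>n<N. (cmod (a n))\<^sup>2)"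
proof -
  have *: "(\<Sum>m<M. sum f (dyadic m 1)) = sum f {1..<2 ^ M}" for f :: "nat \<Rightarrow> real" and M
  proof (induction M)
    case (Suc M)
    then show ?case by (simp add: dyadic_def sum.atLeastLessThan_concat mult_2)
  qed simp
  have N: "N < 2 ^ N" by (rule less_exp)
  have "(\<Sum>n<N. (cmod (a n))\<^sup>2) = (\<Sum>n\<in>{1..<Suc N}. (cmod (a (n - 1)))\<^sup>2)"
    by (rule sum.reindex_bij_witness[of _ "\<lambda>n. n - 1" Suc]) auto
  also have "\<dots> = (\<Sum>n\<in>{1..<2 ^ N}. (cmod (trunc (Suc N) (\<lambda>n. a (n - 1)) n))\<^sup>2)"
    using Suc_leI[OF N] by (intro sum.mono_neutral_cong_left) (auto simp: trunc_def)
  finally show ?thesis unfolding * ..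
qed

lemma tree_basis_besselian:
  assumes "1/2 \<le> \<rho>"
  shows "2 * (1 - \<rho>) * (\<Sum>n<N. (cmod (a n))\<^sup>2) \<le> (norm (\<Sum>n<N. a n *\<^sub>C tree_basis n))\<^sup>2"
  unfolding sum_tree_basis[OF less_exp] norm_sum_trees sum_square_trees[of N a, symmetric] sum_distrib_left
  by (intro sum_mono osc_besselian[unfolded sum_distrib_left] assms rho(2))

lemma tree_basis_hilbertian:
  assumes "\<rho> \<le> 1/2"
  shows "(norm (\<Sum>n<N. a n *\<^sub>C tree_basis n))\<^sup>2 \<le> 2 * (1 - \<rho>) * (\<Sum>n<N. (cmod (a n))\<^sup>2)"
  unfolding sum_tree_basis[OF less_exp] norm_sum_trees sum_square_trees[of N a, symmetric] sum_distrib_left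
  by (intro sum_mono osc_hilbertian[unfolded sum_distrib_left] assms rho(1))

lemma norm_tree_indicator:
  "(norm (\<Sum>n\<in>{2 ^ m - 1..<2 ^ Suc m - 1}. tree_basis n))\<^sup>2 = (4 * \<rho>) ^ m"
proof -
  have "(\<Sum>n\<in>{2 ^ m - 1..<2 ^ Suc m - 1}. tree_basis n) = (\<Sum>n\<in>dyadic m 1. (\<lambda>_. 1) n *\<^sub>C tree_vec n)"
    unfolding tree_basis_def dyadic_def
    by (rule sum.reindex_bij_witness[of _ "\<lambda>n. n - 1" Suc]) (auto simp: scaleC_one)
  also have "(norm \<dots>)\<^sup>2 = \<rho> ^ m * ((2 ^ m)\<^sup>2)"
    unfolding norm_tree_sum by (simp add: osc_const mass_const norm_power)
  also have "\<dots> = (4 * \<rho>) ^ m"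
    unfolding power2_eq_square power_mult_distrib[symmetric] by (simp add: mult.commute)
  finally show ?thesis .
qed

lemma tree_basis_in_span: "tree_basis n \<in> complex_vector.span (range w)"
  unfolding tree_basis_def tree_vec_def haar_part_def
  by (intro complex_vector.span_add complex_vector.span_sum complex_vector.span_scale
      complex_vector.span_base rangeI)

text \<open>Averaging the leaf vectors over a dyadic interval of length \<open>2 ^ k\<close> leaves the contributions of
the levels above \<open>k\<close>, which are common to all leaves of the interval, and annihilates the
others, because the oscillation of a constant sequence is zero.\<close>

lemma haar_part_tail_in_span:
  assumes "n \<ge> 1" "k \<le> ilog 2 n"
  shows "tree_vec n - haar_part k n \<in> complex_vector.span (range tree_basis)"
proof -
  define p where "p = n div 2 ^ k"
  define m where "m = ilog 2 n"
  have m: "2 ^ m \<le> n" "n < 2 ^ Suc m"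
    unfolding m_def using assms by (auto intro: ilog_le ilog_less simp del: power_Suc)
  have k: "k \<le> m" using assms by (simp add: m_def)
  have p1: "p \<ge> 1"
  proof -
    have "2 ^ k \<le> n" using m(1) k by (meson order_trans power_increasing one_le_numeral)
    then show ?thesis by (simp add: p_def Suc_le_eq div_greater_zero_iff)
  qed
  have same: "tree_vec n' - haar_part k n' = tree_vec n - haar_part k n" if "n' \<in> dyadic k p" for n'
  proof -
    have div: "n' div 2 ^ j = n div 2 ^ j" if "k \<le> j" for j
    proof -
      have "x div 2 ^ j = x div 2 ^ k div 2 ^ (j - k)" for x :: nat
        using that by (simp add: div_mult2_eq[symmetric] power_add[symmetric])
      then show ?thesis using \<open>n' \<in> dyadic k p\<close> by (simp add: mem_dyadic_iff p_def)
    qed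
    have "n' div 2 ^ m = 1"
      unfolding div[OF k] using m by (intro div_nat_eqI) auto
    then have ilog: "ilog 2 n' = m" by (intro ilog_root) (simp add: mem_dyadic_iff)
    have tail: "haar_part m x - haar_part k x
        = (\<Sum>i\<in>{k..<m}. (wt i * sgn_bit i x) *\<^sub>C w (Suc i, x div 2 ^ Suc i - 1))" for x
    proof -
      have "{..<m} = {..<k} \<union> {k..<m}" using k by auto
      then show ?thesis
        unfolding haar_part_def by (simp add: sum.union_disjoint ivl_disj_int)
    qed
    have "haar_part m n' - haar_part k n' = haar_part m n - haar_part k n"
      unfolding tail by (intro sum.cong) (auto simp: sgn_bit_def div simp del: power_Suc)
    then show ?thesis
      unfolding tree_vec_def ilog m_def[symmetric] by (simp add: algebra_simps)
  qed
  have "(norm (\<Sum>n'\<in>dyadic k p. 1 *\<^sub>C haar_part k n'))\<^sup>2 = osc \<rho> (\<lambda>_. 1) k p"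
    by (rule norm_haar_sum[OF p1])
  then have zero: "(\<Sum>n'\<in>dyadic k p. haar_part k n') = 0"
    by (simp add: osc_const scaleC_one)
  have "(\<Sum>n'\<in>dyadic k p. tree_vec n') = (\<Sum>n'\<in>dyadic k p. tree_vec n' - haar_part k n')"
    by (simp add: sum_subtractf zero)
  also have "\<dots> = (\<Sum>n'\<in>dyadic k p. 1 *\<^sub>C (tree_vec n - haar_part k n))"
    by (intro sum.cong) (simp_all add: same scaleC_one)
  also have "\<dots> = 2 ^ k *\<^sub>C (tree_vec n - haar_part k n)"
    by (simp only: complex_vector.scale_sum_left[symmetric]) (simp add: card_dyadic)
  finally have "tree_vec n - haar_part k n = inverse (2 ^ k) *\<^sub>C (\<Sum>n'\<in>dyadic k p. tree_vec n')"
    by (simp add: scaleC_scaleC scaleC_one)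
  also have "\<dots> \<in> complex_vector.span (range tree_basis)"
  proof (intro complex_vector.span_scale complex_vector.span_sum)
    fix n' assume "n' \<in> dyadic k p"
    then have "n' \<ge> 1" using p1 by (cases "n' = 0") (auto simp: mem_dyadic_iff)
    then have "tree_vec n' = tree_basis (n' - 1)" by (simp add: tree_basis_def)
    then show "tree_vec n' \<in> complex_vector.span (range tree_basis)"
      by (auto intro: complex_vector.span_base)
  qed
  finally show ?thesis .
qed

text \<open>Each node vector is the difference of two consecutive averages, up to a nonzero factor; the
average over a whole tree gives the mean vector.\<close>

lemma w_in_span: "w ip \<in> complex_vector.span (range tree_basis)"
proof -
  have scale: "x \<in> complex_vector.span B" if "c *\<^sub>C x \<in> complex_vector.span B" "c \<noteq> 0" 
    for c and x :: 'a and B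
    using complex_vector.span_scale[OF that(1), of "inverse c"] that(2) by (simp add: scaleC_scaleC scaleC_one)
  obtain i p where ip: "ip = (i, p)" by (cases ip)
  show ?thesis
  proof (cases i)
    case 0
    have "ilog 2 (2 ^ p) = p" by (intro ilog_eqI) auto
    then have "complex_of_real (sqrt (\<rho> ^ p)) *\<^sub>C w (0, p) = tree_vec (2 ^ p) - haar_part p (2 ^ p)"
      by (simp add: tree_vec_def)
    also have "\<dots> \<in> complex_vector.span (range tree_basis)"
      using \<open>ilog 2 (2 ^ p) = p\<close> by (intro haar_part_tail_in_span) auto
    finally show ?thesis
      using rho unfolding ip 0 by (elim scale) simp
  next
    case (Suc k)
    define n where "n = Suc p * 2 ^ Suc k"
    have n2: "2 ^ Suc k \<le> n" by (simp add: n_def)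
    then have n: "n \<ge> 1" using one_le_power[of "2::nat" "Suc k"] by linarith
    note n2
    also have "n < 2 ^ Suc (ilog 2 n)" by (rule ilog_less) simp
    finally have k: "Suc k \<le> ilog 2 n" by (simp only: power_strict_increasing_iff less_Suc_eq_le)
    have "n div 2 ^ Suc k - 1 = p" unfolding n_def by simp
    then have "(wt k * sgn_bit k n) *\<^sub>C w (Suc k, p) = haar_part (Suc k) n - haar_part k n"
      by (simp add: haar_part_def)
    also have "\<dots> = (tree_vec n - haar_part k n) - (tree_vec n - haar_part (Suc k) n)"
      by simp
    also have "\<dots> \<in> complex_vector.span (range tree_basis)"
      using k n by (intro complex_vector.span_diff haar_part_tail_in_span) auto
    finally show ?thesis
      unfolding ip Suc by (elim scale) (auto simp: wt sgn_bit_def)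
  qed
qed

end

section \<open>Pairing two tree bases\<close>

lemma sum_trunc:
  fixes x :: "nat \<Rightarrow> 'a::complex_normed_vector"
  assumes "r \<le> N"
  shows "(\<Sum>j<N. trunc r a j *\<^sub>C x j) = (\<Sum>j<r. a j *\<^sub>C x j)"
  using assms by (intro sum.mono_neutral_cong_right) (auto simp: trunc_def)

lemma sum_square_trunc:
  assumes "r \<le> N"
  shows "(\<Sum>j<N. (cmod (trunc r a j))\<^sup>2) = (\<Sum>j<r. (cmod (a j))\<^sup>2)"
  using assms by (intro sum.mono_neutral_cong_right) (auto simp: trunc_def)

lemma cmod_half: "(cmod (complex_of_real (1 / sqrt 2)))\<^sup>2 = 1 / 2"
  by (simp add: norm_divide power_divide)

locale pair_system =
  fixes \<rho> \<rho>' :: real and v :: "nat \<Rightarrow> 'a::complex_inner"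
  assumes rho: "1/4 < \<rho>" "\<rho> < 1" and rho': "1/4 < \<rho>'" "\<rho>' < 1" and v: "orthonormal v"
begin

sublocale A: tree_system \<rho> "\<lambda>ip. v (2 * prod_encode ip)"
  using rho by unfold_locales (auto intro!: orthonormal_comp[OF v] injI)

sublocale B: tree_system \<rho>' "\<lambda>ip. v (Suc (2 * prod_encode ip))"
  using rho' by unfold_locales (auto intro!: orthonormal_comp[OF v] injI)

definition pair_basis :: "nat \<Rightarrow> 'a" where
  "pair_basis j = complex_of_real (1 / sqrt 2) *\<^sub>C
     (if even j then A.tree_basis (j div 2) + B.tree_basis (j div 2) else A.tree_basis (j div 2) - B.tree_basis (j div 2))"

lemma pair_basis_even: "pair_basis (2 * n) = complex_of_real (1 / sqrt 2) *\<^sub>C (A.tree_basis n + B.tree_basis n)"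
  and pair_basis_odd: "pair_basis (Suc (2 * n)) = complex_of_real (1 / sqrt 2) *\<^sub>C (A.tree_basis n - B.tree_basis n)"
  by (simp_all add: pair_basis_def)

lemma AB_orthogonal: "cinner (A.tree_basis n) (B.tree_basis n') = 0"
proof -
  have *: "cinner (v (2 * prod_encode ip)) (B.tree_basis n') = 0" for ip
    by (rule cinner_eq_0_span[OF _ B.tree_basis_in_span])
      (auto simp: orthonormalD[OF v], presburger)
  have "cinner (B.tree_basis n') (A.tree_basis n) = 0"
    by (rule cinner_eq_0_span[OF _ A.tree_basis_in_span]) (metis (no_types, lifting) * cinner_commute complex_cnj_zero rangeE)
  then show ?thesis by (metis cinner_commute complex_cnj_zero)
qed

lemma BA_orthogonal: "cinner (B.tree_basis n) (A.tree_basis n') = 0"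
  using AB_orthogonal cinner_commute complex_cnj_zero by metis

lemma norm_AB:
  "(norm (complex_of_real (1 / sqrt 2) *\<^sub>C ((\<Sum>n\<in>I. a n *\<^sub>C A.tree_basis n) + (\<Sum>n\<in>I. b n *\<^sub>C B.tree_basis n))))\<^sup>2
    = ((norm (\<Sum>n\<in>I. a n *\<^sub>C A.tree_basis n))\<^sup>2 + (norm (\<Sum>n\<in>I. b n *\<^sub>C B.tree_basis n))\<^sup>2) / 2"
proof -
  have "(norm ((\<Sum>n\<in>I. a n *\<^sub>C A.tree_basis n) + (\<Sum>n\<in>I. b n *\<^sub>C B.tree_basis n)))\<^sup>2
     = (norm (\<Sum>n\<in>I. a n *\<^sub>C A.tree_basis n))\<^sup>2 + (norm (\<Sum>n\<in>I. b n *\<^sub>C B.tree_basis n))\<^sup>2"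
    by (rule norm_add_orthogonal) (simp add: cinner_simps AB_orthogonal)
  then show ?thesis
    unfolding norm_scaleC power_mult_distrib cmod_half by simp
qed

lemma sum_pair_basis:
  "(\<Sum>j<2 * N. a j *\<^sub>C pair_basis j) = complex_of_real (1 / sqrt 2) *\<^sub>C
     ((\<Sum>n<N. (a (2 * n) + a (Suc (2 * n))) *\<^sub>C A.tree_basis n) + (\<Sum>n<N. (a (2 * n) - a (Suc (2 * n))) *\<^sub>C B.tree_basis n))"
proof (induction N)
  case (Suc N)
  have "2 * Suc N = Suc (Suc (2 * N))" by simp
  then have "(\<Sum>j<2 * Suc N. a j *\<^sub>C pair_basis j)
     = (\<Sum>j<2 * N. a j *\<^sub>C pair_basis j) + a (2 * N) *\<^sub>C pair_basis (2 * N) + a (Suc (2 * N)) *\<^sub>C pair_basis (Suc (2 * N))"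
    by (simp only: sum.lessThan_Suc)
  then show ?case
    unfolding Suc pair_basis_even pair_basis_odd
    by (simp add: scaleC_add_right scaleC_add_left scaleC_scaleC
        complex_vector.scale_left_diff_distrib complex_vector.scale_right_diff_distrib algebra_simps)
qed simp

lemma norm_sum_pair_basis:
  "(norm (\<Sum>j<2 * N. a j *\<^sub>C pair_basis j))\<^sup>2 =
     ((norm (\<Sum>n<N. (a (2 * n) + a (Suc (2 * n))) *\<^sub>C A.tree_basis n))\<^sup>2
      + (norm (\<Sum>n<N. (a (2 * n) - a (Suc (2 * n))) *\<^sub>C B.tree_basis n))\<^sup>2) / 2"
  unfolding sum_pair_basis by (rule norm_AB)

lemma norm_pair_basis: "norm (pair_basis j) = 1"
proof -
  have "(norm (A.tree_basis n + B.tree_basis n))\<^sup>2 = 2" "(norm (A.tree_basis n - B.tree_basis n))\<^sup>2 = 2" for n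
    using norm_add_orthogonal[OF AB_orthogonal, of n n] norm_add_orthogonal[of "A.tree_basis n" "- B.tree_basis n"]
    by (simp_all add: A.norm_tree_basis B.norm_tree_basis AB_orthogonal cinner_diff_right[of _ 0, simplified])
  then have "(norm (pair_basis j))\<^sup>2 = 1"
    unfolding pair_basis_def norm_scaleC power_mult_distrib cmod_half by simp
  then show ?thesis by (metis norm_ge_zero power2_eq_iff_nonneg one_power2 zero_le_one)
qed

lemma norm_pair:
  "(norm (\<alpha> *\<^sub>C pair_basis (2 * n) + \<beta> *\<^sub>C pair_basis (Suc (2 * n))))\<^sup>2 = (cmod \<alpha>)\<^sup>2 + (cmod \<beta>)\<^sup>2"
proof -
  have "cinner (pair_basis (2 * n)) (pair_basis (Suc (2 * n))) = 0"
    by (simp add: pair_basis_even pair_basis_odd cinner_simps AB_orthogonal BA_orthogonal cinner_self A.norm_tree_basis B.norm_tree_basis)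
  then show ?thesis
    by (subst norm_add_orthogonal) (auto simp: cinner_simps norm_scaleC norm_pair_basis)
qed

text \<open>Partial sums of even length are partial sums in both trees. An odd one has one more term, which
is bounded by the sum over its pair because the two members of a pair are orthonormal.\<close>

lemma pair_basis_partial_sums:
  obtains K where "1 \<le> K"
    "\<And>a m n. m \<le> n \<Longrightarrow> norm (\<Sum>j<m. a j *\<^sub>C pair_basis j) \<le> K * norm (\<Sum>j<n. a j *\<^sub>C pair_basis j)"
proof -
  obtain E where E: "1 \<le> E" "\<And>a r N. r \<le> N \<Longrightarrow>
      (norm (\<Sum>n<r. a n *\<^sub>C A.tree_basis n))\<^sup>2 \<le> E * (norm (\<Sum>n<N. a n *\<^sub>C A.tree_basis n))\<^sup>2"
    by (rule A.tree_basis_partial_sums[OF rho(1)]) blast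
  obtain E' where E': "1 \<le> E'" "\<And>a r N. r \<le> N \<Longrightarrow>
      (norm (\<Sum>n<r. a n *\<^sub>C B.tree_basis n))\<^sup>2 \<le> E' * (norm (\<Sum>n<N. a n *\<^sub>C B.tree_basis n))\<^sup>2"
    by (rule B.tree_basis_partial_sums[OF rho'(1)]) blast
  define D where "D = sqrt (max E E')"
  have D: "1 \<le> D" "D\<^sup>2 = max E E'" using E E' by (auto simp: D_def)
  have even: "norm (\<Sum>j<2 * r. a j *\<^sub>C pair_basis j) \<le> D * norm (\<Sum>j<2 * N. a j *\<^sub>C pair_basis j)" if "r \<le> N" for a r N
  proof (rule power2_le_imp_le)
    have A: "(norm (\<Sum>n<r. b n *\<^sub>C A.tree_basis n))\<^sup>2 \<le> D\<^sup>2 * (norm (\<Sum>n<N. b n *\<^sub>C A.tree_basis n))\<^sup>2" for b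
      unfolding D(2) by (rule order_trans[OF E(2)[OF that]]) (auto intro: mult_right_mono)
    have B: "(norm (\<Sum>n<r. b n *\<^sub>C B.tree_basis n))\<^sup>2 \<le> D\<^sup>2 * (norm (\<Sum>n<N. b n *\<^sub>C B.tree_basis n))\<^sup>2" for b
      unfolding D(2) by (rule order_trans[OF E'(2)[OF that]]) (auto intro: mult_right_mono)
    have avg: "(p + q) / 2 \<le> d * ((p' + q') / 2)" if "p \<le> d * p'" "q \<le> d * q'" for p q p' q' d :: real
      using that by (simp add: algebra_simps)
    show "(norm (\<Sum>j<2 * r. a j *\<^sub>C pair_basis j))\<^sup>2 \<le> (D * norm (\<Sum>j<2 * N. a j *\<^sub>C pair_basis j))\<^sup>2"
      unfolding power_mult_distrib norm_sum_pair_basis by (rule avg[OF A B])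
  qed (use D in auto)
  show ?thesis
  proof (rule that[of "3 * D"])
    fix a :: "nat \<Rightarrow> complex" and m n :: nat assume "m \<le> n"
    define F where "F = norm (\<Sum>j<n. a j *\<^sub>C pair_basis j)"
    define b where "b = trunc n a"
    have F: "F = norm (\<Sum>j<2 * n. b j *\<^sub>C pair_basis j)"
      by (simp add: F_def b_def sum_trunc)
    have m: "(\<Sum>j<m. a j *\<^sub>C pair_basis j) = (\<Sum>j<m. b j *\<^sub>C pair_basis j)"
      using \<open>m \<le> n\<close> by (intro sum.cong) (auto simp: b_def trunc_def)
    define r where "r = m div 2"
    have er: "norm (\<Sum>j<2 * r. b j *\<^sub>C pair_basis j) \<le> D * F"
      unfolding F using \<open>m \<le> n\<close> by (intro even) (auto simp: r_def)
    have DF: "0 \<le> D * F" using D by (simp add: F_def)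
    have "norm (\<Sum>j<m. b j *\<^sub>C pair_basis j) \<le> 3 * (D * F)"
    proof (cases "even m")
      case True
      then have "m = 2 * r" by (simp add: r_def)
      then show ?thesis using er DF by simp
    next
      case False
      then have mr: "m = Suc (2 * r)" by (simp add: r_def)
      have er': "norm (\<Sum>j<2 * Suc r. b j *\<^sub>C pair_basis j) \<le> D * F"
        unfolding F using \<open>m \<le> n\<close> mr by (intro even) auto
      let ?z = "b (2 * r) *\<^sub>C pair_basis (2 * r) + b (Suc (2 * r)) *\<^sub>C pair_basis (Suc (2 * r))"
      have "?z = (\<Sum>j<2 * Suc r. b j *\<^sub>C pair_basis j) - (\<Sum>j<2 * r. b j *\<^sub>C pair_basis j)"
        by simp
      then have "norm ?z \<le> D * F + D * F"
        by (simp only: order_trans[OF norm_triangle_ineq4 add_mono[OF er' er]])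
      moreover have "cmod (b (2 * r)) \<le> norm ?z"
        by (rule power2_le_imp_le) (simp_all add: norm_pair)
      moreover have "norm (\<Sum>j<m. b j *\<^sub>C pair_basis j) \<le> norm (\<Sum>j<2 * r. b j *\<^sub>C pair_basis j) + cmod (b (2 * r))"
        unfolding mr sum.lessThan_Suc
        by (rule order_trans[OF norm_triangle_ineq]) (simp add: norm_scaleC norm_pair_basis)
      ultimately show ?thesis using er by linarith
    qed
    then show "norm (\<Sum>j<m. a j *\<^sub>C pair_basis j) \<le> 3 * D * norm (\<Sum>j<n. a j *\<^sub>C pair_basis j)"
      unfolding m F_def by simp
  qed (use D in auto)
qed

lemma sum_square_pairs:
  "(\<Sum>n<N. (cmod (a (2 * n) + a (Suc (2 * n))))\<^sup>2) + (\<Sum>n<N. (cmod (a (2 * n) - a (Suc (2 * n))))\<^sup>2)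
    = 2 * (\<Sum>j<2 * N. (cmod (a j))\<^sup>2)"
proof (induction N)
  case (Suc N)
  have "2 * Suc N = Suc (Suc (2 * N))" by simp
  then have S: "(\<Sum>j<2 * Suc N. (cmod (a j))\<^sup>2)
      = (\<Sum>j<2 * N. (cmod (a j))\<^sup>2) + (cmod (a (2 * N)))\<^sup>2 + (cmod (a (Suc (2 * N))))\<^sup>2"
    by (simp only: sum.lessThan_Suc)
  have arith: "A + x + (B + y) = 2 * (s + p + q)" if "A + B = 2 * s" "x + y = 2 * (p + q)"
    for A B s x y p q :: real
    using that by simp
  show ?case
    unfolding S sum.lessThan_Suc[of _ N] by (rule arith[OF Suc cmod_parallelogram])
qed simp

lemma pair_basis_besselian:
  assumes "1/2 \<le> \<rho>" "1/2 \<le> \<rho>'"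
  obtains c where "c > 0" "\<And>a N. c * (\<Sum>j<N. (cmod (a j))\<^sup>2) \<le> (norm (\<Sum>j<N. a j *\<^sub>C pair_basis j))\<^sup>2"
proof -
  define c where "c = min (2 * (1 - \<rho>)) (2 * (1 - \<rho>'))"
  have c: "c > 0" "c \<le> 2 * (1 - \<rho>)" "c \<le> 2 * (1 - \<rho>')" using rho rho' by (auto simp: c_def)
  have A: "c * (\<Sum>n<N. (cmod (a n))\<^sup>2) \<le> (norm (\<Sum>n<N. a n *\<^sub>C A.tree_basis n))\<^sup>2" for a N
    by (rule order_trans[OF mult_right_mono[OF c(2)] A.tree_basis_besselian[OF assms(1)]]) (simp add: sum_nonneg)
  have B: "c * (\<Sum>n<N. (cmod (a n))\<^sup>2) \<le> (norm (\<Sum>n<N. a n *\<^sub>C B.tree_basis n))\<^sup>2" for a N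
    by (rule order_trans[OF mult_right_mono[OF c(3)] B.tree_basis_besselian[OF assms(2)]]) (simp add: sum_nonneg)
  have average: "c * s \<le> (P + Q) / 2" if "c * x \<le> P" "c * y \<le> Q" "x + y = 2 * s" for x y s P Q :: real
  proof -
    have "c * s = (c * x + c * y) / 2" unfolding distrib_left[symmetric] that(3) by simp
    then show ?thesis using that(1,2) by (simp only: divide_right_mono add_mono zero_le_numeral)
  qed
  have "c * (\<Sum>j<2 * N. (cmod (a j))\<^sup>2) \<le> (norm (\<Sum>j<2 * N. a j *\<^sub>C pair_basis j))\<^sup>2" for a N
    unfolding norm_sum_pair_basis by (rule average[OF A B sum_square_pairs])
  from this[of "trunc N a" N for a N] show ?thesis
    by (intro that[OF c(1)]) (simp add: sum_trunc sum_square_trunc)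
qed

lemma pair_basis_hilbertian:
  assumes "\<rho> \<le> 1/2" "\<rho>' \<le> 1/2"
  obtains c where "c > 0" "\<And>a N. (norm (\<Sum>j<N. a j *\<^sub>C pair_basis j))\<^sup>2 \<le> c * (\<Sum>j<N. (cmod (a j))\<^sup>2)"
proof -
  define c where "c = max (2 * (1 - \<rho>)) (2 * (1 - \<rho>'))"
  have c: "c > 0" "2 * (1 - \<rho>) \<le> c" "2 * (1 - \<rho>') \<le> c" using rho rho' by (auto simp: c_def)
  have A: "(norm (\<Sum>n<N. a n *\<^sub>C A.tree_basis n))\<^sup>2 \<le> c * (\<Sum>n<N. (cmod (a n))\<^sup>2)" for a N
    by (rule order_trans[OF A.tree_basis_hilbertian[OF assms(1)] mult_right_mono[OF c(2)]]) (simp add: sum_nonneg)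
  have B: "(norm (\<Sum>n<N. a n *\<^sub>C B.tree_basis n))\<^sup>2 \<le> c * (\<Sum>n<N. (cmod (a n))\<^sup>2)" for a N
    by (rule order_trans[OF B.tree_basis_hilbertian[OF assms(2)] mult_right_mono[OF c(3)]]) (simp add: sum_nonneg)
  have average: "(P + Q) / 2 \<le> c * s" if "P \<le> c * x" "Q \<le> c * y" "x + y = 2 * s" for x y s P Q :: real
  proof -
    have "c * s = (c * x + c * y) / 2" unfolding distrib_left[symmetric] that(3) by simp
    then show ?thesis using that(1,2) by (simp only: divide_right_mono add_mono zero_le_numeral)
  qed
  have "(norm (\<Sum>j<2 * N. a j *\<^sub>C pair_basis j))\<^sup>2 \<le> c * (\<Sum>j<2 * N. (cmod (a j))\<^sup>2)" for a N
    unfolding norm_sum_pair_basis by (rule average[OF A B sum_square_pairs])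
  from this[of "trunc N a" N for a N] show ?thesis
    by (intro that[OF c(1)]) (simp add: sum_trunc sum_square_trunc)
qed

text \<open>This and \<open>norm_even_half\<close> give the lower bound for the conditionality: both sums run over the
pairs of a tree, the second being a coordinate projection of the first.\<close>

lemma norm_alternating:
  "(norm (\<Sum>n\<in>{2 ^ m - 1..<2 ^ Suc m - 1}. pair_basis (2 * n) - pair_basis (Suc (2 * n))))\<^sup>2 = 2 * (4 * \<rho>') ^ m"
proof -
  have "pair_basis (2 * n) - pair_basis (Suc (2 * n)) = complex_of_real (sqrt 2) *\<^sub>C B.tree_basis n" for n
  proof -
    have "complex_of_real (1 / sqrt 2) + complex_of_real (1 / sqrt 2) = complex_of_real (sqrt 2)"
      unfolding of_real_add[symmetric] by (simp add: real_div_sqrt)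
    then show ?thesis
      unfolding pair_basis_even pair_basis_odd
      by (simp add: scaleC_add_right complex_vector.scale_right_diff_distrib flip: scaleC_add_left)
  qed
  then have "(\<Sum>n\<in>{2 ^ m - 1..<2 ^ Suc m - 1}. pair_basis (2 * n) - pair_basis (Suc (2 * n)))
      = complex_of_real (sqrt 2) *\<^sub>C (\<Sum>n\<in>{2 ^ m - 1..<2 ^ Suc m - 1}. B.tree_basis n)"
    by (simp add: complex_vector.scale_sum_right)
  then show ?thesis
    by (simp only: norm_scaleC power_mult_distrib B.norm_tree_indicator) simp
qed

lemma norm_even_half:
  "(norm (\<Sum>n\<in>{2 ^ m - 1..<2 ^ Suc m - 1}. pair_basis (2 * n)))\<^sup>2 = ((4 * \<rho>) ^ m + (4 * \<rho>') ^ m) / 2"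
proof -
  let ?I = "{2 ^ m - 1..<2 ^ Suc m - 1} :: nat set"
  have "(\<Sum>n\<in>?I. pair_basis (2 * n)) = complex_of_real (1 / sqrt 2) *\<^sub>C
      ((\<Sum>n\<in>?I. 1 *\<^sub>C A.tree_basis n) + (\<Sum>n\<in>?I. 1 *\<^sub>C B.tree_basis n))"
    unfolding pair_basis_even complex_vector.scale_sum_right[symmetric] by (simp only: scaleC_one sum.distrib)
  then have "(norm (\<Sum>n\<in>?I. pair_basis (2 * n)))\<^sup>2
      = ((norm (\<Sum>n\<in>?I. 1 *\<^sub>C A.tree_basis n))\<^sup>2 + (norm (\<Sum>n\<in>?I. 1 *\<^sub>C B.tree_basis n))\<^sup>2) / 2"
    by (simp only: norm_AB)
  then show ?thesis
    by (simp only: scaleC_one A.norm_tree_indicator B.norm_tree_indicator)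
qed

lemma pair_basis_in_span: "pair_basis j \<in> complex_vector.span (range v)"
proof -
  have "A.tree_basis n \<in> complex_vector.span (range v)" "B.tree_basis n \<in> complex_vector.span (range v)" for n
    using A.tree_basis_in_span[of n] B.tree_basis_in_span[of n]
      complex_vector.span_mono[of "range (\<lambda>ip. v (2 * prod_encode ip))" "range v"]
      complex_vector.span_mono[of "range (\<lambda>ip. v (Suc (2 * prod_encode ip)))" "range v"] by blast+
  then show ?thesis
    by (auto simp: pair_basis_def intro!: complex_vector.span_scale complex_vector.span_add complex_vector.span_diff)
qed

lemma v_in_span: "v i \<in> complex_vector.span (range pair_basis)"
proof -
  have base: "c *\<^sub>C pair_basis j \<in> complex_vector.span (range pair_basis)" for c j
    by (intro complex_vector.span_scale complex_vector.span_base) simp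
  have half: "complex_of_real (1 / sqrt 2) * complex_of_real (1 / sqrt 2) = 1 / 2"
    unfolding of_real_mult[symmetric] by simp
  have two: "(1/2 :: complex) *\<^sub>C x + (1/2 :: complex) *\<^sub>C x = x" for x :: 'a
    by (simp add: scaleC_one flip: scaleC_add_left)
  have "A.tree_basis n = complex_of_real (1 / sqrt 2) *\<^sub>C pair_basis (2 * n) + complex_of_real (1 / sqrt 2) *\<^sub>C pair_basis (Suc (2 * n))" for n
    unfolding pair_basis_even pair_basis_odd scaleC_scaleC half
    using two[of "A.tree_basis n"] by (simp add: scaleC_add_right complex_vector.scale_right_diff_distrib)
  then have A: "range A.tree_basis \<subseteq> complex_vector.span (range pair_basis)"
    using complex_vector.span_add[OF base base] by (metis image_subsetI)
  have "B.tree_basis n = complex_of_real (1 / sqrt 2) *\<^sub>C pair_basis (2 * n) - complex_of_real (1 / sqrt 2) *\<^sub>C pair_basis (Suc (2 * n))" for n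
    unfolding pair_basis_even pair_basis_odd scaleC_scaleC half
    using two[of "B.tree_basis n"] by (simp add: scaleC_add_right complex_vector.scale_right_diff_distrib)
  then have B: "range B.tree_basis \<subseteq> complex_vector.span (range pair_basis)"
    using complex_vector.span_diff[OF base base] by (metis image_subsetI)
  show ?thesis
  proof (cases "even i")
    case True
    then have "v i = v (2 * prod_encode (prod_decode (i div 2)))" by simp
    also have "\<dots> \<in> complex_vector.span (range pair_basis)"
      by (rule subsetD[OF complex_vector.span_minimal[OF A complex_vector.subspace_span] A.w_in_span])
    finally show ?thesis .
  next
    case False
    then have "v i = v (Suc (2 * prod_encode (prod_decode (i div 2))))" by simp
    also have "\<dots> \<in> complex_vector.span (range pair_basis)"
      by (rule subsetD[OF complex_vector.span_minimal[OF B complex_vector.subspace_span] B.w_in_span])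
    finally show ?thesis .
  qed
qed

end

section \<open>Block averages and the Dilworth-Kalton-Kutzarova basis\<close>

definition block_start :: "nat \<Rightarrow> nat" where
  "block_start n = 4 ^ n - 1"

lemma block_start_0 [simp]: "block_start 0 = 0"
  by (simp add: block_start_def)

lemma block_start_mono: "m \<le> n \<Longrightarrow> block_start m \<le> block_start n"
  by (simp add: block_start_def diff_le_mono power_increasing)

definition block :: "nat \<Rightarrow> nat set" where
  "block n = {block_start n..<block_start (Suc n)}"

definition block_of :: "nat \<Rightarrow> nat" where
  "block_of j = ilog 4 (Suc j)"

definition root_size :: "nat \<Rightarrow> real" where
  "root_size n = sqrt 3 * 2 ^ n"

lemma finite_block [simp]: "finite (block n)"
  by (simp add: block_def)

lemma mem_block_iff: "j \<in> block n \<longleftrightarrow> block_of j = n"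
proof
  assume "j \<in> block n"
  then show "block_of j = n"
    unfolding block_of_def by (intro ilog_eqI) (auto simp: block_def block_start_def)
next
  assume n: "block_of j = n"
  have "4 ^ n \<le> Suc j"
    unfolding n[symmetric] block_of_def by (rule ilog_le) auto
  moreover have "Suc j < 4 ^ Suc n"
    unfolding n[symmetric] block_of_def by (rule ilog_less) auto
  ultimately show "j \<in> block n" by (auto simp: block_def block_start_def)
qed

lemma root_size_pos [simp]: "root_size n > 0"
  by (simp add: root_size_def)

lemma root_size_neq_0 [simp]: "root_size n \<noteq> 0"
  by (simp add: root_size_def)

lemma card_block: "real (card (block n)) = (root_size n)\<^sup>2"
proof -
  have "real (card (block n)) = 3 * 4 ^ n" 
    by (simp add: block_def block_start_def)
  also have "(4::real) ^ n = (2 ^ n)\<^sup>2"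
    unfolding power2_eq_square power_mult_distrib[symmetric] by simp
  finally show ?thesis by (simp add: root_size_def power_mult_distrib)
qed

lemma of_nat_card_block:
  "of_nat (card (block n)) = complex_of_real (root_size n) * complex_of_real (root_size n)"
  using arg_cong[OF card_block[of n], of complex_of_real] by (simp add: power2_eq_square)

lemma less_block_iff: "j < block_start n \<longleftrightarrow> block_of j < n"
proof
  assume "j < block_start n"
  then have "Suc j < 4 ^ n" by (simp add: block_start_def)
  then have "4 ^ block_of j < (4::nat) ^ n"
    unfolding block_of_def by (intro le_less_trans[OF ilog_le]) auto
  then show "block_of j < n" by simp
next
  assume "block_of j < n"
  then have "(4::nat) ^ Suc (block_of j) \<le> 4 ^ n" by (intro power_increasing) auto
  moreover have "Suc j < 4 ^ Suc (block_of j)"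
    unfolding block_of_def by (rule ilog_less) auto
  ultimately show "j < block_start n" unfolding block_start_def by linarith
qed

lemma sum_blocks: "(\<Sum>j<block_start L. f j) = (\<Sum>n<L. \<Sum>j\<in>block n. f j)"
proof (induction L)
  case (Suc L)
  have "block_start L \<le> block_start (Suc L)" by (simp add: block_start_mono)
  from sum.atLeastLessThan_concat[OF le0 this, of f] Suc show ?case
    by (simp add: block_def lessThan_atLeast0)
qed simp

definition block_avg :: "(nat \<Rightarrow> 'a::complex_normed_vector) \<Rightarrow> nat \<Rightarrow> 'a" where
  "block_avg u n = complex_of_real (1 / root_size n) *\<^sub>C (\<Sum>j\<in>block n. u j)"

definition block_coeff :: "(nat \<Rightarrow> complex) \<Rightarrow> nat \<Rightarrow> complex" where
  "block_coeff a n = complex_of_real (1 / root_size n) * (\<Sum>j\<in>block n. a j)"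

definition block_var :: "(nat \<Rightarrow> complex) \<Rightarrow> nat \<Rightarrow> real" where
  "block_var a n = (\<Sum>j\<in>block n. (cmod (a j - block_coeff a n / root_size n))\<^sup>2)"

lemma block_var_nonneg: "0 \<le> block_var a n"
  by (simp add: block_var_def sum_nonneg)

lemma block_var_eq: "block_var a n = (\<Sum>j\<in>block n. (cmod (a j))\<^sup>2) - (cmod (block_coeff a n))\<^sup>2"
proof -
  define r where "r = root_size n"
  define b where "b = block_coeff a n"
  have r: "r > 0" by (simp add: r_def)
  have s: "(\<Sum>j\<in>block n. a j) = of_real r * b"
    using r by (simp add: b_def block_coeff_def r_def)
  have "complex_of_real (block_var a n) = (\<Sum>j\<in>block n. (a j - b / r) * cnj (a j - b / r))"
    by (simp only: block_var_def of_real_sum complex_norm_square b_def r_def)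
  also have "\<dots> = (\<Sum>j\<in>block n. a j * cnj (a j)) - (\<Sum>j\<in>block n. a j) * cnj (b / r)
      - (b / r) * cnj (\<Sum>j\<in>block n. a j) + of_nat (card (block n)) * ((b / r) * cnj (b / r))"
    by (simp only: complex_cnj_diff ring_distribs left_diff_distrib right_diff_distrib sum_subtractf sum.distrib
        sum_distrib_left sum_distrib_right cnj_sum sum_constant) (simp add: algebra_simps)
  also have "of_nat (card (block n)) * ((b / r) * cnj (b / r)) = b * cnj b"
  proof -
    show ?thesis using r by (simp add: of_nat_card_block r_def[symmetric])
  qed
  also have "(\<Sum>j\<in>block n. a j) * cnj (b / r) = b * cnj b" using r by (simp add: s)
  also have "(b / r) * cnj (\<Sum>j\<in>block n. a j) = b * cnj b" using r by (simp add: s)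
  finally have "complex_of_real (block_var a n) = (\<Sum>j\<in>block n. a j * cnj (a j)) - b * cnj b" by simp
  also have "\<dots> = complex_of_real ((\<Sum>j\<in>block n. (cmod (a j))\<^sup>2) - (cmod b)\<^sup>2)"
    by (simp only: of_real_diff of_real_sum complex_norm_square)
  finally show ?thesis unfolding b_def of_real_eq_iff .
qed

lemma cinner_sum_block_avg:
  assumes "orthonormal u"
  shows "cinner (\<Sum>j<block_start L. a j *\<^sub>C u j) (block_avg u n) = (if n < L then block_coeff a n else 0)"
proof -
  have "cinner (\<Sum>j<block_start L. a j *\<^sub>C u j) (block_avg u n)
      = complex_of_real (1 / root_size n) * (\<Sum>i\<in>block n. if i < block_start L then a i else 0)"
    unfolding block_avg_def cinner_scaleC_right cinner_sum_right[of _ u]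
    by (simp add: orthonormal_cinner_sum[OF assms] del: cinner_sum_left)
  also have "(\<Sum>i\<in>block n. if i < block_start L then a i else 0) = (if n < L then (\<Sum>i\<in>block n. a i) else 0)"
    by (auto simp: less_block_iff mem_block_iff intro!: sum.cong sum.neutral)
  finally show ?thesis by (simp add: block_coeff_def)
qed

lemma block_avg_expansion:
  "block_avg u k = (\<Sum>j<block_start (Suc k). (if j \<in> block k then complex_of_real (1 / root_size k) else 0) *\<^sub>C u j)"
proof -
  have "(\<Sum>j<block_start (Suc k). (if j \<in> block k then complex_of_real (1 / root_size k) else 0) *\<^sub>C u j)
      = (\<Sum>j\<in>block k. complex_of_real (1 / root_size k) *\<^sub>C u j)"
    by (rule sum.mono_neutral_cong_right) (auto simp: block_def)
  then show ?thesis by (simp add: block_avg_def complex_vector.scale_sum_right)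
qed

lemma orthonormal_block_avg:
  assumes "orthonormal u"
  shows "orthonormal (block_avg u)"
  unfolding orthonormal_def
proof (intro allI)
  fix k n
  have "(\<Sum>j\<in>block n. if j \<in> block k then complex_of_real (1 / root_size k) else 0)
      = (if n = k then of_nat (card (block k)) * complex_of_real (1 / root_size k) else 0)"
    by (auto simp: mem_block_iff)
  then show "cinner (block_avg u k) (block_avg u n) = (if k = n then 1 else 0)"
    unfolding block_avg_expansion[of u k] cinner_sum_block_avg[OF assms]
    by (auto simp: block_coeff_def of_nat_card_block)
qed

text \<open>The two span conditions make the closed span of \<open>dkk\<close> contain \<open>u\<close>, and keep the deviations from
the block means orthogonal to \<open>x\<close>.\<close>

locale dkk_system =
  fixes u x :: "nat \<Rightarrow> 'a::complex_hilbert" and K :: real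
  assumes u: "orthonormal u" and u_dense: "closure (complex_vector.span (range u)) = UNIV"
    and x_span: "x n \<in> complex_vector.span (range (block_avg u))"
    and span_x: "block_avg u n \<in> complex_vector.span (range x)"
    and norm_x: "norm (x n) = 1"
    and K: "1 \<le> K"
    and x_partial_sums: "m \<le> n \<Longrightarrow> norm (\<Sum>j<m. a j *\<^sub>C x j) \<le> K * norm (\<Sum>j<n. a j *\<^sub>C x j)"
begin

definition dkk :: "nat \<Rightarrow> 'a" where
  "dkk j = u j + complex_of_real (1 / root_size (block_of j)) *\<^sub>C (x (block_of j) - block_avg u (block_of j))"

lemma sum_dkk_block:
  "(\<Sum>j\<in>block n. a j *\<^sub>C dkk j) = (\<Sum>j\<in>block n. a j *\<^sub>C u j) - block_coeff a n *\<^sub>C block_avg u n + block_coeff a n *\<^sub>C x n"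
proof -
  have "(\<Sum>j\<in>block n. a j *\<^sub>C dkk j)
      = (\<Sum>j\<in>block n. a j *\<^sub>C u j + (a j * complex_of_real (1 / root_size n)) *\<^sub>C (x n - block_avg u n))"
    by (rule sum.cong) (simp_all add: dkk_def mem_block_iff scaleC_add_right scaleC_scaleC)
  also have "\<dots> = (\<Sum>j\<in>block n. a j *\<^sub>C u j) + block_coeff a n *\<^sub>C (x n - block_avg u n)"
    unfolding sum.distrib block_coeff_def sum_distrib_left complex_vector.scale_sum_left
    by (simp add: mult.commute)
  finally show ?thesis by (simp add: complex_vector.scale_right_diff_distrib)
qed

lemma sum_dkk_averaged:
  "(\<Sum>j\<in>block n. (c / complex_of_real (root_size n)) *\<^sub>C dkk j) = c *\<^sub>C x n"
proof -
  have "block_coeff (\<lambda>_. c / complex_of_real (root_size n)) n = c"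
    by (simp add: block_coeff_def of_nat_card_block)
  moreover have "(\<Sum>j\<in>block n. (c / complex_of_real (root_size n)) *\<^sub>C u j) = c *\<^sub>C block_avg u n"
    by (simp add: block_avg_def scaleC_scaleC complex_vector.scale_sum_right)
  ultimately show ?thesis by (simp add: sum_dkk_block)
qed

text \<open>The deviations from the block means are orthogonal to the block averages, in whose span \<open>x\<close>
lies.\<close>

lemma norm_sum_dkk:
  "(norm (\<Sum>j<block_start L. a j *\<^sub>C dkk j))\<^sup>2
    = (\<Sum>n<L. block_var a n) + (norm (\<Sum>n<L. block_coeff a n *\<^sub>C x n))\<^sup>2"
proof -
  define U where "U = (\<Sum>j<block_start L. a j *\<^sub>C u j)"
  define V where "V = (\<Sum>n<L. block_coeff a n *\<^sub>C block_avg u n)"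
  define X where "X = (\<Sum>n<L. block_coeff a n *\<^sub>C x n)"
  have T: "(\<Sum>j<block_start L. a j *\<^sub>C dkk j) = (U - V) + X"
    unfolding U_def V_def X_def sum_blocks sum_dkk_block by (simp add: sum.distrib sum_subtractf)
  have avg: "cinner (U - V) (block_avg u k) = 0" for k
    unfolding cinner_diff_left U_def V_def cinner_sum_block_avg[OF u]
      orthonormal_cinner_sum[OF orthonormal_block_avg[OF u] finite_lessThan] by simp
  have orth: "cinner (U - V) y = 0" if "y \<in> complex_vector.span (range (block_avg u))" for y
    by (rule cinner_eq_0_span[OF _ that]) (auto simp only: avg)
  have "cinner (U - V) X = 0"
    unfolding X_def by (intro orth complex_vector.span_sum complex_vector.span_scale x_span)
  then have 1: "(norm ((U - V) + X))\<^sup>2 = (norm (U - V))\<^sup>2 + (norm X)\<^sup>2"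
    by (rule norm_add_orthogonal)
  have "V \<in> complex_vector.span (range (block_avg u))"
    unfolding V_def
    by (intro complex_vector.span_sum complex_vector.span_scale complex_vector.span_base) simp
  then have "cinner (U - V) V = 0" by (rule orth)
  then have "(norm ((U - V) + V))\<^sup>2 = (norm (U - V))\<^sup>2 + (norm V)\<^sup>2"
    by (rule norm_add_orthogonal)
  moreover have "(norm U)\<^sup>2 = (\<Sum>n<L. \<Sum>j\<in>block n. (cmod (a j))\<^sup>2)"
    unfolding U_def by (subst orthonormal_norm_sum[OF u]) (simp_all add: sum_blocks)
  moreover have "(norm V)\<^sup>2 = (\<Sum>n<L. (cmod (block_coeff a n))\<^sup>2)"
    unfolding V_def by (rule orthonormal_norm_sum[OF orthonormal_block_avg[OF u]]) simp
  ultimately have "(norm (U - V))\<^sup>2 = (\<Sum>n<L. block_var a n)"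
    by (simp add: block_var_eq sum_subtractf)
  with 1 show ?thesis unfolding T X_def by simp
qed

lemma norm_sum_dkk_le:
  "norm (\<Sum>j<block_start L. a j *\<^sub>C dkk j) \<le> sqrt (\<Sum>j<block_start L. (cmod (a j))\<^sup>2) + (\<Sum>n<L. cmod (block_coeff a n))"
proof (rule power2_le_imp_le)
  let ?P = "sqrt (\<Sum>j<block_start L. (cmod (a j))\<^sup>2)" and ?Q = "\<Sum>n<L. cmod (block_coeff a n)"
  have nn: "0 \<le> (\<Sum>j<block_start L. (cmod (a j))\<^sup>2)" "0 \<le> ?Q" by (simp_all add: sum_nonneg)
  have "(\<Sum>n<L. block_var a n) \<le> (\<Sum>n<L. \<Sum>j\<in>block n. (cmod (a j))\<^sup>2)"
    by (intro sum_mono) (simp add: block_var_eq)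
  also have "\<dots> = ?P\<^sup>2" using nn by (simp add: sum_blocks)
  finally have 1: "(\<Sum>n<L. block_var a n) \<le> ?P\<^sup>2" .
  have "norm (\<Sum>n<L. block_coeff a n *\<^sub>C x n) \<le> ?Q"
    by (rule sum_norm_le) (simp add: norm_scaleC norm_x)
  then have 2: "(norm (\<Sum>n<L. block_coeff a n *\<^sub>C x n))\<^sup>2 \<le> ?Q\<^sup>2"
    by (intro power_mono) auto
  have "0 \<le> ?P * ?Q" using nn by (intro mult_nonneg_nonneg) auto
  then have "?P\<^sup>2 + ?Q\<^sup>2 \<le> (?P + ?Q)\<^sup>2"
    unfolding power2_sum by linarith
  with 1 2 show "(norm (\<Sum>j<block_start L. a j *\<^sub>C dkk j))\<^sup>2 \<le> (?P + ?Q)\<^sup>2"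
    unfolding norm_sum_dkk by linarith
  show "0 \<le> ?P + ?Q" using nn by simp
qed

lemma block_var_sum_le: "(\<Sum>n<L. block_var a n) \<le> (norm (\<Sum>j<block_start L. a j *\<^sub>C dkk j))\<^sup>2"
  unfolding norm_sum_dkk by simp

lemma block_coeff_sum_le: "norm (\<Sum>n<L. block_coeff a n *\<^sub>C x n) \<le> norm (\<Sum>j<block_start L. a j *\<^sub>C dkk j)"
  by (rule power2_le_imp_le) (simp_all add: norm_sum_dkk sum_nonneg block_var_nonneg)

lemma block_coeff_le:
  assumes "n < L"
  shows "cmod (block_coeff a n) \<le> 2 * K * norm (\<Sum>j<block_start L. a j *\<^sub>C dkk j)"
proof -
  let ?F = "norm (\<Sum>j<block_start L. a j *\<^sub>C dkk j)"
  have *: "norm (\<Sum>i<m. block_coeff a i *\<^sub>C x i) \<le> K * ?F" if "m \<le> L" for m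
    by (rule order_trans[OF x_partial_sums[OF that] mult_left_mono[OF block_coeff_sum_le]]) (use K in simp)
  have "cmod (block_coeff a n)
      = norm ((\<Sum>i<Suc n. block_coeff a i *\<^sub>C x i) - (\<Sum>i<n. block_coeff a i *\<^sub>C x i))"
    by (simp add: norm_scaleC norm_x)
  also have "\<dots> \<le> K * ?F + K * ?F"
    by (rule order_trans[OF norm_triangle_ineq4 add_mono[OF * *]]) (use assms in auto)
  finally show ?thesis by simp
qed

lemma block_partial_sum_le:
  assumes "l \<le> L"
  shows "norm (\<Sum>j<block_start l. a j *\<^sub>C dkk j) \<le> K * norm (\<Sum>j<block_start L. a j *\<^sub>C dkk j)"
proof (rule power2_le_imp_le)
  have "(\<Sum>n<l. block_var a n) \<le> (\<Sum>n<L. block_var a n)"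
    using assms by (intro sum_mono2) (auto simp: block_var_nonneg)
  also have "\<dots> \<le> K\<^sup>2 * (\<Sum>n<L. block_var a n)"
    using mult_right_mono[OF one_le_power[OF K, of 2], of "\<Sum>n<L. block_var a n"]
    by (simp add: sum_nonneg block_var_nonneg)
  finally have 1: "(\<Sum>n<l. block_var a n) \<le> K\<^sup>2 * (\<Sum>n<L. block_var a n)" .
  have 2: "(norm (\<Sum>n<l. block_coeff a n *\<^sub>C x n))\<^sup>2 \<le> K\<^sup>2 * (norm (\<Sum>n<L. block_coeff a n *\<^sub>C x n))\<^sup>2"
    unfolding power_mult_distrib[symmetric] by (intro power_mono x_partial_sums assms) auto
  show "(norm (\<Sum>j<block_start l. a j *\<^sub>C dkk j))\<^sup>2 \<le> (K * norm (\<Sum>j<block_start L. a j *\<^sub>C dkk j))\<^sup>2"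
    unfolding power_mult_distrib norm_sum_dkk distrib_left by (rule add_mono[OF 1 2])
qed (use K in simp)

lemma norm_single_block:
  assumes "b < L" and zero: "\<And>j. j \<notin> block b \<Longrightarrow> a j = 0"
  shows "(norm (\<Sum>j<block_start L. a j *\<^sub>C dkk j))\<^sup>2 = (\<Sum>j\<in>block b. (cmod (a j))\<^sup>2)"
proof -
  have "a j = 0" if "n \<noteq> b" "j \<in> block n" for n j
    using that by (intro zero) (auto simp: mem_block_iff)
  then have 0: "block_coeff a n = 0" "block_var a n = 0" if "n \<noteq> b" for n
    using that by (simp_all add: block_coeff_def block_var_def)
  have "(\<Sum>n<L. block_var a n) = (\<Sum>n\<in>{b}. block_var a n)"
    using assms(1) 0 by (intro sum.mono_neutral_right) auto
  moreover have "(\<Sum>n<L. block_coeff a n *\<^sub>C x n) = (\<Sum>n\<in>{b}. block_coeff a n *\<^sub>C x n)"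
    using assms(1) 0 by (intro sum.mono_neutral_right) auto
  ultimately show ?thesis
    unfolding norm_sum_dkk by (simp add: norm_scaleC norm_x block_var_eq)
qed

lemma dkk_dense: "closure (complex_vector.span (range dkk)) = UNIV"
proof -
  have dkk: "c *\<^sub>C dkk j \<in> complex_vector.span (range dkk)" for c j
    by (intro complex_vector.span_scale complex_vector.span_base) simp
  have x: "x n \<in> complex_vector.span (range dkk)" for n
  proof -
    have "x n = (\<Sum>j\<in>block n. (1 / complex_of_real (root_size n)) *\<^sub>C dkk j)"
      unfolding sum_dkk_averaged by (simp add: scaleC_one)
    also have "\<dots> \<in> complex_vector.span (range dkk)"
      by (intro complex_vector.span_sum dkk)
    finally show ?thesis .
  qed
  then have v: "block_avg u n \<in> complex_vector.span (range dkk)" for n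
    using subsetD[OF complex_vector.span_minimal[OF _ complex_vector.subspace_span] span_x] by blast
  have "u j \<in> complex_vector.span (range dkk)" for j
  proof -
    have "u j = 1 *\<^sub>C dkk j - complex_of_real (1 / root_size (block_of j)) *\<^sub>C (x (block_of j) - block_avg u (block_of j))"
      by (simp add: dkk_def scaleC_one)
    also have "\<dots> \<in> complex_vector.span (range dkk)"
      by (intro complex_vector.span_diff complex_vector.span_scale dkk x v)
    finally show ?thesis .
  qed
  then have "complex_vector.span (range u) \<subseteq> complex_vector.span (range dkk)"
    by (intro complex_vector.span_minimal complex_vector.subspace_span) auto
  then show ?thesis using u_dense closure_mono by blast
qed

lemma less_block_end: "n < block_start (Suc (block_of n))"
  by (simp only: less_block_iff)

text \<open>The partial sum consists of complete blocks, handled by the partial sums of \<open>x\<close>, and of a part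
of one block. On a single block the norm is the Euclidean norm of the coefficients, since \<open>x\<close>
is normalized; there any cut is harmless.\<close>

lemma dkk_partial_sums:
  assumes "m \<le> n"
  shows "norm (\<Sum>j<m. a j *\<^sub>C dkk j) \<le> (1 + 3 * K) * norm (\<Sum>j<n. a j *\<^sub>C dkk j)"
proof -
  define L where "L = Suc (block_of n)"
  define F where "F = norm (\<Sum>j<n. a j *\<^sub>C dkk j)"
  define a' where "a' = trunc n a"
  define b where "b = block_of m"
  have n: "n \<le> block_start L" unfolding L_def using less_block_end by (rule less_imp_le)
  have F: "F = norm (\<Sum>j<block_start L. a' j *\<^sub>C dkk j)"
    unfolding F_def a'_def sum_trunc[OF n] ..
  have m: "m \<in> block b" by (simp add: mem_block_iff b_def)
  have "m < block_start L" using assms less_block_end[of n] unfolding L_def by (rule le_less_trans)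
  then have bL: "b < L" unfolding less_block_iff b_def .
  define c where "c j = (if j \<in> {block_start b..<m} then a' j else 0)" for j
  have mb: "block_start b \<le> m" using m by (simp add: block_def)
  have "(\<Sum>j<m. a j *\<^sub>C dkk j) = (\<Sum>j<m. a' j *\<^sub>C dkk j)"
    using assms by (intro sum.cong) (auto simp: a'_def trunc_def)
  also have "\<dots> = (\<Sum>j<block_start b. a' j *\<^sub>C dkk j) + (\<Sum>j\<in>{block_start b..<m}. a' j *\<^sub>C dkk j)"
    unfolding lessThan_atLeast0 by (rule sum.atLeastLessThan_concat[symmetric]) (use mb in auto)
  also have "(\<Sum>j\<in>{block_start b..<m}. a' j *\<^sub>C dkk j) = (\<Sum>j<block_start L. c j *\<^sub>C dkk j)"
    using \<open>m < block_start L\<close> by (intro sum.mono_neutral_cong_left) (auto simp: c_def)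
  finally have split: "(\<Sum>j<m. a j *\<^sub>C dkk j) = (\<Sum>j<block_start b. a' j *\<^sub>C dkk j) + (\<Sum>j<block_start L. c j *\<^sub>C dkk j)" .
  have F0: "0 \<le> F" by (simp add: F_def)
  have "norm (\<Sum>j<block_start L. c j *\<^sub>C dkk j) \<le> (1 + 2 * K) * F"
  proof (rule power2_le_imp_le)
    have "(norm (\<Sum>j<block_start L. c j *\<^sub>C dkk j))\<^sup>2 = (\<Sum>j\<in>block b. (cmod (c j))\<^sup>2)"
      using m by (intro norm_single_block bL) (auto simp: c_def block_def)
    also have "\<dots> \<le> (\<Sum>j\<in>block b. (cmod (a' j))\<^sup>2)"
      by (intro sum_mono) (auto simp: c_def)
    also have "\<dots> = block_var a' b + (cmod (block_coeff a' b))\<^sup>2"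
      by (simp add: block_var_eq)
    also have "\<dots> \<le> F\<^sup>2 + (2 * K * F)\<^sup>2"
    proof (intro add_mono power_mono)
      have "block_var a' b \<le> (\<Sum>n<L. block_var a' n)"
        using bL by (intro member_le_sum) (auto simp: block_var_nonneg)
      then show "block_var a' b \<le> F\<^sup>2"
        using block_var_sum_le[where a = a' and L = L] unfolding F by linarith
      show "cmod (block_coeff a' b) \<le> 2 * K * F"
        unfolding F by (rule block_coeff_le[OF bL])
    qed simp
    also have "\<dots> \<le> (F + 2 * K * F)\<^sup>2"
      using F0 K by (simp add: power2_sum)
    also have "F + 2 * K * F = (1 + 2 * K) * F" by (simp add: algebra_simps)
    finally show "(norm (\<Sum>j<block_start L. c j *\<^sub>C dkk j))\<^sup>2 \<le> ((1 + 2 * K) * F)\<^sup>2" .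
  qed (use F0 K in simp)
  moreover have "norm (\<Sum>j<block_start b. a' j *\<^sub>C dkk j) \<le> K * F"
    unfolding F using bL by (intro block_partial_sum_le) simp
  ultimately have "norm (\<Sum>j<m. a j *\<^sub>C dkk j) \<le> K * F + (1 + 2 * K) * F"
    unfolding split by (intro norm_triangle_le add_mono)
  then show ?thesis unfolding F_def by (simp add: algebra_simps)
qed

lemma norm_dkk: "norm (dkk j) = 1"
proof -
  have "(norm (\<Sum>i<block_start (Suc (block_of j)). (if i = j then 1 else 0) *\<^sub>C dkk i))\<^sup>2
      = (\<Sum>i\<in>block (block_of j). (cmod (if i = j then 1 else 0))\<^sup>2)"
    by (rule norm_single_block) (auto simp: mem_block_iff)
  also have "\<dots> = (\<Sum>i\<in>block (block_of j). if i = j then 1 else 0)"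
    by (intro sum.cong) auto
  also have "\<dots> = 1" by (simp add: mem_block_iff)
  also have "(\<Sum>i<block_start (Suc (block_of j)). (if i = j then 1 else 0) *\<^sub>C dkk i)
      = (\<Sum>i<block_start (Suc (block_of j)). if i = j then dkk i else 0)"
    by (intro sum.cong) (auto simp: scaleC_one)
  also have "\<dots> = dkk j"
    using less_block_end[of j] by simp
  finally show ?thesis by (metis norm_ge_zero power2_eq_iff_nonneg one_power2 zero_le_one)
qed

sublocale schauder_system dkk "1 + 3 * K"
  by unfold_locales (rule norm_dkk dkk_dense dkk_partial_sums, assumption?)+

text \<open>Let \<open>F\<close> be the norm of the whole sum and \<open>C * F\<close> the bound for the scaled block means. A block
is late if this bound forces its mean to be at most \<open>t / 2\<close>. The greedy sum equals the sum over
all early blocks, minus the part \<open>g\<close> not selected there, plus the part \<open>h\<close> selected in late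
blocks. Both \<open>g\<close> and \<open>h\<close> are small in the crude norm of \<open>norm_sum_dkk_le\<close>: for \<open>g\<close> by the
geometric growth of the blocks, for \<open>h\<close> because a coefficient of size at least \<open>t\<close> in a late
block is at most twice its deviation from the mean.\<close>

lemma dkk_greedy:
  assumes t: "t > 0" and G: "G \<subseteq> {..<M}" "\<And>j. j \<in> G \<Longrightarrow> t \<le> cmod (a j)"
    and notG: "\<And>j. j < M \<Longrightarrow> j \<notin> G \<Longrightarrow> cmod (a j) \<le> t"
  shows "norm (\<Sum>j\<in>G. a j *\<^sub>C dkk j) \<le> (17 * K + 3) * norm (\<Sum>j<M. a j *\<^sub>C dkk j)"
proof (cases "G = {}")
  case True
  then show ?thesis using K by simp
next
  case False
  define F where "F = norm (\<Sum>j<M. a j *\<^sub>C dkk j)"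
  have F: "F > 0"
  proof -
    obtain j where j: "j \<in> G" using False by blast
    then have "0 < cmod (a j)" using G(2)[OF j] t by linarith
    also have "\<dots> \<le> 2 * (1 + 3 * K) * F"
      unfolding F_def using j G(1) by (intro coeff_le) auto
    finally show ?thesis using K by (simp add: zero_less_mult_iff)
  qed
  define C where "C = 2 * K"
  have C: "C \<ge> 2" using K by (simp add: C_def)
  define late where "late n \<longleftrightarrow> 2 * C * F \<le> t * root_size n" for n
  have "\<exists>n. late n"
  proof -
    obtain n where n: "2 * C * F / (t * sqrt 3) < 2 ^ n"
      using real_arch_pow[of 2] by auto
    then have "2 * C * F < 2 ^ n * (t * sqrt 3)"
      using t by (simp add: pos_divide_less_eq)
    then show ?thesis unfolding late_def root_size_def by (intro exI[of _ n]) (simp add: mult_ac)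
  qed
  define l where "l = (LEAST n. late n)"
  have late_l: "late l" unfolding l_def using \<open>\<exists>n. late n\<close> by (rule LeastI_ex)
  have late: "late n" if "l \<le> n" for n
  proof -
    have "root_size l \<le> root_size n"
      unfolding root_size_def using that by (intro mult_left_mono power_increasing) auto
    then have "t * root_size l \<le> t * root_size n"
      using t by (intro mult_left_mono) auto
    with late_l show ?thesis unfolding late_def by linarith
  qed
  have early: "t * (\<Sum>n<l. root_size n) \<le> 4 * C * F"
  proof (cases l)
    case 0
    then show ?thesis using C F by simp
  next
    case (Suc l')
    then have "\<not> late l'" unfolding l_def by (metis lessI not_less_Least)
    have geo: "(\<Sum>n<k. root_size n) \<le> sqrt 3 * 2 ^ k" for k
      by (induction k) (simp_all add: root_size_def)
    have "t * (\<Sum>n<l. root_size n) \<le> t * (2 * root_size l')"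
      using geo[of l] t unfolding Suc root_size_def by (intro mult_left_mono) simp_all
    also have "\<dots> \<le> 4 * C * F" using \<open>\<not> late l'\<close> by (simp add: late_def)
    finally show ?thesis .
  qed
  \<comment> \<open>All of \<open>{..<M}\<close> and all early blocks lie below \<open>block_start L\<close>.\<close>
  define L where "L = max M l"
  define a' where "a' = trunc M a"
  have "L < 4 ^ L"
  proof -
    have "L < 2 ^ L" by (rule less_exp)
    also have "\<dots> \<le> (4::nat) ^ L" by (intro power_mono) auto
    finally show ?thesis .
  qed
  moreover have "M \<le> L" by (simp add: L_def)
  ultimately have M: "M \<le> block_start L" unfolding block_start_def by linarith
  have lL: "l \<le> L" by (simp add: L_def)
  have Feq: "F = norm (\<Sum>j<block_start L. a' j *\<^sub>C dkk j)"
    unfolding F_def a'_def sum_trunc[OF M] ..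
  have notG': "cmod (a' j) \<le> t" if "j \<notin> G" for j
    using notG[of j] that t by (auto simp: a'_def trunc_def)
  have G': "t \<le> cmod (a' j)" if "j \<in> G" for j
    using G that by (auto simp: a'_def trunc_def)
  define g where "g j = (if j < block_start l \<and> j \<notin> G then a' j else 0)" for j
  define h where "h j = (if j \<in> G \<and> \<not> j < block_start l then a' j else 0)" for j
  have "(\<Sum>j\<in>G. a j *\<^sub>C dkk j) = (\<Sum>j<block_start L. (if j \<in> G then a' j else 0) *\<^sub>C dkk j)"
    using G(1) M by (intro sum.mono_neutral_cong_left) (auto simp: a'_def trunc_def)
  also have "\<dots> = (\<Sum>j<block_start L. trunc (block_start l) a' j *\<^sub>C dkk j - g j *\<^sub>C dkk j + h j *\<^sub>C dkk j)"
    by (intro sum.cong) (auto simp: trunc_def g_def h_def)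
  also have "\<dots> = (\<Sum>j<block_start L. trunc (block_start l) a' j *\<^sub>C dkk j)
      - (\<Sum>j<block_start L. g j *\<^sub>C dkk j) + (\<Sum>j<block_start L. h j *\<^sub>C dkk j)"
    by (simp only: sum.distrib sum_subtractf)
  also have "(\<Sum>j<block_start L. trunc (block_start l) a' j *\<^sub>C dkk j) = (\<Sum>j<block_start l. a' j *\<^sub>C dkk j)"
    by (intro sum_trunc block_start_mono lL)
  finally have split: "(\<Sum>j\<in>G. a j *\<^sub>C dkk j) = (\<Sum>j<block_start l. a' j *\<^sub>C dkk j)
      - (\<Sum>j<block_start L. g j *\<^sub>C dkk j) + (\<Sum>j<block_start L. h j *\<^sub>C dkk j)" .
  have f: "norm (\<Sum>j<block_start l. a' j *\<^sub>C dkk j) \<le> K * F"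
    unfolding Feq by (rule block_partial_sum_le[OF lL])

  have g_le: "cmod (g j) \<le> (if block_of j < l then t else 0)" for j
    using notG'[of j] t by (auto simp: g_def less_block_iff)
  have g1: "(\<Sum>n<L. cmod (block_coeff g n)) \<le> 4 * C * F"
  proof -
    have "cmod (block_coeff g n) \<le> (if n < l then t * root_size n else 0)" for n
    proof -
      have "cmod (\<Sum>j\<in>block n. g j) \<le> (\<Sum>j\<in>block n. if n < l then t else 0)"
      proof (rule sum_norm_le)
        fix j assume "j \<in> block n"
        then show "cmod (g j) \<le> (if n < l then t else 0)"
          using g_le[of j] by (simp only: mem_block_iff)
      qed
      also have "\<dots> = (root_size n)\<^sup>2 * (if n < l then t else 0)"
        by (simp add: card_block)
      finally have "(1 / root_size n) * cmod (\<Sum>j\<in>block n. g j)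
          \<le> (1 / root_size n) * ((root_size n)\<^sup>2 * (if n < l then t else 0))"
        by (intro mult_left_mono) (simp_all add: less_imp_le)
      also have "\<dots> = (if n < l then t * root_size n else 0)"
        using root_size_pos[of n] by (simp add: power2_eq_square)
      finally show ?thesis
        by (simp add: block_coeff_def norm_mult norm_divide less_imp_le)
    qed
    then have "(\<Sum>n<L. cmod (block_coeff g n)) \<le> (\<Sum>n<L. if n < l then t * root_size n else 0)"
      by (intro sum_mono) auto
    also have "\<dots> = (\<Sum>n<l. t * root_size n)"
      using lL by (intro sum.mono_neutral_cong_right) auto
    also have "\<dots> \<le> 4 * C * F" using early by (simp add: sum_distrib_left)
    finally show ?thesis .
  qed
  have g2: "sqrt (\<Sum>j<block_start L. (cmod (g j))\<^sup>2) \<le> 4 * C * F"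
  proof (rule real_le_lsqrt)
    have "(\<Sum>j<block_start L. (cmod (g j))\<^sup>2) \<le> (\<Sum>n<L. \<Sum>j\<in>block n. if n < l then t\<^sup>2 else 0)"
      unfolding sum_blocks
    proof (intro sum_mono)
      fix n j assume "j \<in> block n"
      then have "cmod (g j) \<le> (if n < l then t else 0)" using g_le[of j] by (simp add: mem_block_iff)
      then have "(cmod (g j))\<^sup>2 \<le> (if n < l then t else 0)\<^sup>2" by (intro power_mono) auto
      then show "(cmod (g j))\<^sup>2 \<le> (if n < l then t\<^sup>2 else 0)" by (simp split: if_splits)
    qed
    also have "\<dots> = (\<Sum>n<L. if n < l then (t * root_size n)\<^sup>2 else 0)"
      by (intro sum.cong) (auto simp: card_block power_mult_distrib)
    also have "\<dots> = (\<Sum>n<l. (t * root_size n)\<^sup>2)"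
      using lL by (intro sum.mono_neutral_cong_right) auto
    also have "\<dots> \<le> (\<Sum>n<l. t * root_size n)\<^sup>2"
    proof -
      have "sqrt (\<Sum>n<l. (t * root_size n)\<^sup>2) \<le> (\<Sum>n<l. t * root_size n)"
        using L2_set_le_sum[of "{..<l}" "\<lambda>n. t * root_size n"] t by (simp add: L2_set_def less_imp_le)
      then show ?thesis by (rule sqrt_le_D)
    qed
    also have "\<dots> \<le> (4 * C * F)\<^sup>2"
      using early t by (intro power_mono) (auto simp: sum_distrib_left[symmetric] less_imp_le intro!: sum_nonneg mult_nonneg_nonneg)
    finally show "(\<Sum>j<block_start L. (cmod (g j))\<^sup>2) \<le> (4 * C * F)\<^sup>2" .
  qed (use C F in auto)

  have h_sq: "(\<Sum>j\<in>block n. (cmod (h j))\<^sup>2) \<le> (if l \<le> n then 4 * block_var a' n else 0)" if n: "n < L" for n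
  proof (cases "l \<le> n")
    case True
    define \<mu> where "\<mu> = block_coeff a' n / root_size n"
    have "cmod (block_coeff a' n) \<le> C * F"
      unfolding Feq C_def by (rule block_coeff_le[OF n])
    also have "\<dots> \<le> (t / 2) * root_size n"
      using late[OF True] by (simp add: late_def)
    finally have \<mu>: "cmod \<mu> \<le> t / 2"
      by (simp add: \<mu>_def norm_divide pos_divide_le_eq less_imp_le)
    have "(cmod (h j))\<^sup>2 \<le> 4 * (cmod (a' j - \<mu>))\<^sup>2" for j
    proof (cases "h j = 0")
      case False
      then have "h j = a' j" "j \<in> G" by (auto simp: h_def split: if_splits)
      then have "cmod \<mu> \<le> cmod (h j) / 2" using \<mu> G'[of j] by simp
      then have "cmod (h j) \<le> 2 * cmod (a' j - \<mu>)"
        using norm_triangle_ineq2[of "a' j" \<mu>] \<open>h j = a' j\<close> by simp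
      then have "(cmod (h j))\<^sup>2 \<le> (2 * cmod (a' j - \<mu>))\<^sup>2" by (intro power_mono) auto
      then show ?thesis by (simp add: power_mult_distrib)
    qed simp
    then have "(\<Sum>j\<in>block n. (cmod (h j))\<^sup>2) \<le> (\<Sum>j\<in>block n. 4 * (cmod (a' j - \<mu>))\<^sup>2)"
      by (intro sum_mono)
    also have "\<dots> = 4 * block_var a' n"
      unfolding block_var_def \<mu>_def sum_distrib_left ..
    finally show ?thesis using True by simp
  next
    case False
    then have "h j = 0" if "j \<in> block n" for j
      using that by (simp add: h_def less_block_iff mem_block_iff)
    then show ?thesis using False by simp
  qed
  have h_sq_var: "(\<Sum>j\<in>block n. (cmod (h j))\<^sup>2) \<le> 4 * block_var a' n" if "n < L" for n
    using h_sq[OF that] block_var_nonneg[of a' n] by (auto split: if_splits)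
  have var: "(\<Sum>n<L. block_var a' n) \<le> F\<^sup>2"
    unfolding Feq by (rule block_var_sum_le)
  have h2: "sqrt (\<Sum>j<block_start L. (cmod (h j))\<^sup>2) \<le> 2 * F"
  proof (rule real_le_lsqrt)
    have "(\<Sum>j<block_start L. (cmod (h j))\<^sup>2) \<le> (\<Sum>n<L. 4 * block_var a' n)"
      unfolding sum_blocks by (intro sum_mono h_sq_var) simp
    also have "\<dots> \<le> (2 * F)\<^sup>2"
      using var by (simp add: sum_distrib_left[symmetric] power_mult_distrib)
    finally show "(\<Sum>j<block_start L. (cmod (h j))\<^sup>2) \<le> (2 * F)\<^sup>2" .
  qed (use F in auto)
  have h1: "(\<Sum>n<L. cmod (block_coeff h n)) \<le> F"
  proof -
    have "C * F * cmod (block_coeff h n) \<le> 2 * block_var a' n" if n: "n < L" for n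
    proof (cases "l \<le> n")
      case True
      \<comment> \<open>Since selected coefficients are at least \<open>t\<close>, their sum is at most the sum of their squares divided by \<open>t\<close>.\<close>
      have "t * cmod (h j) \<le> (cmod (h j))\<^sup>2" for j
        using G'[of j] by (auto simp: h_def power2_eq_square intro: mult_right_mono)
      then have "(\<Sum>j\<in>block n. t * cmod (h j)) \<le> 4 * block_var a' n"
        using h_sq_var[OF n] by (meson order_trans sum_mono)
      moreover have "root_size n * cmod (block_coeff h n) \<le> (\<Sum>j\<in>block n. cmod (h j))"
        using norm_sum[of h "block n"] by (simp add: block_coeff_def norm_mult norm_divide less_imp_le)
      then have "t * (root_size n * cmod (block_coeff h n)) \<le> t * (\<Sum>j\<in>block n. cmod (h j))"
        using t by (intro mult_left_mono) auto
      moreover have "2 * C * F * cmod (block_coeff h n) \<le> t * root_size n * cmod (block_coeff h n)"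
        using late[OF True] unfolding late_def by (intro mult_right_mono) auto
      ultimately show ?thesis by (simp add: sum_distrib_left mult.assoc)
    next
      case False
      then have "h j = 0" if "j \<in> block n" for j
        using that by (simp add: h_def less_block_iff mem_block_iff)
      then show ?thesis by (simp add: block_coeff_def block_var_nonneg)
    qed
    then have "(\<Sum>n<L. C * F * cmod (block_coeff h n)) \<le> (\<Sum>n<L. 2 * block_var a' n)"
      by (intro sum_mono) auto
    also have "\<dots> \<le> 2 * F\<^sup>2" using var by (simp add: sum_distrib_left[symmetric])
    also have "\<dots> \<le> C * F * F" using C F by (simp add: power2_eq_square)
    finally show ?thesis using C F by (simp add: sum_distrib_left[symmetric])
  qed
  have "norm (\<Sum>j\<in>G. a j *\<^sub>C dkk j) \<le> norm (\<Sum>j<block_start l. a' j *\<^sub>C dkk j)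
      + norm (\<Sum>j<block_start L. g j *\<^sub>C dkk j) + norm (\<Sum>j<block_start L. h j *\<^sub>C dkk j)"
    unfolding split by (rule order_trans[OF norm_triangle_ineq add_right_mono[OF norm_triangle_ineq4]])
  also have "\<dots> \<le> K * F + (4 * C * F + 4 * C * F) + (2 * F + F)"
    by (intro add_mono f order_trans[OF norm_sum_dkk_le] g1 g2 h1 h2)
  also have "\<dots> \<le> (17 * K + 3) * F"
    by (simp add: C_def algebra_simps)
  finally show ?thesis unfolding F_def .
qed

lemma quasi_greedy_dkk: "quasi_greedy_basis dkk"
  using dkk_greedy by (rule quasi_greedyI)

text \<open>Coefficients that are constant on blocks turn coordinate projections of \<open>x\<close> into coordinate
projections of \<open>dkk\<close>.\<close>

lemma cond_const_dkk:
  assumes I: "I \<subseteq> {..<L}" "J \<subseteq> I" and N: "4 ^ L \<le> N" and nz: "(\<Sum>n\<in>I. c n *\<^sub>C x n) \<noteq> 0"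
  shows "norm (\<Sum>n\<in>J. c n *\<^sub>C x n) / norm (\<Sum>n\<in>I. c n *\<^sub>C x n) \<le> cond_const dkk N"
proof -
  define a where "a j = c (block_of j) / complex_of_real (root_size (block_of j))" for j
  have sum: "(\<Sum>j\<in>(\<Union>n\<in>S. block n). a j *\<^sub>C dkk j) = (\<Sum>n\<in>S. c n *\<^sub>C x n)" if "finite S" for S
  proof -
    have "(\<Sum>j\<in>(\<Union>n\<in>S. block n). a j *\<^sub>C dkk j) = (\<Sum>n\<in>S. \<Sum>j\<in>block n. a j *\<^sub>C dkk j)"
      using that by (intro sum.UNION_disjoint) (auto simp: mem_block_iff)
    also have "\<dots> = (\<Sum>n\<in>S. \<Sum>j\<in>block n. (c n / complex_of_real (root_size n)) *\<^sub>C dkk j)"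
      by (intro sum.cong) (auto simp: a_def mem_block_iff)
    finally show ?thesis by (simp only: sum_dkk_averaged)
  qed
  have fin: "finite I" "finite J"
    using finite_subset[OF I(1)] finite_subset[OF I(2)] by simp_all
  have "(\<Union>n\<in>J. block n) \<subseteq> {..<block_start L}"
    using I by (auto simp: mem_block_iff less_block_iff)
  then have "card (\<Union>n\<in>J. block n) \<le> block_start L"
    using card_mono[of "{..<block_start L}"] by (metis card_lessThan finite_lessThan)
  then have "card (\<Union>n\<in>J. block n) \<le> N" using N unfolding block_start_def by linarith
  then have "norm (\<Sum>j\<in>(\<Union>n\<in>J. block n). a j *\<^sub>C dkk j) / norm (\<Sum>j\<in>(\<Union>n\<in>I. block n). a j *\<^sub>C dkk j)
      \<le> cond_const dkk N"
    using fin(1) nz UN_mono[OF I(2) order_refl] by (intro cond_const_ge) (simp_all only: sum finite_UN_I finite_block not_False_eq_True)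
  then show ?thesis by (simp only: sum fin)
qed

lemma finite_support_bound:
  fixes a :: "nat \<Rightarrow> complex"
  assumes "finite {j. a j \<noteq> 0}"
  obtains L where "{j. a j \<noteq> 0} \<subseteq> {..<block_start L}"
proof -
  obtain n where "{j. a j \<noteq> 0} \<subseteq> {..<n}" using assms finite_nat_bounded by blast
  then show ?thesis
    using less_block_end[of n] by (intro that[of "Suc (block_of n)"]) (meson lessThan_subset_iff less_imp_le order_trans)
qed

lemma besselian_dkk:
  assumes c: "c > 0" and x: "\<And>a N. c * (\<Sum>n<N. (cmod (a n))\<^sup>2) \<le> (norm (\<Sum>n<N. a n *\<^sub>C x n))\<^sup>2"
  shows "besselian dkk"
  unfolding besselian_def
proof (intro exI[of _ "max 1 (1 / c)"] allI impI)
  fix a :: "nat \<Rightarrow> complex" assume fin: "finite {j. a j \<noteq> 0}"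
  then obtain L where L: "{j. a j \<noteq> 0} \<subseteq> {..<block_start L}" by (rule finite_support_bound)
  let ?m = "max 1 (1 / c)" and ?X = "(norm (\<Sum>n<L. block_coeff a n *\<^sub>C x n))\<^sup>2"
  have "(\<Sum>j | a j \<noteq> 0. (cmod (a j))\<^sup>2) = (\<Sum>j<block_start L. (cmod (a j))\<^sup>2)"
    using L by (intro sum.mono_neutral_left) auto
  also have "\<dots> = (\<Sum>n<L. block_var a n) + (\<Sum>n<L. (cmod (block_coeff a n))\<^sup>2)"
    by (simp add: sum_blocks block_var_eq sum_subtractf)
  also have "\<dots> \<le> ?m * (\<Sum>n<L. block_var a n) + ?m * ?X"
  proof (rule add_mono)
    have "1 * (\<Sum>n<L. block_var a n) \<le> ?m * (\<Sum>n<L. block_var a n)"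
      by (intro mult_right_mono) (auto simp: sum_nonneg block_var_nonneg)
    then show "(\<Sum>n<L. block_var a n) \<le> ?m * (\<Sum>n<L. block_var a n)" by simp
    have "(\<Sum>n<L. (cmod (block_coeff a n))\<^sup>2) \<le> (1 / c) * ?X"
      using x[where a = "block_coeff a" and N = L] c by (simp add: field_simps)
    also have "\<dots> \<le> ?m * ?X" by (intro mult_right_mono) auto
    finally show "(\<Sum>n<L. (cmod (block_coeff a n))\<^sup>2) \<le> ?m * ?X" .
  qed
  also have "\<dots> = ?m * (norm (\<Sum>j<block_start L. a j *\<^sub>C dkk j))\<^sup>2"
    by (simp only: norm_sum_dkk distrib_left)
  also have "(\<Sum>j<block_start L. a j *\<^sub>C dkk j) = (\<Sum>j | a j \<noteq> 0. a j *\<^sub>C dkk j)"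
    using L by (intro sum.mono_neutral_right) auto
  finally show "(\<Sum>j | a j \<noteq> 0. (cmod (a j))\<^sup>2) \<le> ?m * (norm (\<Sum>j | a j \<noteq> 0. a j *\<^sub>C dkk j))\<^sup>2" .
qed

lemma hilbertian_dkk:
  assumes c: "c > 0" and x: "\<And>a N. (norm (\<Sum>n<N. a n *\<^sub>C x n))\<^sup>2 \<le> c * (\<Sum>n<N. (cmod (a n))\<^sup>2)"
  shows "hilbertian dkk"
  unfolding hilbertian_def
proof (intro exI[of _ "1 / max 1 c"] conjI allI impI)
  fix a :: "nat \<Rightarrow> complex" assume fin: "finite {j. a j \<noteq> 0}"
  then obtain L where L: "{j. a j \<noteq> 0} \<subseteq> {..<block_start L}" by (rule finite_support_bound)
  let ?m = "max 1 c" and ?B = "\<Sum>n<L. (cmod (block_coeff a n))\<^sup>2"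
  have "(\<Sum>j | a j \<noteq> 0. a j *\<^sub>C dkk j) = (\<Sum>j<block_start L. a j *\<^sub>C dkk j)"
    using L by (intro sum.mono_neutral_left) auto
  then have "(norm (\<Sum>j | a j \<noteq> 0. a j *\<^sub>C dkk j))\<^sup>2
      = (\<Sum>n<L. block_var a n) + (norm (\<Sum>n<L. block_coeff a n *\<^sub>C x n))\<^sup>2"
    by (simp only: norm_sum_dkk)
  also have "\<dots> \<le> ?m * (\<Sum>n<L. block_var a n) + ?m * ?B"
  proof (rule add_mono)
    have "1 * (\<Sum>n<L. block_var a n) \<le> ?m * (\<Sum>n<L. block_var a n)"
      by (intro mult_right_mono) (auto simp: sum_nonneg block_var_nonneg)
    then show "(\<Sum>n<L. block_var a n) \<le> ?m * (\<Sum>n<L. block_var a n)" by simp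
    have "c * ?B \<le> ?m * ?B" by (intro mult_right_mono) (auto simp: sum_nonneg)
    then show "(norm (\<Sum>n<L. block_coeff a n *\<^sub>C x n))\<^sup>2 \<le> ?m * ?B"
      using x[where a = "block_coeff a" and N = L] by linarith
  qed
  also have "\<dots> = ?m * (\<Sum>j<block_start L. (cmod (a j))\<^sup>2)"
    by (simp add: sum_blocks block_var_eq sum_subtractf distrib_left[symmetric])
  also have "(\<Sum>j<block_start L. (cmod (a j))\<^sup>2) = (\<Sum>j | a j \<noteq> 0. (cmod (a j))\<^sup>2)"
    using L by (intro sum.mono_neutral_right) auto
  finally show "1 / ?m * (norm (\<Sum>j | a j \<noteq> 0. a j *\<^sub>C dkk j))\<^sup>2 \<le> (\<Sum>j | a j \<noteq> 0. (cmod (a j))\<^sup>2)"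
    by (simp add: divide_le_eq mult.commute)
qed (use c in simp)

end

section \<open>Logarithmic growth of the conditionality constants\<close>

text \<open>Lower bounds are available along \<open>N = 4 ^ (4 * 2 ^ m)\<close>; consecutive logarithms of these values
have ratio 2, which is harmless for a power of the logarithm.\<close>

lemma dyadic_exponent:
  fixes N :: nat
  assumes "N \<ge> 4 ^ 4"
  obtains m where "4 ^ (4 * 2 ^ m) \<le> N" "N < 4 ^ (8 * 2 ^ m)"
proof -
  define k where "k = ilog 4 N"
  define m where "m = ilog 2 (k div 4)"
  have k: "4 ^ k \<le> N" "N < 4 ^ Suc k"
    unfolding k_def using assms by (auto intro!: ilog_le ilog_less simp del: power_Suc)
  have "(4::nat) ^ 4 < 4 ^ Suc k" using assms k(2) by (rule le_less_trans)
  then have "4 \<le> k" by (simp only: power_strict_increasing_iff less_Suc_eq_le)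
  then have "2 ^ m \<le> k div 4" "k div 4 < 2 ^ Suc m"
    unfolding m_def by (auto intro!: ilog_le ilog_less simp del: power_Suc)
  then have "4 * 2 ^ m \<le> k" "Suc k \<le> 8 * 2 ^ m" by auto
  then have "(4::nat) ^ (4 * 2 ^ m) \<le> 4 ^ k" "(4::nat) ^ Suc k \<le> 4 ^ (8 * 2 ^ m)"
    by (auto intro!: power_increasing simp del: power_Suc)
  with k show ?thesis by (intro that[of m]) linarith+
qed

lemma log_growth:
  fixes f :: "nat \<Rightarrow> real"
  assumes \<beta>: "\<beta> > 0" and one: "\<And>N. N \<ge> 1 \<Longrightarrow> 1 \<le> f N"
    and f: "\<And>m N. 4 ^ (4 * 2 ^ m) \<le> N \<Longrightarrow> (2 ^ m) powr \<beta> / 2 \<le> f N"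
  shows "\<forall>N\<ge>2. (1 / (8 * ln 4)) powr \<beta> / 2 * (ln (real N)) powr \<beta> \<le> f N"
proof (intro allI impI)
  fix N :: nat assume N: "N \<ge> 2"
  have ln4: "ln (4::real) > 0" by simp
  have N0: "0 \<le> ln (real N)" using N by simp
  have eq: "(1 / (8 * ln 4)) powr \<beta> / 2 * (ln (real N)) powr \<beta> = (ln (real N) / (8 * ln 4)) powr \<beta> / 2"
    using N0 ln4 by (simp add: powr_divide powr_mult)
  show "(1 / (8 * ln 4)) powr \<beta> / 2 * (ln (real N)) powr \<beta> \<le> f N"
  proof (cases "N \<ge> 4 ^ 4")
    case True
    then obtain m where m: "4 ^ (4 * 2 ^ m) \<le> N" "N < 4 ^ (8 * 2 ^ m)" by (rule dyadic_exponent)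
    have "real N \<le> 4 ^ (8 * 2 ^ m)" using m(2) by (metis less_imp_le of_nat_le_iff of_nat_numeral of_nat_power)
    then have "ln (real N) \<le> ln (4 ^ (8 * 2 ^ m))" using N by simp
    also have "\<dots> = real (8 * 2 ^ m) * ln 4" by (rule ln_realpow)
    finally have "ln (real N) / (8 * ln 4) \<le> 2 ^ m" using ln4 by (simp add: field_simps)
    then have "(ln (real N) / (8 * ln 4)) powr \<beta> \<le> (2 ^ m) powr \<beta>"
      using N0 ln4 \<beta> by (intro powr_mono2) auto
    then show ?thesis unfolding eq using f[OF m(1)] by linarith
  next
    case False
    then have "real N \<le> 4 ^ 4" by (metis le_cases of_nat_le_iff of_nat_numeral of_nat_power)
    then have "ln (real N) \<le> ln (4 ^ 4)" using N by simp
    also have "\<dots> = real 4 * ln 4" by (rule ln_realpow)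
    finally have "ln (real N) \<le> 4 * ln 4" by simp
    then have "ln (real N) \<le> 8 * ln 4" using ln4 by linarith
    then have "ln (real N) / (8 * ln 4) \<le> 1" using ln4 by (simp add: pos_divide_le_eq)
    then have "(ln (real N) / (8 * ln 4)) powr \<beta> \<le> 1 powr \<beta>"
      using N0 ln4 \<beta> by (intro powr_mono2) auto
    then show ?thesis unfolding eq using one[of N] N by simp
  qed
qed

text \<open>The choice \<open>\<rho> = 2 powr (s - 1)\<close>, \<open>\<rho>' = 2 powr (t - 1)\<close> makes \<open>\<rho> / \<rho>'\<close> equal
to \<open>2 powr (s - t)\<close>. The range from \<open>1/4\<close> to 1 of the parameters corresponds to exponents
between \<open>-1\<close> and 1, and \<open>1/2\<close> to 0.\<close>

lemma exists_conditional_quasi_greedy_basis: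
  fixes u :: "nat \<Rightarrow> 'a::complex_hilbert" and s t :: real
  assumes u: "orthonormal u" "closure (complex_vector.span (range u)) = UNIV"
    and st: "- 1 < t" "t < s" "s < 1"
  obtains e :: "nat \<Rightarrow> 'a" and c where "quasi_greedy_basis e" "c > 0"
    "\<forall>N\<ge>2. c * (ln (real N)) powr ((s - t) / 2) \<le> cond_const e N"
    "0 \<le> t \<Longrightarrow> besselian e" "s \<le> 0 \<Longrightarrow> hilbertian e"
proof -
  define \<rho> where "\<rho> = 2 powr (s - 1)"
  define \<rho>' where "\<rho>' = 2 powr (t - 1)"
  define \<beta> where "\<beta> = (s - t) / 2"
  have half: "2 powr (- 1 :: real) = 1 / 2" by (simp add: powr_minus_divide)
  have "2 powr (- 2 :: real) = 1 / 4" by (simp add: powr_minus_divide)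
  then have quarter: "1 / 4 < 2 powr (r - 1 :: real)" if "- 1 < r" for r
    using powr_less_mono[of "- 2" "r - 1" "2 :: real"] that by (simp only:)
  have less_1: "2 powr (r - 1 :: real) < 1" if "r < 1" for r
    using powr_less_mono[of "r - 1" 0 "2 :: real"] that by simp
  have ge_half: "1 / 2 \<le> 2 powr (r - 1 :: real)" if "0 \<le> r" for r
    unfolding half[symmetric] by (rule powr_mono) (use that in simp_all)
  have le_half: "2 powr (r - 1 :: real) \<le> 1 / 2" if "r \<le> 0" for r
    unfolding half[symmetric] by (rule powr_mono) (use that in simp_all)
  interpret pair_system \<rho> \<rho>' "block_avg u"
    unfolding \<rho>_def \<rho>'_def using st by (intro pair_system.intro quarter less_1 orthonormal_block_avg u(1)) simp_all
  obtain K where K: "1 \<le> K"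
    "\<And>a m n. m \<le> n \<Longrightarrow> norm (\<Sum>j<m. a j *\<^sub>C pair_basis j) \<le> K * norm (\<Sum>j<n. a j *\<^sub>C pair_basis j)"
    by (rule pair_basis_partial_sums) blast
  interpret D: dkk_system u pair_basis K
    using u K by unfold_locales (auto intro: pair_basis_in_span v_in_span norm_pair_basis)
  have growth: "(2 ^ m) powr \<beta> / 2 \<le> cond_const D.dkk N" if N: "4 ^ (4 * 2 ^ m) \<le> N" for m N
  proof -
    define R where "R = {2 ^ m - 1..<2 ^ Suc m - 1 :: nat}"
    define J where "J = (\<lambda>n. 2 * n) ` R"
    define J' where "J' = (\<lambda>n. Suc (2 * n)) ` R"
    define c where "c n = (if even n then 1 else - 1 :: complex)" for n :: nat
    have J: "(\<Sum>n\<in>J. c n *\<^sub>C pair_basis n) = (\<Sum>n\<in>R. pair_basis (2 * n))"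
      unfolding J_def by (subst sum.reindex) (auto simp: c_def scaleC_one inj_on_def)
    have J': "(\<Sum>n\<in>J'. c n *\<^sub>C pair_basis n) = - (\<Sum>n\<in>R. pair_basis (Suc (2 * n)))"
      unfolding J'_def by (subst sum.reindex) (auto simp: c_def scaleC_one inj_on_def sum_negf)
    have "J \<inter> J' = {}" unfolding J_def J'_def by (auto, presburger)
    then have I: "(\<Sum>n\<in>J \<union> J'. c n *\<^sub>C pair_basis n) = (\<Sum>n\<in>R. pair_basis (2 * n) - pair_basis (Suc (2 * n)))"
      by (subst sum.union_disjoint) (auto simp: J J' sum_subtractf, auto simp: J_def J'_def R_def)
    have nI: "(norm (\<Sum>n\<in>J \<union> J'. c n *\<^sub>C pair_basis n))\<^sup>2 = 2 * (4 * \<rho>') ^ m"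
      unfolding I R_def by (rule norm_alternating)
    have nJ: "(norm (\<Sum>n\<in>J. c n *\<^sub>C pair_basis n))\<^sup>2 = ((4 * \<rho>) ^ m + (4 * \<rho>') ^ m) / 2"
      unfolding J R_def by (rule norm_even_half)
    have pos: "0 < (4 * \<rho>') ^ m" "0 < (4 * \<rho>) ^ m" by (auto simp: \<rho>_def \<rho>'_def)
    have "norm (\<Sum>n\<in>J. c n *\<^sub>C pair_basis n) / norm (\<Sum>n\<in>J \<union> J'. c n *\<^sub>C pair_basis n) \<le> cond_const D.dkk N"
    proof (rule D.cond_const_dkk[OF _ _ N])
      show "J \<union> J' \<subseteq> {..<4 * 2 ^ m}"
        by (auto simp: J_def J'_def R_def)
      show "(\<Sum>n\<in>J \<union> J'. c n *\<^sub>C pair_basis n) \<noteq> 0"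
        using nI rho'(1) by auto
    qed auto
    moreover have "(2 ^ m) powr \<beta> / 2 \<le> norm (\<Sum>n\<in>J. c n *\<^sub>C pair_basis n) / norm (\<Sum>n\<in>J \<union> J'. c n *\<^sub>C pair_basis n)"
    proof (rule power2_le_imp_le)
      have "((2 ^ m) powr \<beta>)\<^sup>2 = (2 powr (s - t)) ^ m"
        by (simp add: \<beta>_def powr_power powr_realpow[symmetric] powr_powr mult.commute del: powr_realpow)
      also have "2 powr (s - t) = \<rho> / \<rho>'"
        by (simp add: \<rho>_def \<rho>'_def powr_diff[symmetric])
      also have "(\<rho> / \<rho>') ^ m = (4 * \<rho>) ^ m / (4 * \<rho>') ^ m"
        by (simp add: power_divide[symmetric])
      finally have "((2 ^ m) powr \<beta> / 2)\<^sup>2 = (4 * \<rho>) ^ m / 2 / (2 * (4 * \<rho>') ^ m)"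
        by (simp add: power_divide)
      also have "\<dots> \<le> ((4 * \<rho>) ^ m + (4 * \<rho>') ^ m) / 2 / (2 * (4 * \<rho>') ^ m)"
        using pos by (intro divide_right_mono) auto
      finally show "((2 ^ m) powr \<beta> / 2)\<^sup>2
          \<le> (norm (\<Sum>n\<in>J. c n *\<^sub>C pair_basis n) / norm (\<Sum>n\<in>J \<union> J'. c n *\<^sub>C pair_basis n))\<^sup>2"
        unfolding power_divide[of "norm _"] nI nJ .
    qed auto
    ultimately show ?thesis by linarith
  qed
  show ?thesis
  proof (rule that[of D.dkk])
    show "quasi_greedy_basis D.dkk" by (rule D.quasi_greedy_dkk)
    show "0 < (1 / (8 * ln 4)) powr \<beta> / (2::real)" by simp
    show "\<forall>N\<ge>2. (1 / (8 * ln 4)) powr \<beta> / 2 * (ln (real N)) powr ((s - t) / 2) \<le> cond_const D.dkk N"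
      unfolding \<beta>_def[symmetric]
      using st by (intro log_growth growth D.cond_const_ge_1) (auto simp: \<beta>_def)
    show "besselian D.dkk" if "0 \<le> t"
    proof -
      have "1 / 2 \<le> \<rho>" "1 / 2 \<le> \<rho>'"
        unfolding \<rho>_def \<rho>'_def using that st by (intro ge_half; linarith)+
      then obtain c where "c > 0" "\<And>a N. c * (\<Sum>j<N. (cmod (a j))\<^sup>2) \<le> (norm (\<Sum>j<N. a j *\<^sub>C pair_basis j))\<^sup>2"
        by (rule pair_basis_besselian) blast
      then show ?thesis by (rule D.besselian_dkk)
    qed
    show "hilbertian D.dkk" if "s \<le> 0"
    proof -
      have "\<rho> \<le> 1 / 2" "\<rho>' \<le> 1 / 2"
        unfolding \<rho>_def \<rho>'_def using that st by (intro le_half; linarith)+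
      then obtain c where "c > 0" "\<And>a N. (norm (\<Sum>j<N. a j *\<^sub>C pair_basis j))\<^sup>2 \<le> c * (\<Sum>j<N. (cmod (a j))\<^sup>2)"
        by (rule pair_basis_hilbertian) blast
      then show ?thesis by (rule D.hilbertian_dkk)
    qed
  qed
qed

text \<open>The logarithm stays above \<open>ln 2\<close>, so that lowering the exponent costs only a constant, also
when the smaller exponent is negative.\<close>

lemma log_growth_smaller_exponent:
  fixes f :: "nat \<Rightarrow> real"
  assumes f: "\<forall>N\<ge>2. c * (ln (real N)) powr \<beta> \<le> f N" and c: "c > 0" and le: "\<alpha> \<le> \<beta>"
  shows "\<exists>c'>0. \<forall>N\<ge>2. c' * (ln (real N)) powr \<alpha> \<le> f N"
proof (intro exI[of _ "c * ln 2 powr (\<beta> - \<alpha>)"] conjI allI impI)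
  show "0 < c * ln 2 powr (\<beta> - \<alpha>)" using c by simp
  fix N :: nat assume N: "N \<ge> 2"
  then have "ln 2 powr (\<beta> - \<alpha>) \<le> ln (real N) powr (\<beta> - \<alpha>)"
    using le by (intro powr_mono2) auto
  then have "c * (ln 2 powr (\<beta> - \<alpha>) * ln (real N) powr \<alpha>) \<le> c * (ln (real N) powr (\<beta> - \<alpha>) * ln (real N) powr \<alpha>)"
    using c by (intro mult_left_mono mult_right_mono) auto
  also have "\<dots> = c * ln (real N) powr \<beta>"
    using N by (simp add: powr_add[symmetric])
  also have "\<dots> \<le> f N" using f N by blast
  finally show "c * ln 2 powr (\<beta> - \<alpha>) * ln (real N) powr \<alpha> \<le> f N"
    by (simp add: mult.assoc)
qed

theorem theorem1p2:
  fixes \<alpha> :: real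
  assumes separable: "separable_space (euclidean :: 'a::complex_hilbert topology)"
    and infinite_dim: "\<nexists>B :: 'a set. finite B \<and> complex_vector.span B = UNIV"
    and alpha: "\<alpha> < 1"
  shows "(\<exists>(e :: nat \<Rightarrow> 'a) c. quasi_greedy_basis e \<and> c > 0 \<and>
            (\<forall>N\<ge>2. cond_const e N \<ge> c * (ln (real N)) powr \<alpha>))
    \<and> (\<alpha> < 1/2 \<longrightarrow>
          (\<exists>(e :: nat \<Rightarrow> 'a) c. quasi_greedy_basis e \<and> besselian e \<and> c > 0 \<and>
            (\<forall>N\<ge>2. cond_const e N \<ge> c * (ln (real N)) powr \<alpha>)))
    \<and> (\<alpha> < 1/2 \<longrightarrow>
          (\<exists>(e :: nat \<Rightarrow> 'a) c. quasi_greedy_basis e \<and> hilbertian e \<and> c > 0 \<and>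
            (\<forall>N\<ge>2. cond_const e N \<ge> c * (ln (real N)) powr \<alpha>)))"
proof -
  obtain u :: "nat \<Rightarrow> 'a" where u: "orthonormal u" "closure (complex_vector.span (range u)) = UNIV"
    using exists_orthonormal_basis[OF separable infinite_dim] by blast
  have main: "\<exists>(e :: nat \<Rightarrow> 'a) c. quasi_greedy_basis e \<and> c > 0 \<and>
      (\<forall>N\<ge>2. c * (ln (real N)) powr \<alpha> \<le> cond_const e N) \<and> (0 \<le> t \<longrightarrow> besselian e) \<and> (s \<le> 0 \<longrightarrow> hilbertian e)"
    if st: "- 1 < t" "t < s" "s < 1" "\<alpha> \<le> (s - t) / 2" for s t :: real
  proof -
    obtain e :: "nat \<Rightarrow> 'a" and c where e: "quasi_greedy_basis e" "c > 0"
      "\<forall>N\<ge>2. c * (ln (real N)) powr ((s - t) / 2) \<le> cond_const e N"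
      "0 \<le> t \<Longrightarrow> besselian e" "s \<le> 0 \<Longrightarrow> hilbertian e"
      using exists_conditional_quasi_greedy_basis[OF u st(1,2,3)] by blast
    show ?thesis using log_growth_smaller_exponent[OF e(3,2) st(4)] e(1,4,5) by blast
  qed
  \<comment> \<open>A positive exponent is needed to separate the two parameters; the constant \<open>1/4\<close> stays below \<open>1/2\<close>.\<close>
  define \<beta> where "\<beta> = max \<alpha> (1/4)"
  have \<beta>: "0 < \<beta>" "\<beta> < 1" "\<alpha> \<le> \<beta>" "\<alpha> < 1/2 \<Longrightarrow> \<beta> < 1/2"
    using alpha by (auto simp: \<beta>_def)
  show ?thesis
  proof (intro conjI impI)
    show "\<exists>(e :: nat \<Rightarrow> 'a) c. quasi_greedy_basis e \<and> c > 0 \<and>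
        (\<forall>N\<ge>2. cond_const e N \<ge> c * (ln (real N)) powr \<alpha>)"
      using main[of "- \<beta>" \<beta>] \<beta>(1,2,3) by auto
    assume "\<alpha> < 1/2"
    then show "\<exists>(e :: nat \<Rightarrow> 'a) c. quasi_greedy_basis e \<and> besselian e \<and> c > 0 \<and>
        (\<forall>N\<ge>2. cond_const e N \<ge> c * (ln (real N)) powr \<alpha>)"
      using main[of 0 "2 * \<beta>"] \<beta> by force
    show "\<exists>(e :: nat \<Rightarrow> 'a) c. quasi_greedy_basis e \<and> hilbertian e \<and> c > 0 \<and>
        (\<forall>N\<ge>2. cond_const e N \<ge> c * (ln (real N)) powr \<alpha>)"
      using main[of "- 2 * \<beta>" 0] \<beta> \<open>\<alpha> < 1/2\<close> by force
  qed
qed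

end
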